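(* Let $h\ge 2$ be an integer and let $L(x_1,\dots,x_h)=u_1x_1+\cdots+u_hx_h$ with $u_1,\dots,u_h\in\mathbb{Z}\setminus\{0\}$ and $\gcd(u_1,\dots,u_h)=1$. Let $p:\mathbb{N}\to(0,1)$ satisfy $p(N)\to 0$ and $Np(N)\to\infty$, and let $A\subseteq I_N$ be the random subset in which each element of $I_N$ is included independently with probability $p(N)$. Then: (i) If $p(N)=o\big(N^{-\frac{h-1}{h}}\big)$, then $|L(A)|\sim \dfrac{(N p(N))^h}{\theta_L}$. (ii) If $p(N)=cN^{-\frac{h-1}{h}}$ for some constant $c>0$, then $$|L(A)|\sim\left(\sum_{i=1}^h|u_i|-2\int_0^{m/2}\exp\left(-\frac{c^h\sum_{t_1=0}^{|u_1|-1}\cdots\sum_{t_h=0}^{|u_h|-1}\mathsf{IH}_h\big(x-\sum_{i=1}^h t_i\big)}{\theta_L\prod_{i=1}^h|u_i|}\right)dx\right)N,$$ $$|L(A)^c|\sim\left(2\int_0^{m/2}\exp\left(-\frac{c^h\sum_{t_1=0}^{|u_1|-1}\cdots\sum_{t_h=0}^{|u_h|-1}\mathsf{IH}_h\big(x-\sum_{i=1}^h t_i\big)}{\theta_L\prod_{i=1}^h|u_i|}\right)dx\right)N.$$ (iii) If $N^{-\frac{h-1}{h}}=o(p(N))$, then $$|L(A)^c|\sim\frac{2\,\Gamma\!\left(\frac{1}{h-1}\right)\sqrt[h-1]{(h-1)!\,\theta_L\prod_{i=1}^h|u_i|}}{(h-1)\,p(N)^{\frac{h}{h-1}}},$$ where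 $\Gamma$ is the Gamma function.
   Context: $I_N=\{0,1,\dots,N\}$; intervals $[a,b]$ denote $[a,b]\cap\mathbb{Z}$. For the linear form $L$ with coefficients $u_1,\dots,u_h$: $s=\sum_{i:u_i>0}u_i$, $d=\sum_{i:u_i<0}|u_i|$, $m=s+d=\sum_i|u_i|$. For $A\subseteq I_N$, $L(A)=\{u_1a_1+\cdots+u_ha_h: a_i\in A\}\subseteq[-dN,sN]$, and $L(A)^c=[-dN,sN]\setminus L(A)$. $\theta_L$ is the number of permutations $\sigma$ of $\{1,\dots,h\}$ with $(u_{\sigma(1)},\dots,u_{\sigma(h)})=(u_1,\dots,u_h)$. $\mathsf{IH}_h$ is the Irwin–Hall density of order $h$: $\mathsf{IH}_h(x)=\frac{1}{(h-1)!}\sum_{j=0}^h(-1)^j\binom{h}{j}(x-j)_+^{h-1}$ for $x\le h$ and $\mathsf{IH}_h(x)=0$ for $x>h$, where $y_+=\max\{0,y\}$. For a random variable $X=X_N$ and a function $f(N)$, $X\sim f(N)$ means: for all $\epsilon_1,\epsilon_2>0$, for all sufficiently large $N$, $\Pr\big(X\notin[(1-\epsilon_1)f(N),(1+\epsilon_1)f(N)]\big)<\epsilon_2$. All asymptotics are as $N\to\infty$. *)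

theory Defs
  imports
    "HOL-Probability.Probability"
    "HOL-Library.Landau_Symbols"
    "HOL-Combinatorics.Permutations"
begin

text \<open>A linear form \<open>u\<^sub>1 x\<^sub>1 + \<dots> + u\<^sub>h x\<^sub>h\<close> is represented by \<open>h\<close> and a
  function \<open>u\<close>, of which only the values on \<open>{1..h}\<close> matter.\<close>

definition pos_sum :: "nat \<Rightarrow> (nat \<Rightarrow> int) \<Rightarrow> int" where
  "pos_sum h u = (\<Sum>i\<in>{i\<in>{1..h}. u i > 0}. u i)"

definition neg_sum :: "nat \<Rightarrow> (nat \<Rightarrow> int) \<Rightarrow> int" where
  "neg_sum h u = (\<Sum>i\<in>{i\<in>{1..h}. u i < 0}. \<bar>u i\<bar>)"

definition abs_sum :: "nat \<Rightarrow> (nat \<Rightarrow> int) \<Rightarrow> int" where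
  "abs_sum h u = (\<Sum>i=1..h. \<bar>u i\<bar>)"

definition form_values :: "nat \<Rightarrow> (nat \<Rightarrow> int) \<Rightarrow> int set \<Rightarrow> int set" where
  "form_values h u A = {\<Sum>i=1..h. u i * a i | a. \<forall>i\<in>{1..h}. a i \<in> A}"

definition missing_values :: "nat \<Rightarrow> (nat \<Rightarrow> int) \<Rightarrow> nat \<Rightarrow> int set \<Rightarrow> int set" where
  "missing_values h u N A =
     {- (neg_sum h u * int N)..pos_sum h u * int N} - form_values h u A"

definition form_symmetries :: "nat \<Rightarrow> (nat \<Rightarrow> int) \<Rightarrow> nat" where
  "form_symmetries h u = card {\<sigma>. \<sigma> permutes {1..h} \<and> (\<forall>i\<in>{1..h}. u (\<sigma> i) = u i)}"

definition Irwin_Hall :: "nat \<Rightarrow> real \<Rightarrow> real" where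
  "Irwin_Hall h x =
     (if x \<le> real h
      then 1 / fact (h - 1) *
        (\<Sum>j=0..h. (-1) ^ j * real (h choose j) * (max 0 (x - real j)) ^ (h - 1))
      else 0)"

text \<open>The law of the random subset of \<open>{0, \<dots>, N}\<close> that contains each element
  independently with probability \<open>q\<close> (meaningful for \<open>0 \<le> q \<le> 1\<close>).\<close>

definition random_subset :: "nat \<Rightarrow> real \<Rightarrow> int set pmf" where
  "random_subset N q =
     map_pmf (\<lambda>b. {x \<in> {0..int N}. b x})
       (Pi_pmf {0..int N} False (\<lambda>_. bernoulli_pmf q))"

text \<open>The relation \<open>X\<^sub>N \<sim> f(N)\<close>, where \<open>X N\<close> is a random variable on the
  probability space given by \<open>M N\<close>.\<close>

definition concentrates ::
    "(nat \<Rightarrow> 'a pmf) \<Rightarrow> (nat \<Rightarrow> 'a \<Rightarrow> real) \<Rightarrow> (nat \<Rightarrow> real) \<Rightarrow> bool" where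
  "concentrates M X f \<longleftrightarrow>
     (\<forall>\<epsilon>\<^sub>1>0. \<forall>\<epsilon>\<^sub>2>0. \<forall>\<^sub>F N in sequentially.
        measure_pmf.prob (M N)
          {\<omega>. X N \<omega> \<notin> {(1 - \<epsilon>\<^sub>1) * f N..(1 + \<epsilon>\<^sub>1) * f N}} < \<epsilon>\<^sub>2)"

end

theory Submission
  imports Defs "HOL-Number_Theory.Cong"
begin

text \<open>
  Write \<open>P(n)\<close> for the probability that \<open>n\<close> has no representation by elements of the random set.
  Up to permutations fixing the coefficients, the injective representations of \<open>n\<close> are almost
  disjoint sets of size \<open>h\<close>, so Harris' inequality from below and Janson's inequality from above
  give \<open>P(n) \<approx> exp (- p\<^sup>h r(n) / \<theta>)\<close>, where \<open>r(n)\<close> counts representations inside \<open>{0..N}\<close> and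
  \<open>\<theta>\<close> is the number of symmetries; the same estimate for pairs of targets gives
  asymptotic independence. All error terms reduce to one count: tuples with \<open>w\<close> distinct entries that
  satisfy one or two independent linear equations number \<open>O(M ^ (w - 1))\<close> or \<open>O(M ^ (w - 2))\<close>.

  In the two dense regimes there is a natural scale \<open>s\<close> (\<open>s = N\<close>, respectively
  \<open>s = p powr (- h / (h - 1))\<close>) with \<open>p ^ h * s ^ (h - 1)\<close> constant. For the targets at distance \<open>k < T s\<close> from
  either end of the range, \<open>p\<^sup>h r / \<theta>\<close> is a function of \<open>k / s\<close> up to \<open>o(1)\<close>, the sum of the
  \<open>P(n)\<close> is a Riemann sum, and the second moment method applies. At criticality these targets are
  everything; above it, the remaining ones are controlled by applying Janson's inequality with the
  density lowered to the point where its two terms balance. Below criticality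
  a first moment bound on collisions suffices.
\<close>

subsection \<open>Product measures on subsets\<close>

text \<open>The errors are governed by a window, not by \<open>N\<close>: a value at distance
  \<open>k\<close> from an end is represented by at most \<open>M = 2 * \<kappa>\<close> elements
  near the two ends, where \<open>k < \<kappa>\<close>. Once \<open>p ^ h * M ^ (h - 1)\<close> is
  bounded, both error terms are at most a constant over \<open>p * M\<close>, so one estimate serves
  the scale \<open>N\<close> and the much shorter supercritical scale. Two kinds of targets resist
  the count of tuples. For \<open>n = 0\<close> the merged coefficients may all cancel, and the
  equation then restricts nothing; for \<open>\<bar>n\<bar> = \<bar>n'\<bar>\<close> the two
  equations may be dependent. Both kinds are rare enough for their probabilities to be bounded by 1.
  The second moment method needs the mean only from below and the second moment only from above. So
  Harris is applied to single targets and Janson to pairs, never the other way round. Away from the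
  ends, Janson's correction relative to its main term is of order
  \<open>q ^ (h - 1) * k ^ (h - 2)\<close>, which may exceed 1. Being missed is a decreasing event,
  so a smaller density \<open>q\<close> still gives a valid upper bound, and the best one makes this
  ratio a small constant.\<close>

lemma sum_Pow_insert:
  assumes "finite I" "a \<notin> I"
  shows "(\<Sum>J\<in>Pow (insert a I). f J) = (\<Sum>J\<in>Pow I. f J + f (insert a J))"
proof -
  have "(\<Sum>J\<in>Pow (insert a I). f J) = (\<Sum>J\<in>Pow I. f J) + (\<Sum>J\<in>insert a ` Pow I. f J)"
    unfolding Pow_insert using assms by (intro sum.union_disjoint) auto
  also have "(\<Sum>J\<in>insert a ` Pow I. f J) = (\<Sum>J\<in>Pow I. f (insert a J))"
    using assms by (intro sum.reindex_cong[where l = "insert a"]) (auto simp: inj_on_def)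
  finally show ?thesis by (simp add: sum.distrib)
qed

text \<open>Expectation under the product measure of density \<open>q\<close>, kept as a finite sum
  so that inequalities follow by induction on \<open>V\<close> without measurability or
  integrability. Only \<open>prob_random_subset\<close> returns to \<open>pmf\<close>.\<close>

definition subset_exp :: "'a set \<Rightarrow> real \<Rightarrow> ('a set \<Rightarrow> real) \<Rightarrow> real" where
  "subset_exp V q f = (\<Sum>S\<in>Pow V. q ^ card S * (1 - q) ^ card (V - S) * f S)"

lemma subset_exp_empty [simp]: "subset_exp {} q f = f {}"
  by (simp add: subset_exp_def)

lemma subset_exp_cong: "(\<And>S. S \<subseteq> V \<Longrightarrow> f S = g S) \<Longrightarrow> subset_exp V q f = subset_exp V q g"
  unfolding subset_exp_def by (intro sum.cong) auto

text \<open>Conditioning on whether \<open>x\<close> is chosen; the inductions over \<open>V\<close>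
  below run on this recursion.\<close>

lemma subset_exp_insert:
  assumes "finite V" "x \<notin> V"
  shows "subset_exp (insert x V) q f = q * subset_exp V q (\<lambda>S. f (insert x S)) + (1 - q) * subset_exp V q f"
proof -
  let ?w = "\<lambda>S. q ^ card S * (1 - q) ^ card (insert x V - S) * f S"
  have "subset_exp (insert x V) q f = (\<Sum>S\<in>Pow V. ?w S) + (\<Sum>S\<in>Pow V. ?w (insert x S))"
    unfolding subset_exp_def sum_Pow_insert[OF assms] sum.distrib ..
  also have "(\<Sum>S\<in>Pow V. ?w (insert x S)) = q * subset_exp V q (\<lambda>S. f (insert x S))"
    unfolding subset_exp_def sum_distrib_left
  proof (intro sum.cong refl)
    fix S assume S: "S \<in> Pow V"
    with assms have "finite S" "x \<notin> S" by (auto intro: finite_subset)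
    moreover have "insert x V - insert x S = V - S" using assms S by auto
    ultimately show "?w (insert x S) = q * (q ^ card S * (1 - q) ^ card (V - S) * f (insert x S))"
      by simp
  qed
  also have "(\<Sum>S\<in>Pow V. ?w S) = (1 - q) * subset_exp V q f"
    unfolding subset_exp_def sum_distrib_left
  proof (intro sum.cong refl)
    fix S assume S: "S \<in> Pow V"
    have "insert x V - S = insert x (V - S)" using assms S by auto
    then show "?w S = (1 - q) * (q ^ card S * (1 - q) ^ card (V - S) * f S)"
      using assms by simp
  qed
  finally show ?thesis by simp
qed

lemma subset_exp_add: "subset_exp V q (\<lambda>S. f S + g S) = subset_exp V q f + subset_exp V q g"
  by (simp add: subset_exp_def sum.distrib distrib_left)

lemma subset_exp_diff: "subset_exp V q (\<lambda>S. f S - g S) = subset_exp V q f - subset_exp V q g"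
  by (simp add: subset_exp_def sum_subtractf right_diff_distrib)

lemma subset_exp_cmult: "subset_exp V q (\<lambda>S. c * f S) = c * subset_exp V q f"
  by (simp add: subset_exp_def sum_distrib_left mult_ac)

lemma subset_exp_uminus: "subset_exp V q (\<lambda>S. - f S) = - subset_exp V q f"
  by (simp add: subset_exp_def sum_negf)

lemma subset_exp_sum: "subset_exp V q (\<lambda>S. \<Sum>i\<in>I. f i S) = (\<Sum>i\<in>I. subset_exp V q (f i))"
  unfolding subset_exp_def sum_distrib_left by (rule sum.swap)

lemma subset_exp_const [simp]: "finite V \<Longrightarrow> subset_exp V q (\<lambda>_. c) = c"
  by (induction V rule: finite_induct) (auto simp: subset_exp_insert algebra_simps)

lemma subset_exp_mono:
  assumes "0 \<le> q" "q \<le> 1" "\<And>S. S \<subseteq> V \<Longrightarrow> f S \<le> g S"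
  shows "subset_exp V q f \<le> subset_exp V q g"
  unfolding subset_exp_def using assms by (intro sum_mono mult_left_mono) auto

lemma subset_exp_nonneg:
  assumes "0 \<le> q" "q \<le> 1" "\<And>S. S \<subseteq> V \<Longrightarrow> 0 \<le> f S"
  shows "0 \<le> subset_exp V q f"
  unfolding subset_exp_def using assms by (intro sum_nonneg mult_nonneg_nonneg) auto

lemma subset_exp_Markov:
  assumes "0 \<le> q" "q \<le> 1" "c > 0" "\<And>S. S \<subseteq> V \<Longrightarrow> 0 \<le> f S" "\<And>S. S \<subseteq> V \<Longrightarrow> Q S \<Longrightarrow> c \<le> f S"
  shows "subset_exp V q (\<lambda>S. of_bool (Q S)) \<le> subset_exp V q f / c"
proof -
  have "subset_exp V q (\<lambda>S. of_bool (Q S)) \<le> subset_exp V q (\<lambda>S. (1 / c) * f S)"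
    using assms by (intro subset_exp_mono) (auto simp: field_simps)
  also have "\<dots> = subset_exp V q f / c" unfolding subset_exp_cmult by simp
  finally show ?thesis .
qed

text \<open>The product \<open>pmf\<close> also splits off one coordinate at a time, as a
  \<open>bind\<close> over a Bernoulli variable, so both sides satisfy the recursion of
  \<open>subset_exp_insert\<close>.\<close>

lemma prob_Pi_bernoulli_subset:
  assumes "finite V" "0 \<le> q" "q \<le> 1"
  shows "measure_pmf.prob (map_pmf (\<lambda>b. {x\<in>V. b x}) (Pi_pmf V False (\<lambda>_. bernoulli_pmf q))) E
       = subset_exp V q (indicator E)"
  using assms(1)
proof (induction V arbitrary: E rule: finite_induct)
  case empty
  then show ?case by (auto simp: indicator_def)
next
  case (insert x V)
  let ?R = "\<lambda>V. map_pmf (\<lambda>b. {x\<in>V. b x}) (Pi_pmf V False (\<lambda>_. bernoulli_pmf q))"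
  have "?R (insert x V) = bind_pmf (bernoulli_pmf q) (\<lambda>y. map_pmf (\<lambda>S. if y then insert x S else S) (?R V))"
    using insert.hyps
    by (subst Pi_pmf_insert')
      (auto simp: map_bind_pmf map_pmf_def[symmetric] map_pmf_comp o_def
        intro!: bind_pmf_cong map_pmf_cong split: if_splits)
  then have "measure_pmf.prob (?R (insert x V)) E =
     measure_pmf.expectation (bernoulli_pmf q)
        (\<lambda>y. measure_pmf.prob (map_pmf (\<lambda>S. if y then insert x S else S) (?R V)) E)"
    by (simp only: measure_pmf_bind)
       (subst measure_pmf.measure_bind[where N = "count_space UNIV"], auto simp: measure_pmf_in_subprob_algebra simp del: map_pmf_comp)
  also have "\<dots> = q * measure_pmf.prob (?R V) {S. insert x S \<in> E} + (1 - q) * measure_pmf.prob (?R V) E"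
    using assms by (simp add: vimage_def del: map_pmf_comp)
  also have "\<dots> = subset_exp (insert x V) q (indicator E)"
    unfolding subset_exp_insert[OF insert.hyps] insert.IH
    by (simp add: indicator_def[abs_def])
  finally show ?case .
qed

lemma prob_random_subset:
  assumes "0 \<le> q" "q \<le> 1"
  shows "measure_pmf.prob (random_subset N q) {S. Q S} = subset_exp {0..int N} q (\<lambda>S. of_bool (Q S))"
  unfolding random_subset_def prob_Pi_bernoulli_subset[OF finite_atLeastAtMost_int assms]
  by (intro subset_exp_cong) auto

section \<open>Correlation inequalities and monotonicity in the density\<close>

lemma subset_exp_Harris:
  assumes "finite V" "0 \<le> q" "q \<le> 1"
    and "\<And>S T. S \<subseteq> T \<Longrightarrow> f S \<le> f T" "\<And>S T. S \<subseteq> T \<Longrightarrow> g S \<le> g T"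
  shows "subset_exp V q f * subset_exp V q g \<le> subset_exp V q (\<lambda>S. f S * g S)"
  using assms(1,4,5)
proof (induction V arbitrary: f g rule: finite_induct)
  case empty
  then show ?case by simp
next
  case (insert x V)
  define f1 g1 where "f1 = (\<lambda>S. f (insert x S))" and "g1 = (\<lambda>S. g (insert x S))"
  have "f S \<le> f1 S" "g S \<le> g1 S" for S
    unfolding f1_def g1_def by (intro insert.prems; auto)+
  then have le: "subset_exp V q f \<le> subset_exp V q f1" "subset_exp V q g \<le> subset_exp V q g1"
    using assms(2,3) by (auto intro: subset_exp_mono)
  have IH1: "subset_exp V q f1 * subset_exp V q g1 \<le> subset_exp V q (\<lambda>S. f1 S * g1 S)"
    by (intro insert.IH) (auto simp: f1_def g1_def intro!: insert.prems)
  have IH0: "subset_exp V q f * subset_exp V q g \<le> subset_exp V q (\<lambda>S. f S * g S)"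
    by (intro insert.IH insert.prems)
  define a b c d where "a = subset_exp V q f1" "b = subset_exp V q g1" "c = subset_exp V q f" "d = subset_exp V q g"
  \<comment> \<open>Chebyshev's inequality for two points: this product is exactly the difference of
    the two sides of the next inequality.\<close>
  have "0 \<le> q * (1 - q) * ((a - c) * (b - d))"
    using le assms(2,3) by (intro mult_nonneg_nonneg) (auto simp: a_b_c_d_def)
  then have "(q * a + (1 - q) * c) * (q * b + (1 - q) * d) \<le> q * (a * b) + (1 - q) * (c * d)"
    by (simp add: algebra_simps)
  also have "\<dots> \<le> q * subset_exp V q (\<lambda>S. f1 S * g1 S) + (1 - q) * subset_exp V q (\<lambda>S. f S * g S)"
    using IH0 IH1 assms(2,3) by (intro add_mono mult_left_mono) (auto simp: a_b_c_d_def)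
  finally show ?case
    using insert.hyps by (simp add: subset_exp_insert f1_def g1_def a_b_c_d_def)
qed

lemma subset_exp_Harris_neg:
  assumes "finite V" "0 \<le> q" "q \<le> 1"
    and f: "\<And>S T. S \<subseteq> T \<Longrightarrow> f S \<le> f T" and g: "\<And>S T. S \<subseteq> T \<Longrightarrow> g T \<le> g S"
  shows "subset_exp V q (\<lambda>S. f S * g S) \<le> subset_exp V q f * subset_exp V q g"
  using subset_exp_Harris[of V q f "\<lambda>S. - g S"] assms by (simp add: subset_exp_uminus)

lemma subset_exp_Harris_anti:
  assumes "finite V" "0 \<le> q" "q \<le> 1"
    and f: "\<And>S T. S \<subseteq> T \<Longrightarrow> f T \<le> f S" and g: "\<And>S T. S \<subseteq> T \<Longrightarrow> g T \<le> g S"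
  shows "subset_exp V q f * subset_exp V q g \<le> subset_exp V q (\<lambda>S. f S * g S)"
  using subset_exp_Harris[of V q "\<lambda>S. - f S" "\<lambda>S. - g S"] assms by (simp add: subset_exp_uminus)

text \<open>Independence is expressed coordinatewise: every element is ignored by \<open>f\<close>
  or by \<open>g\<close>. If, say, \<open>f\<close> ignores \<open>x\<close>, the mean of
  \<open>f\<close> factors out of both branches of the recursion. The induction hypothesis is needed
  for all combinations of the original and the shifted functions.\<close>

lemma subset_exp_indep:
  assumes "finite V"
    and "\<And>x. x \<in> V \<Longrightarrow> (\<forall>S. f (insert x S) = f S) \<or> (\<forall>S. g (insert x S) = g S)"
  shows "subset_exp V q (\<lambda>S. f S * g S) = subset_exp V q f * subset_exp V q g"
  using assms
proof (induction V arbitrary: f g rule: finite_induct)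
  case empty
  then show ?case by simp
next
  case (insert x V)
  have IH: "subset_exp V q (\<lambda>S. f' S * g' S) = subset_exp V q f' * subset_exp V q g'"
    if "f' = f \<or> f' = (\<lambda>S. f (insert x S))" "g' = g \<or> g' = (\<lambda>S. g (insert x S))" for f' g'
  proof (rule insert.IH)
    fix y assume "y \<in> V"
    then show "(\<forall>S. f' (insert y S) = f' S) \<or> (\<forall>S. g' (insert y S) = g' S)"
      using insert.prems[of y] that by (auto simp: insert_commute[of x y])
  qed
  have "(\<lambda>S. f (insert x S)) = f \<or> (\<lambda>S. g (insert x S)) = g"
    using insert.prems[of x] by auto
  then show ?case
    using insert.hyps by (auto simp: subset_exp_insert IH algebra_simps)
qed

lemma subset_exp_superset:
  assumes "finite V" "B \<subseteq> V"
  shows "subset_exp V q (\<lambda>S. of_bool (B \<subseteq> S)) = q ^ card B"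
  using assms
proof (induction V arbitrary: B rule: finite_induct)
  case empty
  then show ?case by simp
next
  case (insert x V)
  have fin: "finite B" using insert by (auto intro: finite_subset)
  show ?case
  proof (cases "x \<in> B")
    case True
    have "subset_exp V q (\<lambda>S. of_bool (B \<subseteq> S)) = subset_exp V q (\<lambda>_. 0)"
      using insert True by (intro subset_exp_cong) auto
    moreover have "(B \<subseteq> insert x S) = (B - {x} \<subseteq> S)" for S by auto
    moreover have "q * q ^ card (B - {x}) = q ^ card B"
      by (simp only: card.remove[OF fin True] power_Suc)
    ultimately show ?thesis
      using insert.hyps insert.IH[of "B - {x}"] insert.prems True fin
      by (auto simp: subset_exp_insert subset_insert_iff card_Diff_singleton
               simp flip: power_Suc card.remove[OF fin True])
  next
    case False
    then have "B \<subseteq> V" "\<And>S. (B \<subseteq> insert x S) = (B \<subseteq> S)" using insert.prems by auto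
    then show ?thesis using insert.hyps insert.IH[of B] by (simp add: subset_exp_insert algebra_simps)
  qed
qed

text \<open>Moving weight from "chosen" to "not chosen" moves it to the larger of the two
  conditional means. This is what permits lowering the density in the bulk.\<close>

lemma subset_exp_antimono_prob:
  assumes "finite V" "0 \<le> q" "q \<le> p" "p \<le> 1" and "\<And>S T. S \<subseteq> T \<Longrightarrow> f T \<le> f S"
  shows "subset_exp V p f \<le> subset_exp V q f"
  using assms(1,5)
proof (induction V arbitrary: f rule: finite_induct)
  case empty
  then show ?case by simp
next
  case (insert x V)
  define f1 where "f1 = (\<lambda>S. f (insert x S))"
  have "subset_exp V p f1 \<le> subset_exp V q f1"
    by (intro insert.IH) (auto simp: f1_def intro!: insert.prems)
  moreover have "subset_exp V p f \<le> subset_exp V q f" by (intro insert.IH insert.prems)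
  moreover have "subset_exp V p f1 \<le> subset_exp V p f"
    unfolding f1_def using assms by (intro subset_exp_mono insert.prems) auto
  moreover define a b c d where "a = subset_exp V p f1" "b = subset_exp V q f1" "c = subset_exp V p f" "d = subset_exp V q f"
  ultimately have "a \<le> b" "c \<le> d" "a \<le> c" by auto
  have "p * a + (1 - p) * c \<le> q * a + (1 - q) * c"
    using mult_right_mono[of q p "c - a"] \<open>a \<le> c\<close> assms(3) by (simp add: algebra_simps)
  also have "\<dots> \<le> q * b + (1 - q) * d"
    using \<open>a \<le> b\<close> \<open>c \<le> d\<close> assms by (intro add_mono mult_left_mono) auto
  finally show ?case
    using insert.hyps by (simp add: subset_exp_insert f1_def a_b_c_d_def)
qed

definition avoids :: "'a set set \<Rightarrow> 'a set \<Rightarrow> bool" where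
  "avoids F S \<longleftrightarrow> (\<forall>B\<in>F. \<not> B \<subseteq> S)"

lemma avoids_anti: "S \<subseteq> T \<Longrightarrow> avoids F T \<Longrightarrow> avoids F S"
  by (auto simp: avoids_def)

lemma subset_exp_avoids_nonneg: "0 \<le> q \<Longrightarrow> q \<le> 1 \<Longrightarrow> 0 \<le> subset_exp V q (\<lambda>S. of_bool (avoids F S))"
  by (intro subset_exp_nonneg) auto

text \<open>The events that a given \<open>B\<close> is not contained in \<open>S\<close> are all
  decreasing, hence positively correlated, so their joint probability is at least the
  product.\<close>

lemma subset_exp_avoids_lower:
  assumes "finite V" "0 \<le> q" "q \<le> 1" "finite F" "F \<subseteq> Pow V"
  shows "(\<Prod>B\<in>F. 1 - q ^ card B) \<le> subset_exp V q (\<lambda>S. of_bool (avoids F S))"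
  using assms(4,5)
proof (induction F rule: finite_induct)
  case empty
  then show ?case using assms(1) by (simp add: avoids_def)
next
  case (insert B F)
  have "subset_exp V q (\<lambda>S. of_bool (\<not> B \<subseteq> S)) = subset_exp V q (\<lambda>S. 1 - of_bool (B \<subseteq> S))"
    by (intro subset_exp_cong) auto
  also have "\<dots> = 1 - q ^ card B"
    using assms(1) insert.prems by (simp add: subset_exp_diff subset_exp_superset)
  finally have B: "subset_exp V q (\<lambda>S. of_bool (\<not> B \<subseteq> S)) = 1 - q ^ card B" .
  have "(1 - q ^ card B) * (\<Prod>B\<in>F. 1 - q ^ card B)
      \<le> subset_exp V q (\<lambda>S. of_bool (\<not> B \<subseteq> S)) * subset_exp V q (\<lambda>S. of_bool (avoids F S))"
    unfolding B using insert assms by (intro mult_left_mono) (auto intro: power_le_one)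
  also have "\<dots> \<le> subset_exp V q (\<lambda>S. of_bool (\<not> B \<subseteq> S) * of_bool (avoids F S))"
    using assms avoids_anti by (intro subset_exp_Harris_anti) (auto simp: of_bool_def)
  also have "\<dots> = subset_exp V q (\<lambda>S. of_bool (avoids (insert B F) S))"
    by (intro subset_exp_cong) (auto simp: avoids_def)
  finally show ?case using insert.hyps by simp
qed

text \<open>Each step conditions on the sets disjoint from the new one, which are independent of it, and
  bounds the effect of the intersecting ones by Harris' inequality.\<close>

lemma Janson_inequality:
  assumes "finite V" "0 \<le> q" "q \<le> 1" "finite F" "F \<subseteq> Pow V"
  shows "subset_exp V q (\<lambda>S. of_bool (avoids F S)) \<le>
    exp (- (\<Sum>B\<in>F. q ^ card B) + (\<Sum>B\<in>F. \<Sum>C\<in>{C\<in>F. C \<noteq> B \<and> B \<inter> C \<noteq> {}}. q ^ card (B \<union> C)))"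
  using assms(4,5)
proof (induction F rule: finite_induct)
  case empty
  then show ?case using assms(1) by (simp add: avoids_def)
next
  case (insert B F)
  define N1 where "N1 = {C\<in>F. B \<inter> C \<noteq> {}}"
  define F0 where "F0 = F - N1"
  define d where "d = (\<Sum>C\<in>N1. q ^ card (B \<union> C))"
  let ?P = "\<lambda>Q. subset_exp V q (\<lambda>S. of_bool (Q S))"
  have BV: "B \<subseteq> V" and FV: "F \<subseteq> Pow V" using insert.prems by auto
  have fin: "finite N1" using insert.hyps by (auto simp: N1_def)
  have cont: "?P (\<lambda>S. B \<union> C \<subseteq> S \<and> avoids F0 S) \<le> q ^ card (B \<union> C) * ?P (avoids F0)" if "C \<in> N1" for C
  proof -
    have "B \<union> C \<subseteq> V" using that FV BV by (auto simp: N1_def)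
    then have "?P (\<lambda>S. B \<union> C \<subseteq> S) = q ^ card (B \<union> C)" by (intro subset_exp_superset assms)
    moreover have "subset_exp V q (\<lambda>S. of_bool (B \<union> C \<subseteq> S) * of_bool (avoids F0 S))
      \<le> ?P (\<lambda>S. B \<union> C \<subseteq> S) * ?P (avoids F0)"
      by (intro subset_exp_Harris_neg assms) (auto simp: of_bool_def intro: avoids_anti)
    ultimately show ?thesis by (simp add: of_bool_conj mult.assoc)
  qed
  have indep: "?P (\<lambda>S. B \<subseteq> S \<and> avoids F0 S) = q ^ card B * ?P (avoids F0)"
  proof -
    have "subset_exp V q (\<lambda>S. of_bool (B \<subseteq> S) * of_bool (avoids F0 S)) = ?P (\<lambda>S. B \<subseteq> S) * ?P (avoids F0)"
    proof (intro subset_exp_indep assms)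
      fix x
      show "(\<forall>S. of_bool (B \<subseteq> insert x S) = (of_bool (B \<subseteq> S) :: real)) \<or>
            (\<forall>S. of_bool (avoids F0 (insert x S)) = (of_bool (avoids F0 S) :: real))"
      proof (cases "x \<in> B")
        case True
        then have "\<forall>C\<in>F0. x \<notin> C" by (auto simp: F0_def N1_def)
        then have "avoids F0 (insert x S) = avoids F0 S" for S
          by (auto simp: avoids_def subset_insert)
        then show ?thesis by simp
      next
        case False
        then show ?thesis by (simp add: subset_insert)
      qed
    qed
    then show ?thesis using subset_exp_superset[OF assms(1) BV] by (simp add: of_bool_conj)
  qed
  have "?P (\<lambda>S. B \<subseteq> S \<and> avoids F0 S) \<le>
    subset_exp V q (\<lambda>S. of_bool (B \<subseteq> S \<and> avoids F S) + (\<Sum>C\<in>N1. of_bool (B \<union> C \<subseteq> S \<and> avoids F0 S)))"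
  proof (intro subset_exp_mono assms)
    fix S
    show "(of_bool (B \<subseteq> S \<and> avoids F0 S) :: real) \<le>
      of_bool (B \<subseteq> S \<and> avoids F S) + (\<Sum>C\<in>N1. of_bool (B \<union> C \<subseteq> S \<and> avoids F0 S))"
    proof (cases "B \<subseteq> S \<and> avoids F0 S \<and> \<not> avoids F S")
      case True
      then obtain C where C: "C \<in> N1" "C \<subseteq> S" by (auto simp: avoids_def F0_def)
      have "(1::real) = of_bool (B \<union> C \<subseteq> S \<and> avoids F0 S)" using C True by auto
      also have "\<dots> \<le> (\<Sum>C\<in>N1. of_bool (B \<union> C \<subseteq> S \<and> avoids F0 S))"
        by (rule member_le_sum) (use C fin in auto)
      finally show ?thesis using True by auto
    next
      case False
      have "(0::real) \<le> (\<Sum>C\<in>N1. of_bool (B \<union> C \<subseteq> S \<and> avoids F0 S))" by (intro sum_nonneg) auto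
      then show ?thesis using False by auto
    qed
  qed
  also have "\<dots> \<le> ?P (\<lambda>S. B \<subseteq> S \<and> avoids F S) + d * ?P (avoids F0)"
    unfolding subset_exp_add subset_exp_sum d_def sum_distrib_right
    by (intro add_left_mono sum_mono cont)
  finally have key: "(q ^ card B - d) * ?P (avoids F0) \<le> ?P (\<lambda>S. B \<subseteq> S \<and> avoids F S)"
    unfolding indep by (simp add: algebra_simps)
  have F0le: "?P (avoids F) \<le> ?P (avoids F0)"
    by (intro subset_exp_mono assms) (auto simp: avoids_def F0_def)
  \<comment> \<open>\<open>key\<close> speaks of \<open>F0\<close>, the recursion below of
    \<open>F\<close>. The replacement is monotone only for a nonnegative coefficient; for a negative
    one the left side is at most 0 and nothing is to be shown.\<close>
  have key2: "(q ^ card B - d) * ?P (avoids F) \<le> ?P (\<lambda>S. B \<subseteq> S \<and> avoids F S)"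
  proof (cases "q ^ card B - d \<ge> 0")
    case True
    then show ?thesis using mult_left_mono[OF F0le True] key by linarith
  next
    case False
    then have "(q ^ card B - d) * ?P (avoids F) \<le> 0"
      using subset_exp_avoids_nonneg[OF assms(2,3)] by (intro mult_nonpos_nonneg) auto
    also have "0 \<le> ?P (\<lambda>S. B \<subseteq> S \<and> avoids F S)" by (intro subset_exp_nonneg assms) auto
    finally show ?thesis .
  qed
  have "?P (avoids (insert B F)) = subset_exp V q (\<lambda>S. of_bool (avoids F S) - of_bool (B \<subseteq> S \<and> avoids F S))"
    by (intro subset_exp_cong) (auto simp: avoids_def)
  also have "\<dots> \<le> (1 + (d - q ^ card B)) * ?P (avoids F)"
    unfolding subset_exp_diff using key2 by (simp add: algebra_simps)
  also have "\<dots> \<le> exp (d - q ^ card B) * ?P (avoids F)"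
    by (intro mult_right_mono exp_ge_add_one_self subset_exp_avoids_nonneg assms)
  also have "\<dots> \<le> exp (d - q ^ card B) * exp (- (\<Sum>B\<in>F. q ^ card B) +
      (\<Sum>B\<in>F. \<Sum>C\<in>{C\<in>F. C \<noteq> B \<and> B \<inter> C \<noteq> {}}. q ^ card (B \<union> C)))"
    using insert.IH FV by (intro mult_left_mono) auto
  also have "\<dots> = exp (- (\<Sum>B\<in>insert B F. q ^ card B) + (d +
      (\<Sum>B\<in>F. \<Sum>C\<in>{C\<in>F. C \<noteq> B \<and> B \<inter> C \<noteq> {}}. q ^ card (B \<union> C))))"
    using insert.hyps by (simp flip: exp_add)
  \<comment> \<open>\<open>d\<close> counts each new intersecting pair once, the sum over ordered
    pairs counts it twice. Hence an inequality here, and no factor 1/2 before the correction term of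
    the statement; constants are irrelevant later.\<close>
  also have "d + (\<Sum>B\<in>F. \<Sum>C\<in>{C\<in>F. C \<noteq> B \<and> B \<inter> C \<noteq> {}}. q ^ card (B \<union> C)) \<le>
    (\<Sum>D\<in>insert B F. \<Sum>C\<in>{C\<in>insert B F. C \<noteq> D \<and> D \<inter> C \<noteq> {}}. q ^ card (D \<union> C))"
  proof -
    have eq: "{C\<in>insert B F. C \<noteq> B \<and> B \<inter> C \<noteq> {}} = N1"
      using insert.hyps by (auto simp: N1_def)
    show ?thesis
      unfolding sum.insert[OF insert.hyps] d_def eq
      using insert.hyps assms by (intro add_mono order.refl sum_mono sum_mono2) auto
  qed
  finally show ?case by simp
qed

subsection \<open>Tuples subject to linear equations\<close>

lemma card_le_of_inj_restrict:
  assumes "finite J" "finite V" "J0 \<subseteq> J" "Z \<subseteq> J \<rightarrow>\<^sub>E V" "inj_on (\<lambda>v. restrict v J0) Z"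
  shows "card Z \<le> card V ^ card J0"
proof -
  have fin: "finite J0" by (rule finite_subset[OF assms(3,1)])
  have "card Z = card ((\<lambda>v. restrict v J0) ` Z)" by (rule card_image[symmetric, OF assms(5)])
  also have "\<dots> \<le> card (J0 \<rightarrow>\<^sub>E V)"
    using assms fin by (intro card_mono finite_PiE) (fastforce simp: PiE_iff)+
  also have "\<dots> = card V ^ card J0" using fin by (simp add: card_PiE)
  finally show ?thesis .
qed

lemma restrict_eq_outside:
  assumes "v \<in> J \<rightarrow>\<^sub>E V" "v' \<in> J \<rightarrow>\<^sub>E V" "restrict v J0 = restrict v' J0" "x \<notin> J - J0"
  shows "v x = v' x"
  by (metis DiffI PiE_arb assms restrict_apply)

lemma finite_PiE_filter: "finite J \<Longrightarrow> finite V \<Longrightarrow> finite {v \<in> J \<rightarrow>\<^sub>E V. P v}"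
  by (rule finite_subset[of _ "J \<rightarrow>\<^sub>E V"]) (auto intro: finite_PiE)

text \<open>A coordinate with nonzero coefficient is determined by all the others, so forgetting it
  is injective on the solutions.\<close>

lemma card_linear_eq:
  fixes e :: "'a \<Rightarrow> int"
  assumes "finite J" "finite V" "i \<in> J" "e i \<noteq> 0"
  shows "card {v \<in> J \<rightarrow>\<^sub>E V. (\<Sum>i\<in>J. e i * v i) = n} \<le> card V ^ (card J - 1)"
proof -
  let ?Z = "{v \<in> J \<rightarrow>\<^sub>E V. (\<Sum>i\<in>J. e i * v i) = n}"
  have "inj_on (\<lambda>v. restrict v (J - {i})) ?Z"
  proof (rule inj_onI)
    fix v v' assume v: "v \<in> ?Z" "v' \<in> ?Z" and eq: "restrict v (J - {i}) = restrict v' (J - {i})"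
    then have out: "v x = v' x" if "x \<noteq> i" for x
      using restrict_eq_outside[of v J V v' "J - {i}" x] that by auto
    have "e i * v i + (\<Sum>i\<in>J - {i}. e i * v i) = e i * v' i + (\<Sum>i\<in>J - {i}. e i * v' i)"
      using v by (simp flip: sum.remove[OF assms(1,3), of "\<lambda>i. e i * v i"]
        sum.remove[OF assms(1,3), of "\<lambda>i. e i * v' i"])
    moreover have "(\<Sum>i\<in>J - {i}. e i * v i) = (\<Sum>i\<in>J - {i}. e i * v' i)"
      using out by (intro sum.cong) auto
    ultimately have "v i = v' i" using assms by simp
    then show "v = v'" using out by (metis ext)
  qed
  then have "card ?Z \<le> card V ^ card (J - {i})"
    using assms by (intro card_le_of_inj_restrict[of J]) auto
  then show ?thesis using assms by (simp add: card_Diff_singleton)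
qed

lemma det2_zero_int:
  fixes a b c d x y :: int
  assumes "a * x + b * y = 0" "c * x + d * y = 0" "a * d \<noteq> b * c"
  shows "x = 0 \<and> y = 0"
proof -
  have "(a * d - b * c) * x = d * (a * x + b * y) - b * (c * x + d * y)"
       "(a * d - b * c) * y = a * (c * x + d * y) - c * (a * x + b * y)"
    by (simp_all add: algebra_simps)
  then have "(a * d - b * c) * x = 0" "(a * d - b * c) * y = 0" by (simp_all add: assms(1,2))
  then show ?thesis using assms(3) by simp
qed

text \<open>A nonvanishing 2 by 2 minor determines the coordinates \<open>i\<close> and
  \<open>j\<close> from the remaining ones, by Cramer's rule in the form of
  \<open>det2_zero_int\<close>.\<close>

lemma card_linear_eq2:
  fixes e e' :: "'a \<Rightarrow> int"
  assumes "finite J" "finite V" "i \<in> J" "j \<in> J" "e i * e' j \<noteq> e j * e' i"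
  shows "card {v \<in> J \<rightarrow>\<^sub>E V. (\<Sum>i\<in>J. e i * v i) = n \<and> (\<Sum>i\<in>J. e' i * v i) = n'} \<le> card V ^ (card J - 2)"
proof -
  let ?Z = "{v \<in> J \<rightarrow>\<^sub>E V. (\<Sum>i\<in>J. e i * v i) = n \<and> (\<Sum>i\<in>J. e' i * v i) = n'}"
  have ij: "i \<noteq> j" using assms by auto
  have split: "(\<Sum>i\<in>J. f i) = f i + f j + (\<Sum>i\<in>J - {i,j}. f i)" for f :: "'a \<Rightarrow> int"
  proof -
    have "(\<Sum>i\<in>J. f i) = f i + (\<Sum>i\<in>J - {i}. f i)" by (intro sum.remove assms)
    also have "(\<Sum>i\<in>J - {i}. f i) = f j + (\<Sum>i\<in>J - {i} - {j}. f i)"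
      using assms ij by (intro sum.remove) auto
    also have "J - {i} - {j} = J - {i,j}" by auto
    finally show ?thesis by (simp add: add.assoc)
  qed
  have "inj_on (\<lambda>v. restrict v (J - {i,j})) ?Z"
  proof (rule inj_onI)
    fix v v' assume v: "v \<in> ?Z" "v' \<in> ?Z" and eq: "restrict v (J - {i,j}) = restrict v' (J - {i,j})"
    then have out: "v x = v' x" if "x \<noteq> i" "x \<noteq> j" for x
      using restrict_eq_outside[of v J V v' "J - {i,j}" x] that by auto
    have same: "(\<Sum>i\<in>J - {i,j}. g i * v i) = (\<Sum>i\<in>J - {i,j}. g i * v' i)" for g
      using out by (intro sum.cong) auto
    have "e i * (v i - v' i) + e j * (v j - v' j) = 0"
      using v split[of "\<lambda>i. e i * v i"] split[of "\<lambda>i. e i * v' i"] same[of e] by (simp add: algebra_simps)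
    moreover have "e' i * (v i - v' i) + e' j * (v j - v' j) = 0"
      using v split[of "\<lambda>i. e' i * v i"] split[of "\<lambda>i. e' i * v' i"] same[of e'] by (simp add: algebra_simps)
    ultimately have "v i - v' i = 0 \<and> v j - v' j = 0"
      using assms by (intro det2_zero_int[of "e i" _ "e j" _ "e' i" "e' j"])
    then show "v = v'" using out by (metis eq_iff_diff_eq_0 ext)
  qed
  then have "card ?Z \<le> card V ^ card (J - {i,j})"
    using assms by (intro card_le_of_inj_restrict[of J]) auto
  also have "card (J - {i,j}) = card J - 2"
    using assms ij by (subst card_Diff_subset) auto
  finally show ?thesis .
qed

text \<open>A tuple with exactly \<open>w\<close> distinct entries is an injective \<open>w\<close>-tuple composed with one of
  boundedly many patterns.\<close>

lemma card_by_pattern: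
  assumes "finite J" "finite V" "Z \<subseteq> J \<rightarrow>\<^sub>E V" "\<And>c. c \<in> Z \<Longrightarrow> card (c ` J) = w"
    and B: "\<And>\<pi>. \<pi> \<in> J \<rightarrow>\<^sub>E {..<w} \<Longrightarrow>
      card {v \<in> {..<w} \<rightarrow>\<^sub>E V. inj_on v {..<w} \<and> restrict (v \<circ> \<pi>) J \<in> Z} \<le> B"
  shows "card Z \<le> w ^ card J * B"
proof -
  let ?A = "\<lambda>\<pi>. {v \<in> {..<w} \<rightarrow>\<^sub>E V. inj_on v {..<w} \<and> restrict (v \<circ> \<pi>) J \<in> Z}"
  let ?P = "J \<rightarrow>\<^sub>E {..<w}"
  have finA: "finite (?A \<pi>)" for \<pi>
    by (rule finite_subset[of _ "{..<w} \<rightarrow>\<^sub>E V"]) (use assms in \<open>auto intro: finite_PiE\<close>)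
  have finP: "finite ?P" using assms by (intro finite_PiE) auto
  have "Z \<subseteq> (\<Union>\<pi>\<in>?P. (\<lambda>v. restrict (v \<circ> \<pi>) J) ` ?A \<pi>)"
  proof
    fix c assume c: "c \<in> Z"
    then have cV: "c \<in> J \<rightarrow>\<^sub>E V" using assms by auto
    have "finite (c ` J)" using assms by auto
    then obtain b where b: "bij_betw b {..<w} (c ` J)"
      using ex_bij_betw_nat_finite[of "c ` J"] assms(4)[OF c] by (auto simp: atLeast0LessThan)
    define v where "v = restrict b {..<w}"
    define \<pi> where "\<pi> = restrict (\<lambda>j. inv_into {..<w} b (c j)) J"
    have inv: "b (inv_into {..<w} b (c j)) = c j" "inv_into {..<w} b (c j) \<in> {..<w}" if "j \<in> J" for j
      using b that f_inv_into_f[of "c j" b "{..<w}"] inv_into_into[of "c j" b "{..<w}"]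
      by (auto simp: bij_betw_def)
    have vP: "v \<in> {..<w} \<rightarrow>\<^sub>E V"
    proof -
      have "c ` J \<subseteq> V" using cV by auto
      then show ?thesis using bij_betwE[OF b] by (auto simp: v_def)
    qed
    have "inj_on v {..<w}" using b by (auto simp: v_def bij_betw_def)
    moreover have "\<pi> \<in> ?P" using inv by (auto simp: \<pi>_def)
    moreover have eq: "restrict (v \<circ> \<pi>) J = c"
    proof
      fix x
      show "restrict (v \<circ> \<pi>) J x = c x"
      proof (cases "x \<in> J")
        case True
        then show ?thesis using inv[OF True] by (simp add: v_def \<pi>_def)
      next
        case False
        then show ?thesis using PiE_arb[OF cV False] by simp
      qed
    qed
    ultimately show "c \<in> (\<Union>\<pi>\<in>?P. (\<lambda>v. restrict (v \<circ> \<pi>) J) ` ?A \<pi>)"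
      using c vP by (intro UN_I[of \<pi>] image_eqI[of _ _ v]) (simp_all del: o_apply)
  qed
  then have "card Z \<le> card (\<Union>\<pi>\<in>?P. (\<lambda>v. restrict (v \<circ> \<pi>) J) ` ?A \<pi>)"
    using finA finP by (intro card_mono) auto
  also have "\<dots> \<le> (\<Sum>\<pi>\<in>?P. card ((\<lambda>v. restrict (v \<circ> \<pi>) J) ` ?A \<pi>))"
    by (rule card_UN_le[OF finP])
  also have "\<dots> \<le> (\<Sum>\<pi>\<in>?P. B)"
    using finA B by (intro sum_mono order.trans[OF card_image_le]) auto
  also have "\<dots> = w ^ card J * B" using assms by (simp add: card_PiE)
  finally show ?thesis .
qed

text \<open>A pair of tuples on \<open>I\<close> is one tuple on \<open>I \<times> UNIV\<close> with
  a boolean tag, which reduces the claim to \<open>card_by_pattern\<close>. Its pattern is then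
  split back into the patterns \<open>p\<close> and \<open>q\<close> of the two components.\<close>

lemma card_pairs_by_pattern:
  fixes I :: "'a set" and V :: "'b set"
  assumes "finite I" "finite V" "P \<subseteq> (I \<rightarrow>\<^sub>E V) \<times> (I \<rightarrow>\<^sub>E V)"
    and w: "\<And>a b. (a, b) \<in> P \<Longrightarrow> card (a ` I \<union> b ` I) = w"
    and B: "\<And>p q. p \<in> I \<rightarrow> {..<w} \<Longrightarrow> q \<in> I \<rightarrow> {..<w} \<Longrightarrow>
      card {v \<in> {..<w} \<rightarrow>\<^sub>E V. inj_on v {..<w} \<and> (restrict (v \<circ> p) I, restrict (v \<circ> q) I) \<in> P} \<le> B"
  shows "card P \<le> w ^ (2 * card I) * B"
proof -
  define J where "J = I \<times> (UNIV :: bool set)"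
  define enc :: "('a \<Rightarrow> 'b) \<times> ('a \<Rightarrow> 'b) \<Rightarrow> 'a \<times> bool \<Rightarrow> 'b"
    where "enc = (\<lambda>(a, b). restrict (\<lambda>(l, t). if t then b l else a l) J)"
  have enc: "enc (a, b) (l, False) = a l" "enc (a, b) (l, True) = b l" if "l \<in> I" for a b l
    using that by (simp_all add: enc_def J_def)
  have dec: "a = restrict (\<lambda>l. enc (a, b) (l, False)) I" "b = restrict (\<lambda>l. enc (a, b) (l, True)) I"
    if "(a, b) \<in> P" for a b
  proof -
    have e: "a \<in> extensional I" "b \<in> extensional I" using that assms(3) by (auto simp: PiE_iff)
    show "a = restrict (\<lambda>l. enc (a, b) (l, False)) I" "b = restrict (\<lambda>l. enc (a, b) (l, True)) I"
      by (rule extensionalityI[OF e(1) restrict_extensional] extensionalityI[OF e(2) restrict_extensional], simp add: enc)+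
  qed
  have "inj_on enc P"
  proof (rule inj_onI)
    fix x y assume "x \<in> P" "y \<in> P" "enc x = enc y"
    then show "x = y" using dec[of "fst x" "snd x"] dec[of "fst y" "snd y"] by (metis prod.collapse)
  qed
  then have "card P = card (enc ` P)" by (simp add: card_image)
  also have "\<dots> \<le> w ^ card J * B"
  proof (rule card_by_pattern[where V = V])
    show "finite J" using assms by (simp add: J_def)
    show "enc ` P \<subseteq> J \<rightarrow>\<^sub>E V"
    proof (intro image_subsetI)
      fix x assume "x \<in> P"
      then obtain a b where "x = (a, b)" "a \<in> I \<rightarrow>\<^sub>E V" "b \<in> I \<rightarrow>\<^sub>E V" using assms(3) by auto
      then show "enc x \<in> J \<rightarrow>\<^sub>E V" by (auto simp: enc_def J_def PiE_iff)
    qed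
    show "card (c ` J) = w" if "c \<in> enc ` P" for c
    proof -
      from that obtain a b where ab: "(a, b) \<in> P" "c = enc (a, b)" by auto
      have "J = (\<lambda>l. (l, False)) ` I \<union> (\<lambda>l. (l, True)) ` I" by (auto simp: J_def UNIV_bool)
      then have "c ` J = a ` I \<union> b ` I" unfolding ab(2) by (simp add: image_Un image_image enc)
      then show ?thesis using w[OF ab(1)] by simp
    qed
    fix \<pi> assume \<pi>: "\<pi> \<in> J \<rightarrow>\<^sub>E {..<w}"
    let ?p = "\<lambda>l. \<pi> (l, False)" and ?q = "\<lambda>l. \<pi> (l, True)"
    have "{v \<in> {..<w} \<rightarrow>\<^sub>E V. inj_on v {..<w} \<and> restrict (v \<circ> \<pi>) J \<in> enc ` P} \<subseteq>
      {v \<in> {..<w} \<rightarrow>\<^sub>E V. inj_on v {..<w} \<and> (restrict (v \<circ> ?p) I, restrict (v \<circ> ?q) I) \<in> P}"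
    proof (rule subsetI)
      fix v assume v: "v \<in> {v \<in> {..<w} \<rightarrow>\<^sub>E V. inj_on v {..<w} \<and> restrict (v \<circ> \<pi>) J \<in> enc ` P}"
      then obtain a b where ab: "(a, b) \<in> P" "restrict (v \<circ> \<pi>) J = enc (a, b)" by auto
      have "restrict (v \<circ> ?p) I = restrict (\<lambda>l. enc (a, b) (l, False)) I"
           "restrict (v \<circ> ?q) I = restrict (\<lambda>l. enc (a, b) (l, True)) I"
        unfolding ab(2)[symmetric] by (auto simp: J_def intro!: restrict_ext)
      then have "(restrict (v \<circ> ?p) I, restrict (v \<circ> ?q) I) \<in> P" using dec[OF ab(1)] ab(1) by simp
      then show "v \<in> {v \<in> {..<w} \<rightarrow>\<^sub>E V. inj_on v {..<w} \<and> (restrict (v \<circ> ?p) I, restrict (v \<circ> ?q) I) \<in> P}"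
        using v by blast
    qed
    then have "card {v \<in> {..<w} \<rightarrow>\<^sub>E V. inj_on v {..<w} \<and> restrict (v \<circ> \<pi>) J \<in> enc ` P} \<le>
      card {v \<in> {..<w} \<rightarrow>\<^sub>E V. inj_on v {..<w} \<and> (restrict (v \<circ> ?p) I, restrict (v \<circ> ?q) I) \<in> P}"
      using assms(2) by (intro card_mono finite_PiE_filter) auto
    also have "\<dots> \<le> B" using \<pi> by (intro B) (auto simp: J_def PiE_iff)
    finally show "card {v \<in> {..<w} \<rightarrow>\<^sub>E V. inj_on v {..<w} \<and> restrict (v \<circ> \<pi>) J \<in> enc ` P} \<le> B" .
  qed (use assms in simp_all)
  also have "card J = 2 * card I" using assms by (simp add: J_def card_cartesian_product)
  finally show ?thesis .
qed

text \<open>In terms of the distinct entries the coefficients are summed over the fibers of the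
  pattern. They may cancel, which is the source of every special case in the counts below.\<close>

lemma sum_pattern:
  fixes u :: "'a \<Rightarrow> int" and w :: nat
  assumes "finite J" "\<pi> \<in> J \<rightarrow> {..<w}"
  shows "(\<Sum>l\<in>J. u l * v (\<pi> l)) = (\<Sum>i<w. (\<Sum>l\<in>{l\<in>J. \<pi> l = i}. u l) * v i)"
proof -
  have "(\<Sum>l\<in>J. u l * v (\<pi> l)) = (\<Sum>i<w. \<Sum>l\<in>{l\<in>J. \<pi> l = i}. u l * v (\<pi> l))"
    using assms by (intro sum.group[symmetric]) auto
  also have "\<dots> = (\<Sum>i<w. (\<Sum>l\<in>{l\<in>J. \<pi> l = i}. u l) * v i)"
    unfolding sum_distrib_right by (intro sum.cong) auto
  finally show ?thesis .
qed

section \<open>Solutions of a linear form and the sets of elements they use\<close>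

locale linear_form =
  fixes h :: nat and u :: "nat \<Rightarrow> int"
  assumes h2: "h \<ge> 2" and nonzero: "i \<in> {1..h} \<Longrightarrow> u i \<noteq> 0"
begin

definition I :: "nat set" where "I = {1..h}"

lemma finite_I [simp]: "finite I" and card_I [simp]: "card I = h" and I_nonempty: "I \<noteq> {}"
  and u_nz: "i \<in> I \<Longrightarrow> u i \<noteq> 0"
  using h2 nonzero by (auto simp: I_def)

definition L :: "(nat \<Rightarrow> int) \<Rightarrow> int" where "L a = (\<Sum>i\<in>I. u i * a i)"

definition tuples :: "int set \<Rightarrow> int \<Rightarrow> (nat \<Rightarrow> int) set" where
  "tuples V n = {a \<in> I \<rightarrow>\<^sub>E V. L a = n}"

text \<open>A value is attained by \<open>S\<close> iff \<open>S\<close> contains the image of some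
  solution, so images are the sets to which Harris and Janson apply. Injective solutions give sets
  of size exactly \<open>h\<close>, the main term; \<open>deg_supports\<close> collects the smaller
  ones, which only matter as an error.\<close>

definition supports :: "int set \<Rightarrow> int \<Rightarrow> int set set" where
  "supports V n = (\<lambda>a. a ` I) ` {a \<in> tuples V n. inj_on a I}"

definition deg_supports :: "int set \<Rightarrow> int \<Rightarrow> int set set" where
  "deg_supports V n = (\<lambda>a. a ` I) ` {a \<in> tuples V n. \<not> inj_on a I}"

lemma finite_tuples [simp]: "finite V \<Longrightarrow> finite (tuples V n)"
  unfolding tuples_def by (rule finite_subset[of _ "I \<rightarrow>\<^sub>E V"]) (auto intro: finite_PiE)

lemma finite_supports [simp]: "finite V \<Longrightarrow> finite (supports V n)"
  by (auto simp: supports_def)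

lemma finite_deg_supports [simp]: "finite V \<Longrightarrow> finite (deg_supports V n)"
  by (auto simp: deg_supports_def)

lemma supports_subset: "supports V n \<subseteq> Pow V" and deg_supports_subset: "deg_supports V n \<subseteq> Pow V"
  by (auto simp: supports_def deg_supports_def tuples_def)

lemma card_supports: "B \<in> supports V n \<Longrightarrow> card B = h"
  by (auto simp: supports_def card_image)

lemma card_deg_supports: "B \<in> deg_supports V n \<Longrightarrow> 1 \<le> card B \<and> card B < h"
proof -
  assume "B \<in> deg_supports V n"
  then obtain a where a: "B = a ` I" "\<not> inj_on a I" by (auto simp: deg_supports_def)
  then have "card B \<noteq> card I" using eq_card_imp_inj_on[of I a] by auto
  moreover have "card B \<le> card I" unfolding a by (rule card_image_le) simp
  moreover have "B \<noteq> {}" "finite B" using a I_nonempty by auto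
  ultimately show ?thesis by (auto simp: Suc_le_eq card_gt_0_iff)
qed

text \<open>Merging equal entries leaves one equation in \<open>j\<close> unknowns. If some merged
  coefficient survives, it fixes one unknown; if all cancel, the equation reads
  \<open>0 = n\<close>, which \<open>n \<noteq> 0\<close> rules out.\<close>

lemma card_tuples_image:
  assumes "finite V" "n \<noteq> 0"
  shows "card {a \<in> tuples V n. card (a ` I) = j} \<le> j ^ h * card V ^ (j - 1)"
proof -
  have "card {a \<in> tuples V n. card (a ` I) = j} \<le> j ^ card I * card V ^ (j - 1)"
  proof (rule card_by_pattern[where V = V])
    show "{a \<in> tuples V n. card (a ` I) = j} \<subseteq> I \<rightarrow>\<^sub>E V" unfolding tuples_def by blast
    fix \<pi> assume \<pi>: "\<pi> \<in> I \<rightarrow>\<^sub>E {..<j}"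
    define e where "e i = (\<Sum>l\<in>{l\<in>I. \<pi> l = i}. u l)" for i
    let ?A = "{v \<in> {..<j} \<rightarrow>\<^sub>E V. inj_on v {..<j} \<and> restrict (v \<circ> \<pi>) I \<in> {a \<in> tuples V n. card (a ` I) = j}}"
    have A: "(\<Sum>i<j. e i * v i) = n" if "v \<in> ?A" for v
    proof -
      have "n = L (restrict (v \<circ> \<pi>) I)" using that by (auto simp: tuples_def)
      also have "\<dots> = (\<Sum>l\<in>I. u l * v (\<pi> l))" unfolding L_def by (intro sum.cong) auto
      also have "\<dots> = (\<Sum>i<j. e i * v i)" unfolding e_def using \<pi> by (intro sum_pattern) auto
      finally show ?thesis by simp
    qed
    show "card ?A \<le> card V ^ (j - 1)"
    proof (cases "\<exists>i<j. e i \<noteq> 0")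
      case True
      then obtain i where i: "i < j" "e i \<noteq> 0" by auto
      have "card ?A \<le> card {v \<in> {..<j} \<rightarrow>\<^sub>E V. (\<Sum>i<j. e i * v i) = n}"
        using A by (intro card_mono finite_PiE_filter assms subsetI) (simp_all del: o_apply)
      also have "\<dots> \<le> card V ^ (card {..<j} - 1)"
        using i assms by (intro card_linear_eq[of _ _ i]) auto
      finally show ?thesis by simp
    next
      case False
      have "v \<notin> ?A" for v
      proof
        assume "v \<in> ?A"
        then have "(\<Sum>i<j. e i * v i) = n" by (rule A)
        moreover have "(\<Sum>i<j. e i * v i) = 0" using False by (intro sum.neutral) auto
        ultimately show False using assms by simp
      qed
      then have "?A = {}" by blast
      then show ?thesis by (simp only: card.empty)
    qed
  qed (use assms in simp_all)
  then show ?thesis by simp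
qed

lemma card_deg_supports_size:
  assumes "finite V" "n \<noteq> 0"
  shows "card {B \<in> deg_supports V n. card B = j} \<le> j ^ h * card V ^ (j - 1)"
proof -
  have "{B \<in> deg_supports V n. card B = j} \<subseteq> (\<lambda>a. a ` I) ` {a \<in> tuples V n. card (a ` I) = j}"
    by (auto simp: deg_supports_def)
  then have "card {B \<in> deg_supports V n. card B = j} \<le> card ((\<lambda>a. a ` I) ` {a \<in> tuples V n. card (a ` I) = j})"
    using assms by (intro card_mono) auto
  also have "\<dots> \<le> card {a \<in> tuples V n. card (a ` I) = j}"
    using assms by (intro card_image_le) auto
  also note card_tuples_image[OF assms]
  finally show ?thesis .
qed

lemma card_tuples_noninj:
  assumes "finite V" "n \<noteq> 0" "card V \<le> M" "M \<ge> 1"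
  shows "card {a \<in> tuples V n. \<not> inj_on a I} \<le> h ^ (h + 1) * M ^ (h - 2)"
proof -
  have "{a \<in> tuples V n. \<not> inj_on a I} \<subseteq> (\<Union>j\<in>{1..<h}. {a \<in> tuples V n. card (a ` I) = j})"
  proof
    fix a assume a: "a \<in> {a \<in> tuples V n. \<not> inj_on a I}"
    then have "a ` I \<in> deg_supports V n" by (auto simp: deg_supports_def)
    then have "card (a ` I) \<in> {1..<h}" using card_deg_supports by fastforce
    then show "a \<in> (\<Union>j\<in>{1..<h}. {a \<in> tuples V n. card (a ` I) = j})" using a by auto
  qed
  then have "card {a \<in> tuples V n. \<not> inj_on a I} \<le> card (\<Union>j\<in>{1..<h}. {a \<in> tuples V n. card (a ` I) = j})"
    using assms by (intro card_mono) auto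
  also have "\<dots> \<le> (\<Sum>j\<in>{1..<h}. card {a \<in> tuples V n. card (a ` I) = j})"
    by (rule card_UN_le) simp
  also have "\<dots> \<le> (\<Sum>j\<in>{1..<h}. h ^ h * M ^ (h - 2))"
  proof (rule sum_mono)
    fix j assume j: "j \<in> {1..<h}"
    have "card {a \<in> tuples V n. card (a ` I) = j} \<le> j ^ h * card V ^ (j - 1)"
      by (rule card_tuples_image[OF assms(1,2)])
    also have "\<dots> \<le> h ^ h * M ^ (h - 2)"
    proof (rule mult_le_mono)
      show "j ^ h \<le> h ^ h" using j by (intro power_mono) auto
      have "card V ^ (j - 1) \<le> M ^ (j - 1)" using assms by (intro power_mono) auto
      also have "\<dots> \<le> M ^ (h - 2)" using j assms by (intro power_increasing) auto
      finally show "card V ^ (j - 1) \<le> M ^ (h - 2)" .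
    qed
    finally show "card {a \<in> tuples V n. card (a ` I) = j} \<le> h ^ h * M ^ (h - 2)" .
  qed
  also have "\<dots> \<le> h ^ (h + 1) * M ^ (h - 2)" by simp
  finally show ?thesis .
qed

text \<open>If all \<open>2 \<times> 2\<close> minors of \<open>u\<close> and \<open>u \<circ> \<sigma>\<close> vanish, then \<open>n * u (\<sigma> j) = n' * u j\<close> for all \<open>j\<close>
  as soon as there is one solution.\<close>

lemma card_tuples_twist:
  assumes "finite V" "\<sigma> permutes I" "j \<in> I" "n * u (\<sigma> j) \<noteq> n' * u j"
  shows "card {a \<in> tuples V n. (\<Sum>i\<in>I. u (\<sigma> i) * a i) = n'} \<le> card V ^ (h - 2)"
proof (cases "\<exists>i\<in>I. u i * u (\<sigma> j) \<noteq> u j * u (\<sigma> i)")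
  case True
  then obtain i where i: "i \<in> I" "u i * u (\<sigma> j) \<noteq> u j * u (\<sigma> i)" by auto
  have "{a \<in> tuples V n. (\<Sum>i\<in>I. u (\<sigma> i) * a i) = n'}
     = {a \<in> I \<rightarrow>\<^sub>E V. (\<Sum>i\<in>I. u i * a i) = n \<and> (\<Sum>i\<in>I. u (\<sigma> i) * a i) = n'}"
    by (auto simp: tuples_def L_def)
  also have "card \<dots> \<le> card V ^ (card I - 2)"
    using i assms by (intro card_linear_eq2[of _ _ i j]) auto
  finally show ?thesis by simp
next
  case False
  have "{a \<in> tuples V n. (\<Sum>i\<in>I. u (\<sigma> i) * a i) = n'} = {}"
  proof (rule ccontr)
    assume "{a \<in> tuples V n. (\<Sum>i\<in>I. u (\<sigma> i) * a i) = n'} \<noteq> {}"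
    then obtain a where a: "(\<Sum>i\<in>I. u i * a i) = n" "(\<Sum>i\<in>I. u (\<sigma> i) * a i) = n'"
      by (auto simp: tuples_def L_def)
    have "n * u (\<sigma> j) = (\<Sum>i\<in>I. (u i * u (\<sigma> j)) * a i)"
      unfolding a(1)[symmetric] sum_distrib_right by (intro sum.cong) (auto simp: mult_ac)
    also have "\<dots> = (\<Sum>i\<in>I. (u j * u (\<sigma> i)) * a i)"
      using False by (intro sum.cong) auto
    also have "\<dots> = n' * u j"
      unfolding a(2)[symmetric] sum_distrib_right by (intro sum.cong) (auto simp: mult_ac)
    finally show False using assms by simp
  qed
  then show ?thesis by (simp only: card.empty)
qed

text \<open>Two different supports have the same size \<open>h\<close>, so each has an element the
  other lacks. At these two elements the coefficients of the two merged equations form a diagonal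
  matrix with entries \<open>u l\<close> and \<open>u m\<close>, so the equations are independent
  for all targets \<open>n\<close> and \<open>n'\<close>.\<close>

lemma card_supports_pairs:
  assumes "finite V"
  shows "card {(B, C). B \<in> supports V n \<and> C \<in> supports V n' \<and> B \<noteq> C \<and> card (B \<union> C) = w}
    \<le> w ^ (2 * h) * card V ^ (w - 2)"
proof -
  define T where "T = {(a, b). a \<in> tuples V n \<and> b \<in> tuples V n' \<and> inj_on a I \<and> inj_on b I \<and>
     a ` I \<noteq> b ` I \<and> card (a ` I \<union> b ` I) = w}"
  have "T \<subseteq> tuples V n \<times> tuples V n'" by (auto simp: T_def)
  then have finT: "finite T" by (rule finite_subset) (use assms in simp)
  have "{(B, C). B \<in> supports V n \<and> C \<in> supports V n' \<and> B \<noteq> C \<and> card (B \<union> C) = w}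
      \<subseteq> (\<lambda>(a, b). (a ` I, b ` I)) ` T"
  proof (rule subsetI)
    fix x assume "x \<in> {(B, C). B \<in> supports V n \<and> C \<in> supports V n' \<and> B \<noteq> C \<and> card (B \<union> C) = w}"
    then obtain a b where ab: "x = (a ` I, b ` I)" "a \<in> tuples V n" "inj_on a I" "b \<in> tuples V n'" "inj_on b I"
        "a ` I \<noteq> b ` I" "card (a ` I \<union> b ` I) = w"
      unfolding supports_def by blast
    then have "(a, b) \<in> T" by (simp add: T_def)
    with ab(1) show "x \<in> (\<lambda>(a, b). (a ` I, b ` I)) ` T" by (intro image_eqI[of _ _ "(a, b)"]) auto
  qed
  then have "card {(B, C). B \<in> supports V n \<and> C \<in> supports V n' \<and> B \<noteq> C \<and> card (B \<union> C) = w} \<le> card T"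
    by (rule surj_card_le[OF finT])
  also have "card T \<le> w ^ (2 * card I) * card V ^ (w - 2)"
  proof (rule card_pairs_by_pattern[where V = V])
    show "T \<subseteq> (I \<rightarrow>\<^sub>E V) \<times> (I \<rightarrow>\<^sub>E V)" by (auto simp: T_def tuples_def)
    show "card (a ` I \<union> b ` I) = w" if "(a, b) \<in> T" for a b using that by (simp add: T_def)
    fix p q assume pq: "p \<in> I \<rightarrow> {..<w}" "q \<in> I \<rightarrow> {..<w}"
    let ?A = "{v \<in> {..<w} \<rightarrow>\<^sub>E V. inj_on v {..<w} \<and> (restrict (v \<circ> p) I, restrict (v \<circ> q) I) \<in> T}"
    define e where "e i = (\<Sum>l\<in>{l\<in>I. p l = i}. u l)" for i
    define e' where "e' i = (\<Sum>l\<in>{l\<in>I. q l = i}. u l)" for i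
    show "card ?A \<le> card V ^ (w - 2)"
    proof (cases "?A = {}")
      case True
      then show ?thesis by (simp only: card.empty)
    next
      case False
      have L_comp: "L (restrict (v \<circ> r) I) = (\<Sum>l\<in>I. u l * v (r l))" for v and r :: "nat \<Rightarrow> nat"
        unfolding L_def by (intro sum.cong) auto
      have A: "(\<Sum>i<w. e i * v i) = n \<and> (\<Sum>i<w. e' i * v i) = n'" if "v \<in> ?A" for v
      proof -
        have "L (restrict (v \<circ> p) I) = n" "L (restrict (v \<circ> q) I) = n'"
          using that unfolding T_def tuples_def by blast+
        then show ?thesis
          using sum_pattern[OF finite_I pq(1), of u v] sum_pattern[OF finite_I pq(2), of u v]
          unfolding L_comp e_def e'_def by simp
      qed
      from False obtain v where v: "(restrict (v \<circ> p) I, restrict (v \<circ> q) I) \<in> T" by blast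
      have *: "inj_on (restrict (v \<circ> p) I) I" "inj_on (restrict (v \<circ> q) I) I"
          "restrict (v \<circ> p) I ` I \<noteq> restrict (v \<circ> q) I ` I"
        using v unfolding T_def by blast+
      have inj: "inj_on p I" "inj_on q I"
        by (intro inj_onI; rule inj_onD[OF *(1)] inj_onD[OF *(2)]; simp)+
      have ne: "p ` I \<noteq> q ` I" using *(3) by (metis image_comp image_restrict_eq)
      have cards: "card (p ` I) = h" "card (q ` I) = h" using inj by (auto simp: card_image)
      have "\<not> p ` I \<subseteq> q ` I" "\<not> q ` I \<subseteq> p ` I"
        using ne cards card_subset_eq[of "q ` I" "p ` I"] card_subset_eq[of "p ` I" "q ` I"] by auto
      then obtain l m where l: "l \<in> I" "p l \<notin> q ` I" and m: "m \<in> I" "q m \<notin> p ` I"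
        by blast
      have s: "{l'\<in>I. p l' = p l} = {l}" "{l'\<in>I. q l' = q m} = {m}"
        using l(1) m(1) inj by (auto simp: inj_on_def)
      have s': "{l'\<in>I. q l' = p l} = {}" "{l'\<in>I. p l' = q m} = {}"
        using l(2) m(2) by force+
      have e1: "e (p l) = u l" "e' (q m) = u m"
        unfolding e_def e'_def s by simp_all
      have e2: "e' (p l) = 0" "e (q m) = 0"
        unfolding e_def e'_def s' by simp_all
      have "card ?A \<le> card {v \<in> {..<w} \<rightarrow>\<^sub>E V. (\<Sum>i<w. e i * v i) = n \<and> (\<Sum>i<w. e' i * v i) = n'}"
        using A by (intro card_mono finite_PiE_filter assms subsetI) (simp_all del: o_apply)
      also have "\<dots> \<le> card V ^ (card {..<w} - 2)"
        using l m e1 e2 pq assms u_nz by (intro card_linear_eq2[of _ _ "p l" "q m"]) auto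
      finally show ?thesis by simp
    qed
  qed (use assms in simp_all)
  finally show ?thesis by simp
qed

end

subsection \<open>Counting representations\<close>

text \<open>For positive weights this is the denumerant of \<open>k\<close>: the number of ways to
  write \<open>k\<close> with parts \<open>w i\<close>. Positivity is also what makes the set finite
  and \<open>card\<close> meaningful.\<close>

definition nsol :: "'a set \<Rightarrow> ('a \<Rightarrow> nat) \<Rightarrow> nat \<Rightarrow> nat" where
  "nsol I w k = card {b \<in> I \<rightarrow>\<^sub>E UNIV. (\<Sum>i\<in>I. w i * b i) = k}"

lemma sol_le:
  fixes w b :: "'a \<Rightarrow> nat"
  assumes "finite I" "(\<Sum>i\<in>I. w i * b i) = k" "i \<in> I" "w i > 0"
  shows "b i \<le> k"
proof -
  have "b i \<le> w i * b i" using assms by simp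
  also have "\<dots> \<le> k" unfolding assms(2)[symmetric] by (rule member_le_sum) (use assms in auto)
  finally show ?thesis .
qed

lemma finite_sol:
  fixes w :: "'a \<Rightarrow> nat"
  assumes "finite I" "\<And>i. i \<in> I \<Longrightarrow> w i > 0"
  shows "finite {b \<in> I \<rightarrow>\<^sub>E UNIV. (\<Sum>i\<in>I. w i * b i) = k}"
proof (rule finite_subset)
  show "{b \<in> I \<rightarrow>\<^sub>E UNIV. (\<Sum>i\<in>I. w i * b i) = k} \<subseteq> I \<rightarrow>\<^sub>E {..k}"
  proof
    fix b assume b: "b \<in> {b \<in> I \<rightarrow>\<^sub>E UNIV. (\<Sum>i\<in>I. w i * b i) = k}"
    then have "b i \<le> k" if "i \<in> I" for i
      using sol_le[of I w b k i] assms that by auto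
    then show "b \<in> I \<rightarrow>\<^sub>E {..k}" using b by (auto simp: PiE_iff)
  qed
  show "finite (I \<rightarrow>\<^sub>E {..k})" using assms by (intro finite_PiE) auto
qed

lemma finite_mult_le: "(c::nat) > 0 \<Longrightarrow> finite {t. c * t \<le> k}"
proof (rule finite_subset)
  assume "c > 0"
  then have "t \<le> c * t" for t by simp
  then show "{t. c * t \<le> k} \<subseteq> {..k}" using order.trans by blast
qed auto

lemma nsol_insert:
  assumes "finite I" "\<And>i. i \<in> I \<Longrightarrow> w i > 0" "x \<notin> I" "w x > 0"
  shows "nsol (insert x I) w k = (\<Sum>t\<in>{t. w x * t \<le> k}. nsol I w (k - w x * t))"
proof -
  let ?S = "\<lambda>k. {b \<in> I \<rightarrow>\<^sub>E UNIV. (\<Sum>i\<in>I. w i * b i) = k}"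
  let ?T = "{t. w x * t \<le> k}"
  have finT: "finite ?T" 
    by (rule finite_mult_le[OF assms(4)])
  have "{b \<in> insert x I \<rightarrow>\<^sub>E UNIV. (\<Sum>i\<in>insert x I. w i * b i) = k}
     = (\<lambda>(t, g). g(x := t)) ` (SIGMA t:?T. ?S (k - w x * t))"
  proof (intro equalityI subsetI)
    fix b assume b: "b \<in> {b \<in> insert x I \<rightarrow>\<^sub>E UNIV. (\<Sum>i\<in>insert x I. w i * b i) = k}"
    define g where "g = b(x := undefined)"
    have "(\<Sum>i\<in>I. w i * g i) = (\<Sum>i\<in>I. w i * b i)"
      using assms(3) by (intro sum.cong) (auto simp: g_def)
    moreover have "w x * b x + (\<Sum>i\<in>I. w i * b i) = k" using b assms by simp
    moreover have "g \<in> I \<rightarrow>\<^sub>E UNIV" using b assms(3) by (auto simp: g_def PiE_iff extensional_def)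
    ultimately have "(b x, g) \<in> (SIGMA t:?T. ?S (k - w x * t))" by auto
    then show "b \<in> (\<lambda>(t, g). g(x := t)) ` (SIGMA t:?T. ?S (k - w x * t))"
      by (rule rev_image_eqI) (auto simp: g_def)
  next
    fix b assume "b \<in> (\<lambda>(t, g). g(x := t)) ` (SIGMA t:?T. ?S (k - w x * t))"
    then obtain t g where tg: "w x * t \<le> k" "g \<in> I \<rightarrow>\<^sub>E UNIV" "(\<Sum>i\<in>I. w i * g i) = k - w x * t" "b = g(x := t)"
      by auto
    have "(\<Sum>i\<in>I. w i * b i) = (\<Sum>i\<in>I. w i * g i)"
      using assms(3) tg by (intro sum.cong) auto
    then show "b \<in> {b \<in> insert x I \<rightarrow>\<^sub>E UNIV. (\<Sum>i\<in>insert x I. w i * b i) = k}"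
      using tg assms by (auto simp: PiE_iff extensional_def)
  qed
  moreover have "inj_on (\<lambda>(t, g). g(x := t)) (SIGMA t:?T. ?S (k - w x * t))"
  proof (rule inj_onI, safe)
    fix t g t' g' assume g: "g \<in> I \<rightarrow>\<^sub>E UNIV" "g' \<in> I \<rightarrow>\<^sub>E UNIV" "g(x := t) = g'(x := t')"
    show "t = t'" using fun_cong[OF g(3), of x] by simp
    show "g = g'"
    proof
      fix y show "g y = g' y"
        using fun_cong[OF g(3), of y] PiE_arb[OF g(1) assms(3)] PiE_arb[OF g(2) assms(3)]
        by (cases "y = x") auto
    qed
  qed
  ultimately have "nsol (insert x I) w k = card (SIGMA t:?T. ?S (k - w x * t))"
    unfolding nsol_def by (simp only: card_image)
  also have "\<dots> = (\<Sum>t\<in>?T. nsol I w (k - w x * t))"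
    unfolding nsol_def using finT finite_sol[OF assms(1,2)] by (intro card_SigmaI) auto
  finally show ?thesis .
qed

lemma nsol_not_dvd:
  assumes "finite I" "g dvd k \<Longrightarrow> False" "\<And>i. i \<in> I \<Longrightarrow> g dvd w i"
  shows "nsol I w k = 0"
proof -
  have "g dvd (\<Sum>i\<in>I. w i * b i)" for b using assms by (intro dvd_sum) auto
  then have "{b \<in> I \<rightarrow>\<^sub>E UNIV. (\<Sum>i\<in>I. w i * b i) = k} = {}" using assms(2) by auto
  then show ?thesis unfolding nsol_def by (simp only: card.empty)
qed

lemma nsol_singleton:
  assumes "w x > 0"
  shows "nsol {x} w k = (if w x dvd k then 1 else 0)"
proof (cases "w x dvd k")
  case True
  then obtain t where t: "k = w x * t" by auto
  have "{b \<in> {x} \<rightarrow>\<^sub>E UNIV. (\<Sum>i\<in>{x}. w i * b i) = k} = {(\<lambda>_. undefined)(x := t)}"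
    using assms t by (auto simp: PiE_iff extensional_def fun_eq_iff)
  then show ?thesis using True unfolding nsol_def by (simp only: card.insert card.empty) simp
next
  case False
  then show ?thesis using nsol_not_dvd[of "{x}" "w x" k w] by auto
qed

text \<open>The mean value bounds for a power, with the derivative taken at either end of the
  interval.\<close>

lemma power_diff_le:
  fixes a b :: real
  assumes "0 \<le> b" "b \<le> a"
  shows "a ^ n - b ^ n \<le> real n * a ^ (n - 1) * (a - b)"
    and "real n * b ^ (n - 1) * (a - b) \<le> a ^ n - b ^ n"
proof -
  show "a ^ n - b ^ n \<le> real n * a ^ (n - 1) * (a - b)"
  proof (induction n)
    case (Suc n)
    have "a ^ Suc n - b ^ Suc n = a * (a ^ n - b ^ n) + (a - b) * b ^ n" by (simp add: algebra_simps)
    also have "\<dots> \<le> a * (real n * a ^ (n - 1) * (a - b)) + (a - b) * a ^ n"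
      using assms by (intro add_mono mult_left_mono Suc power_mono) auto
    also have "\<dots> = real (Suc n) * a ^ n * (a - b)"
      by (cases n) (simp_all add: algebra_simps)
    finally show ?case by simp
  qed auto
  show "real n * b ^ (n - 1) * (a - b) \<le> a ^ n - b ^ n"
  proof (induction n)
    case (Suc n)
    have "real (Suc n) * b ^ n * (a - b) = b * (real n * b ^ (n - 1) * (a - b)) + (a - b) * b ^ n"
      by (cases n) (simp_all add: algebra_simps)
    also have "\<dots> \<le> b * (a ^ n - b ^ n) + (a - b) * a ^ n"
      using assms by (intro add_mono mult_left_mono Suc power_mono) auto
    also have "\<dots> = a ^ Suc n - b ^ Suc n" by (simp add: algebra_simps)
    finally show ?case by simp
  qed auto
qed

text \<open>With \<open>d = gcd w g\<close>, the quotient \<open>w div d\<close> is invertible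
  modulo \<open>g div d\<close>, so the congruence has exactly one solution per period of length
  \<open>g div d\<close>.\<close>

lemma unique_multiple_mod:
  fixes w g k :: nat
  assumes "w > 0" "g > 0" "gcd w g dvd k"
  obtains t where "t < g div gcd w g"
    "\<And>t'. t' < g div gcd w g \<Longrightarrow> [w * t' = k] (mod g) \<longleftrightarrow> t' = t"
proof -
  define d where "d = gcd w g"
  define e where "e = g div d"
  have d: "d > 0" "d dvd w" "d dvd g" using assms by (auto simp: d_def)
  have e: "e > 0" "g = d * e" using d assms by (auto simp: e_def dvd_div_eq_0_iff)
  have cop: "coprime (w div d) e"
    unfolding d_def e_def using assms by (intro div_gcd_coprime) auto
  obtain t0 where t0: "[w * t0 = d] (mod g)" using cong_solve_nat[of w g] assms d_def by auto
  obtain k' where k': "k = d * k'" using assms d_def by auto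
  have ex: "[w * (t0 * k') = k] (mod g)"
    using cong_mult[OF t0 cong_refl[of k']] k' by (simp add: mult_ac)
  have char: "[w * s = w * s'] (mod g) \<longleftrightarrow> [s = s'] (mod e)" for s s'
  proof -
    obtain w' where w': "w = d * w'" using d by auto
    then have "w' = w div d" using d by simp
    then have "coprime w' e" using cop by simp
    have "[w * s = w * s'] (mod g) \<longleftrightarrow> [w' * s = w' * s'] (mod e)"
      unfolding w' e(2) mult.assoc cong_def using d by (simp add: mod_mult_mult1)
    also have "\<dots> \<longleftrightarrow> [s = s'] (mod e)" using \<open>coprime w' e\<close> by (rule cong_mult_lcancel_nat)
    finally show ?thesis .
  qed
  show thesis
  proof (rule that[of "(t0 * k') mod e"])
    show "(t0 * k') mod e < g div gcd w g" using e(1) unfolding e_def d_def by (rule mod_less_divisor)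
    fix t' assume "t' < g div gcd w g"
    then have t': "t' < e" by (simp only: e_def d_def)
    have "[w * t' = k] (mod g) \<longleftrightarrow> [w * t' = w * (t0 * k')] (mod g)"
      using ex by (meson cong_sym cong_trans)
    also have "\<dots> \<longleftrightarrow> [t' = t0 * k'] (mod e)" by (rule char)
    also have "\<dots> \<longleftrightarrow> t' = (t0 * k') mod e" using t' by (simp add: cong_def)
    finally show "[w * t' = k] (mod g) \<longleftrightarrow> t' = (t0 * k') mod e" .
  qed
qed

text \<open>Only the first \<open>e\<close> values of the new variable are listed; the others are
  shifted by \<open>e\<close>. This turns the full sum into a recursion with step
  \<open>w x * e\<close>, suited to induction on \<open>k\<close>.\<close>

lemma nsol_insert_step:
  assumes "finite I" "\<And>i. i \<in> I \<Longrightarrow> w i > 0" "x \<notin> I" "w x > 0" "k \<ge> w x * e"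
  shows "nsol (insert x I) w k = (\<Sum>t<e. nsol I w (k - w x * t)) + nsol (insert x I) w (k - w x * e)"
proof -
  let ?T = "\<lambda>k. {t. w x * t \<le> k}"
  have finT: "finite (?T k)" for k
    by (rule finite_mult_le[OF assms(4)])
  have "?T k = {..<e} \<union> (\<lambda>t. t + e) ` ?T (k - w x * e)"
  proof (intro equalityI subsetI)
    fix t assume t: "t \<in> ?T k"
    show "t \<in> {..<e} \<union> (\<lambda>t. t + e) ` ?T (k - w x * e)"
    proof (cases "t < e")
      case False
      then have "t = (t - e) + e" by simp
      moreover have "w x * (t - e) \<le> k - w x * e"
        using t by (simp add: diff_mult_distrib2 diff_le_mono)
      ultimately show ?thesis by blast
    qed auto
  next
    fix t assume t: "t \<in> {..<e} \<union> (\<lambda>t. t + e) ` ?T (k - w x * e)"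
    show "t \<in> ?T k"
    proof (cases "t < e")
      case True
      then have "w x * t \<le> w x * e" by simp
      from order.trans[OF this assms(5)] show ?thesis by simp
    next
      case False
      then obtain s where "t = s + e" "w x * s \<le> k - w x * e" using t by auto
      then show ?thesis using assms(5) by (simp add: add_mult_distrib2)
    qed
  qed
  moreover have "{..<e} \<inter> (\<lambda>t. t + e) ` ?T (k - w x * e) = {}" by auto
  ultimately have "(\<Sum>t\<in>?T k. nsol I w (k - w x * t)) = (\<Sum>t<e. nsol I w (k - w x * t)) +
     (\<Sum>t\<in>(\<lambda>t. t + e) ` ?T (k - w x * e). nsol I w (k - w x * t))"
    using finT by (simp add: sum.union_disjoint)
  also have "(\<Sum>t\<in>(\<lambda>t. t + e) ` ?T (k - w x * e). nsol I w (k - w x * t)) =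
     (\<Sum>t\<in>?T (k - w x * e). nsol I w (k - w x * e - w x * t))"
    by (subst sum.reindex) (auto simp: inj_on_def add_mult_distrib2 intro!: sum.cong arg_cong[of _ _ "nsol I w"])
  finally show ?thesis by (simp add: nsol_insert[of I w x, OF assms(1-4)])
qed

text \<open>Adding a weight \<open>w x\<close> to weights with gcd \<open>g\<close>: of the \<open>g / gcd (w x) g\<close> successive values
  \<open>k - w x * t\<close> exactly one is divisible by \<open>g\<close>, so the new count increases by one old count every
  \<open>lcm (w x) g\<close>. The factor \<open>card I - 1\<close> in the error makes the one-weight case exact.\<close>

lemma nsol_asymp:
  assumes "finite I" "I \<noteq> {}" "\<And>i. i \<in> I \<Longrightarrow> w i > 0"
  shows "\<exists>C\<ge>0. \<forall>k. Gcd (w ` I) dvd k \<longrightarrow>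
    \<bar>real (nsol I w k) - real (Gcd (w ` I)) / (fact (card I - 1) * (\<Prod>i\<in>I. real (w i))) * real k ^ (card I - 1)\<bar>
      \<le> C * real (card I - 1) * (real k + 1) ^ (card I - 2)"
  using assms
proof (induction I rule: finite_ne_induct)
  case (singleton x)
  then show ?case by (intro exI[of _ 0]) (auto simp: nsol_singleton)
next
  case (insert x I)
  define g where "g = Gcd (w ` I)"
  define n where "n = card I"
  define d where "d = gcd (w x) g"
  define e where "e = g div d"
  define P where "P = (\<Prod>i\<in>I. real (w i))"
  define B where "B = real g / (fact (n - 1) * P)"
  define A where "A = real d / (fact n * (real (w x) * P))"
  define st where "st = w x * e"
  have wpos: "\<And>i. i \<in> I \<Longrightarrow> w i > 0" "w x > 0" using insert.prems by auto
  have n: "n \<ge> 1" using insert.hyps by (auto simp: n_def Suc_le_eq card_gt_0_iff)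
  have g: "g > 0"
  proof -
    obtain i where "i \<in> I" using insert.hyps by auto
    then have "g dvd w i" "w i > 0" using wpos by (auto simp: g_def intro: Gcd_dvd)
    then show ?thesis by (auto intro: Nat.gr0I)
  qed
  have d: "d > 0" "d dvd g" "d dvd w x" using g by (auto simp: d_def)
  have e: "e > 0" "g = d * e" using d g by (auto simp: e_def dvd_div_eq_0_iff)
  have st: "st > 0" using e wpos by (simp add: st_def)
  have P: "P > 0" using wpos by (auto simp: P_def intro: prod_pos)
  have B: "B > 0" using g P by (simp add: B_def)
  have A: "A > 0" using d P wpos by (simp add: A_def)
  \<comment> \<open>The leading constants match: the derivative of \<open>A * k ^ n\<close>, taken
    over one period \<open>st\<close>, is \<open>B * k ^ (n - 1)\<close>.\<close>
  have AB: "A * real n * real st = B"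
  proof -
    have "(fact n :: real) = real n * fact (n - 1)" using n by (subst fact_reduce) auto
    then show ?thesis using n P wpos by (simp add: A_def B_def st_def e(2))
  qed
  obtain C where C: "C \<ge> 0" "\<And>k. g dvd k \<Longrightarrow>
      \<bar>real (nsol I w k) - B * real k ^ (n - 1)\<bar> \<le> C * real (n - 1) * (real k + 1) ^ (n - 2)"
    using insert.IH[OF wpos(1)] unfolding g_def[symmetric] n_def[symmetric] P_def[symmetric] B_def[symmetric] by auto
  define K0 where "K0 = (\<Sum>k<st. real (nsol (insert x I) w k))"
  have K0: "real (nsol (insert x I) w k) \<le> K0" if "k < st" for k
    unfolding K0_def using that by (intro member_le_sum) auto
  \<comment> \<open>\<open>K0 + A * real st ^ n\<close> pays for the initial stretch
    \<open>k < st\<close>, the other two summands for the error made in one period.\<close>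
  define C' where "C' = K0 + A * real st ^ n + C * real (n - 1) + B * real (n - 1) * real st"
  have K0nn: "K0 \<ge> 0" by (auto simp: K0_def intro: sum_nonneg)
  have C'nn: "C' \<ge> 0" using K0nn A B C(1) by (auto simp: C'_def intro!: add_nonneg_nonneg)
  have main: "\<bar>real (nsol (insert x I) w k) - A * real k ^ n\<bar> \<le> C' * (real k + 1) ^ (n - 1)" if "d dvd k" for k
    using that
  proof (induction k rule: less_induct)
    case (less k)
    show ?case
    proof (cases "k < st")
      case True
      have "A * real k ^ n \<le> A * real st ^ n" using True A by (intro mult_left_mono power_mono) auto
      moreover have "0 \<le> A * real k ^ n" using A by simp
      ultimately have "\<bar>real (nsol (insert x I) w k) - A * real k ^ n\<bar> \<le> K0 + A * real st ^ n"
        using K0[OF True] by linarith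
      also have "\<dots> \<le> C' * 1" using C B by (simp add: C'_def)
      also have "\<dots> \<le> C' * (real k + 1) ^ (n - 1)" using C'nn by (intro mult_left_mono one_le_power) auto
      finally show ?thesis .
    next
      case False
      then have kst: "k \<ge> st" by simp
      obtain t where t: "t < e" "\<And>t'. t' < e \<Longrightarrow> [w x * t' = k] (mod g) \<longleftrightarrow> t' = t"
        using unique_multiple_mod[OF wpos(2) g, of k] less.prems unfolding d_def[symmetric] e_def[symmetric] by metis
      define y where "y = k - w x * t"
      have wt: "w x * t' < st" if "t' < e" for t' using that wpos by (simp add: st_def)
      have dvd: "g dvd (k - w x * t') \<longleftrightarrow> t' = t" if "t' < e" for t'
        using t(2)[OF that] wt[OF that] kst cong_altdef_nat[of "w x * t'" k g] cong_sym_eq[of k "w x * t'" g]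
        by simp
      have "(\<Sum>t'<e. nsol I w (k - w x * t')) = (\<Sum>t'<e. if t' = t then nsol I w y else 0)"
      proof (intro sum.cong refl)
        fix t' assume "t' \<in> {..<e}"
        then show "nsol I w (k - w x * t') = (if t' = t then nsol I w y else 0)"
          using dvd[of t'] nsol_not_dvd[OF insert.hyps(1), of g "k - w x * t'" w]
          by (auto simp: y_def g_def intro: Gcd_dvd)
      qed
      also have "\<dots> = nsol I w y" using t by simp
      finally have step: "nsol (insert x I) w k = nsol I w y + nsol (insert x I) w (k - st)"
        using nsol_insert_step[of I w x e k] insert.hyps wpos kst unfolding st_def by simp
      have y: "g dvd y" "k - st \<le> y" "y \<le> k" using dvd[OF t(1)] wt[OF t(1)] by (auto simp: y_def)
      have "d dvd st" unfolding st_def using d by simp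
      then have IH: "\<bar>real (nsol (insert x I) w (k - st)) - A * real (k - st) ^ n\<bar> \<le> C' * (real (k - st) + 1) ^ (n - 1)"
        using less.prems kst st by (intro less.IH) (auto intro: dvd_diff_nat)
      define a b z where "a = real k" and "b = real (k - st)" and "z = real y"
      have abz: "0 \<le> b" "b \<le> z" "z \<le> a" "a - b = real st" using y kst by (auto simp: a_def b_def z_def)
      have E1: "\<bar>real (nsol I w y) - B * z ^ (n - 1)\<bar> \<le> C * real (n - 1) * (a + 1) ^ (n - 2)"
      proof -
        have "C * real (n - 1) * (z + 1) ^ (n - 2) \<le> C * real (n - 1) * (a + 1) ^ (n - 2)"
          using C(1) abz by (intro mult_left_mono power_mono) auto
        then show ?thesis using C(2)[OF y(1)] by (simp add: a_def b_def z_def)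
      qed
      \<comment> \<open>Both quantities lie between \<open>B * b ^ (n - 1)\<close> and
        \<open>B * a ^ (n - 1)\<close>: the first because \<open>y\<close> lies in the period, the
        second by the two mean value bounds.\<close>
      have E2: "\<bar>B * z ^ (n - 1) - (A * a ^ n - A * b ^ n)\<bar> \<le> B * real (n - 1) * real st * (a + 1) ^ (n - 2)"
      proof -
        have "A * (a ^ n - b ^ n) \<le> A * (real n * a ^ (n - 1) * (a - b))"
          using A abz by (intro mult_left_mono power_diff_le) auto
        also have "\<dots> = B * a ^ (n - 1)" using abz AB by (simp add: mult_ac flip: AB)
        finally have 1: "A * (a ^ n - b ^ n) \<le> B * a ^ (n - 1)" .
        have "A * (real n * b ^ (n - 1) * (a - b)) \<le> A * (a ^ n - b ^ n)"
          using A abz by (intro mult_left_mono power_diff_le) auto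
        moreover have "A * (real n * b ^ (n - 1) * (a - b)) = B * b ^ (n - 1)"
          using abz AB by (simp add: mult_ac flip: AB)
        ultimately have 2: "B * b ^ (n - 1) \<le> A * (a ^ n - b ^ n)" by (simp only:)
        have 3: "B * b ^ (n - 1) \<le> B * z ^ (n - 1)" "B * z ^ (n - 1) \<le> B * a ^ (n - 1)"
          using B abz by (auto intro!: mult_left_mono power_mono)
        have "\<bar>B * z ^ (n - 1) - (A * a ^ n - A * b ^ n)\<bar> \<le> B * (a ^ (n - 1) - b ^ (n - 1))"
          using 1 2 3 unfolding right_diff_distrib abs_le_iff by linarith
        also have "\<dots> \<le> B * (real (n - 1) * a ^ (n - 1 - 1) * (a - b))"
          using B abz by (intro mult_left_mono power_diff_le) auto
        also have "\<dots> \<le> B * (real (n - 1) * (a + 1) ^ (n - 1 - 1) * (a - b))"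
          using B abz by (intro mult_left_mono mult_right_mono power_mono) auto
        also have "\<dots> = B * real (n - 1) * real st * (a + 1) ^ (n - 2)"
          using abz by (simp add: numeral_2_eq_2)
        finally show ?thesis .
      qed
      \<comment> \<open>Passing from \<open>b\<close> to \<open>a\<close>, which differ by
        \<open>st \<ge> 1\<close>, increases the error bound by at least
        \<open>C' * (a + 1) ^ (n - 2)\<close>, enough to absorb the error of one period. For
        \<open>n = 1\<close> there is no such gain, but then the factor \<open>n - 1\<close>
        annihilates the error.\<close>
      have E3: "C' * (b + 1) ^ (n - 1) + (C * real (n - 1) + B * real (n - 1) * real st) * (a + 1) ^ (n - 2)
         \<le> C' * (a + 1) ^ (n - 1)"
      proof (cases "n = 1")
        case False
        then obtain m where m: "n = Suc (Suc m)" using n by (cases n; cases "n - 1") auto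
        have "(C * real (n - 1) + B * real (n - 1) * real st) * (a + 1) ^ (n - 2) \<le> C' * ((a - b) * (a + 1) ^ m)"
        proof -
          have "C * real (n - 1) + B * real (n - 1) * real st \<le> C'"
            using K0nn A by (simp add: C'_def)
          moreover have "1 * (a + 1) ^ m \<le> (a - b) * (a + 1) ^ m"
            using abz st by (intro mult_right_mono) auto
          ultimately show ?thesis using m C'nn abz by (intro mult_mono) auto
        qed
        moreover have "(b + 1) * (b + 1) ^ m \<le> (b + 1) * (a + 1) ^ m"
          using abz by (intro mult_left_mono power_mono) auto
        then have "C' * ((b + 1) * (b + 1) ^ m) \<le> C' * ((b + 1) * (a + 1) ^ m)"
          using C'nn by (rule mult_left_mono)
        ultimately have "C' * (b + 1) ^ (n - 1) + (C * real (n - 1) + B * real (n - 1) * real st) * (a + 1) ^ (n - 2)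
          \<le> C' * ((b + 1) * (a + 1) ^ m) + C' * ((a - b) * (a + 1) ^ m)"
          unfolding m by simp
        also have "\<dots> = C' * (a + 1) ^ (n - 1)" unfolding m by (simp add: algebra_simps)
        finally show ?thesis .
      qed simp
      have "\<bar>real (nsol (insert x I) w k) - A * a ^ n\<bar> \<le>
         \<bar>real (nsol (insert x I) w (k - st)) - A * b ^ n\<bar> + \<bar>real (nsol I w y) - B * z ^ (n - 1)\<bar>
          + \<bar>B * z ^ (n - 1) - (A * a ^ n - A * b ^ n)\<bar>"
        unfolding step by simp
      also have "\<dots> \<le> C' * (b + 1) ^ (n - 1) + C * real (n - 1) * (a + 1) ^ (n - 2) +
          B * real (n - 1) * real st * (a + 1) ^ (n - 2)"
        using E1 E2 IH by (intro add_mono) (auto simp: a_def b_def z_def)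
      also have "\<dots> \<le> C' * (a + 1) ^ (n - 1)" using E3 by (simp add: algebra_simps)
      finally show ?thesis by (simp add: a_def b_def z_def)
    qed
  qed
  have "Gcd (w ` insert x I) = d" by (simp add: d_def g_def)
  moreover have "card (insert x I) = Suc n" using insert.hyps by (simp add: n_def)
  moreover have "(\<Prod>i\<in>insert x I. real (w i)) = real (w x) * P" using insert.hyps by (simp add: P_def)
  moreover have "C' * (real k + 1) ^ (n - 1) \<le> C' * real n * (real k + 1) ^ (n - 1)" for k
    using C'nn n by (intro mult_right_mono) (auto simp: mult_le_cancel_left1)
  ultimately show ?case
    using C'nn main by (intro exI[of _ C']) (auto simp: A_def intro: order.trans)
qed

definition bsol :: "'a set \<Rightarrow> ('a \<Rightarrow> nat) \<Rightarrow> nat \<Rightarrow> nat \<Rightarrow> nat" where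
  "bsol I w N k = card {b \<in> I \<rightarrow>\<^sub>E {..N}. (\<Sum>i\<in>I. w i * b i) = k}"

lemma sum_PiE_insert:
  assumes "a \<notin> I"
  shows "(\<Sum>t\<in>PiE (insert a I) T. f t) = (\<Sum>s\<in>T a. \<Sum>t\<in>PiE I T. f (t(a := s)))"
  unfolding PiE_insert_eq sum.reindex[OF inj_combinator[OF assms]]
  by (simp add: sum.cartesian_product o_def case_prod_unfold)

text \<open>In each coordinate, the unit differences at \<open>0, ..., w i - 1\<close> telescope to
  one difference of step \<open>w i\<close>; the lemma does this for all coordinates, one after the
  other.\<close>

lemma sum_PiE_differences:
  fixes \<phi> :: "real \<Rightarrow> real" and w :: "'a \<Rightarrow> nat"
  assumes "finite I"
  shows "(\<Sum>t\<in>(\<Pi>\<^sub>E i\<in>I. {0..int (w i) - 1}). \<Sum>J\<in>Pow I. (-1) ^ card J * \<phi> (x - real_of_int (\<Sum>i\<in>I. t i) - real (card J)))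
     = (\<Sum>J\<in>Pow I. (-1) ^ card J * \<phi> (x - real (\<Sum>i\<in>J. w i)))"
  using assms
proof (induction I arbitrary: x rule: finite_induct)
  case empty
  then show ?case by simp
next
  case (insert a I)
  define \<Psi> where "\<Psi> y = (\<Sum>J\<in>Pow I. (-1) ^ card J * \<phi> (y - real (\<Sum>i\<in>J. w i)))" for y
  have inner: "(\<Sum>t\<in>(\<Pi>\<^sub>E i\<in>I. {0..int (w i) - 1}). \<Sum>J\<in>Pow (insert a I). (-1) ^ card J *
      \<phi> (x - real_of_int (\<Sum>i\<in>insert a I. (t(a := s)) i) - real (card J))) = \<Psi> (x - real_of_int s) - \<Psi> (x - real_of_int s - 1)" for s
  proof -
    have "(\<Sum>J\<in>Pow (insert a I). (-1) ^ card J * \<phi> (x - real_of_int (\<Sum>i\<in>insert a I. (t(a := s)) i) - real (card J)))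
       = (\<Sum>J\<in>Pow I. (-1) ^ card J * \<phi> ((x - real_of_int s) - real_of_int (\<Sum>i\<in>I. t i) - real (card J)))
       - (\<Sum>J\<in>Pow I. (-1) ^ card J * \<phi> ((x - real_of_int s - 1) - real_of_int (\<Sum>i\<in>I. t i) - real (card J)))" for t :: "'a \<Rightarrow> int"
    proof -
      have "(\<Sum>i\<in>I. (t(a := s)) i) = (\<Sum>i\<in>I. t i)" using insert.hyps by (intro sum.cong) auto
      then have T: "(\<Sum>i\<in>insert a I. (t(a := s)) i) = s + (\<Sum>i\<in>I. t i)" using insert.hyps by simp
      have "card (insert a J) = Suc (card J)" if "J \<in> Pow I" for J
        using insert.hyps that by (subst card_insert_disjoint) (auto intro: finite_subset)
      then show ?thesis
        unfolding T sum_Pow_insert[OF insert.hyps] sum_subtractf[symmetric]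
        by (intro sum.cong) (auto simp: algebra_simps)
    qed
    then show ?thesis by (simp only: sum_subtractf insert.IH \<Psi>_def)
  qed
  have tele: "(\<Sum>s\<in>{0..int m - 1}. \<Psi> (x - real_of_int s) - \<Psi> (x - real_of_int s - 1)) = \<Psi> x - \<Psi> (x - real m)" for m
  proof (induction m)
    case (Suc m)
    have "{0..int (Suc m) - 1} = insert (int m) {0..int m - 1}" by auto
    then show ?case using Suc by (simp add: algebra_simps)
  qed auto
  have "(\<Sum>J\<in>Pow (insert a I). (-1) ^ card J * \<phi> (x - real (\<Sum>i\<in>J. w i))) = \<Psi> x - \<Psi> (x - real (w a))"
  proof -
    have "card (insert a J) = Suc (card J)" "(\<Sum>i\<in>insert a J. w i) = w a + (\<Sum>i\<in>J. w i)" if "J \<in> Pow I" for J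
      using insert.hyps that by (auto intro: finite_subset card_insert_disjoint sum.insert)
    then show ?thesis
      unfolding \<Psi>_def sum_Pow_insert[OF insert.hyps] sum_subtractf[symmetric]
      by (intro sum.cong) (auto simp: algebra_simps)
  qed
  then show ?case unfolding sum_PiE_insert[OF insert.hyps(2)] inner tele by simp
qed

lemma sum_Pow_card:
  fixes f :: "nat \<Rightarrow> real"
  assumes "finite I"
  shows "(\<Sum>J\<in>Pow I. f (card J)) = (\<Sum>j\<le>card I. real (card I choose j) * f j)"
proof -
  have "(\<Sum>J\<in>Pow I. f (card J)) = (\<Sum>j\<le>card I. \<Sum>J\<in>{J\<in>Pow I. card J = j}. f (card J))"
    using assms by (intro sum.group[symmetric]) (auto intro: card_mono)
  also have "\<dots> = (\<Sum>j\<le>card I. real (card I choose j) * f j)"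
  proof (intro sum.cong refl)
    fix j
    have "{J\<in>Pow I. card J = j} = {J. J \<subseteq> I \<and> card J = j}" by auto
    then show "(\<Sum>J\<in>{J\<in>Pow I. card J = j}. f (card J)) = real (card I choose j) * f j"
      using n_subsets[OF assms, of j] by simp
  qed
  finally show ?thesis .
qed

text \<open>Each difference lowers the degree of a polynomial by at least one, so
  \<open>card I\<close> of them annihilate every degree below \<open>card I\<close>.\<close>

lemma finite_difference_power:
  fixes y :: real
  assumes "finite I" "m < card I"
  shows "(\<Sum>J\<in>Pow I. (-1) ^ card J * (y - real (card J)) ^ m) = 0"
  using assms
proof (induction I arbitrary: m rule: finite_induct)
  case empty
  then show ?case by simp
next
  case (insert a I)
  have c: "card (insert a J) = Suc (card J)" if "J \<in> Pow I" for J
    using insert.hyps that by (subst card_insert_disjoint) (auto intro: finite_subset)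
  have diff: "z ^ m - (z - 1) ^ m = (\<Sum>i<m. - (real (m choose i) * (-1) ^ (m - i)) * z ^ i)" for z :: real
  proof -
    have "(z - 1) ^ m = (\<Sum>i\<le>m. real (m choose i) * z ^ i * (-1) ^ (m - i))"
      using binomial_ring[of z "-1" m] by simp
    also have "\<dots> = (\<Sum>i<m. real (m choose i) * z ^ i * (-1) ^ (m - i)) + z ^ m"
      by (simp add: lessThan_Suc_atMost[symmetric])
    finally show ?thesis by (simp add: sum_negf mult_ac)
  qed
  have "(\<Sum>J\<in>Pow (insert a I). (-1) ^ card J * (y - real (card J)) ^ m)
     = (\<Sum>J\<in>Pow I. (-1) ^ card J * ((y - real (card J)) ^ m - (y - real (card J) - 1) ^ m))"
    unfolding sum_Pow_insert[OF insert.hyps]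
    by (intro sum.cong) (auto simp: c algebra_simps)
  also have "\<dots> = (\<Sum>J\<in>Pow I. \<Sum>i<m. - (real (m choose i) * (-1) ^ (m - i)) * ((-1) ^ card J * (y - real (card J)) ^ i))"
    unfolding diff sum_distrib_left by (intro sum.cong) (auto simp: mult_ac)
  also have "\<dots> = (\<Sum>i<m. - (real (m choose i) * (-1) ^ (m - i)) * (\<Sum>J\<in>Pow I. (-1) ^ card J * (y - real (card J)) ^ i))"
    unfolding sum_distrib_left by (rule sum.swap)
  also have "\<dots> = 0" using insert by (intro sum.neutral) auto
  finally show ?case .
qed

text \<open>The cutoff at \<open>x > h\<close> in the definition of \<open>Irwin_Hall\<close> agrees
  with the formula: beyond \<open>h\<close> no power is truncated any more, and the alternating sum
  is a vanishing finite difference. So one formula covers all \<open>x\<close>.\<close>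

lemma Irwin_Hall_Pow:
  assumes "finite I" "card I = h" "h \<ge> 2"
  shows "Irwin_Hall h x = 1 / fact (h - 1) * (\<Sum>J\<in>Pow I. (-1) ^ card J * (max 0 (x - real (card J))) ^ (h - 1))"
proof -
  have "(\<Sum>J\<in>Pow I. (-1) ^ card J * (max 0 (x - real (card J))) ^ (h - 1))
      = (\<Sum>j=0..h. (-1) ^ j * real (h choose j) * (max 0 (x - real j)) ^ (h - 1))"
    using sum_Pow_card[OF assms(1), of "\<lambda>j. (-1) ^ j * (max 0 (x - real j)) ^ (h - 1)"] assms(2)
    by (simp add: atLeast0AtMost mult_ac)
  moreover have "(\<Sum>J\<in>Pow I. (-1) ^ card J * (max 0 (x - real (card J))) ^ (h - 1)) = 0" if "x > real h"
  proof -
    have "real (card J) \<le> x" if "J \<in> Pow I" for J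
      using card_mono[OF assms(1), of J] that \<open>x > real h\<close> assms(2) by auto
    then have "(\<Sum>J\<in>Pow I. (-1) ^ card J * (max 0 (x - real (card J))) ^ (h - 1)) =
        (\<Sum>J\<in>Pow I. (-1) ^ card J * (x - real (card J)) ^ (h - 1))"
      by (intro sum.cong) (auto simp: max_def)
    also have "\<dots> = 0" using assms by (intro finite_difference_power) auto
    finally show ?thesis .
  qed
  ultimately show ?thesis unfolding Irwin_Hall_def by auto
qed

section \<open>Bounded solutions for positive weights with gcd 1, and their limiting density\<close>

locale weights =
  fixes I :: "'a set" and w :: "'a \<Rightarrow> nat"
  assumes fin: "finite I" and card2: "card I \<ge> 2" and wpos: "i \<in> I \<Longrightarrow> w i > 0" and gcd1: "Gcd (w ` I) = 1"
begin

definition "n = card I"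
definition "W = (\<Sum>i\<in>I. w i)"
definition "A = 1 / (fact (n - 1) * (\<Prod>i\<in>I. real (w i)))"

text \<open>The density of a sum of independent uniform variables on the intervals from 0 to
  \<open>w i\<close>, in the form that inclusion-exclusion over the upper bounds produces.\<close>

definition dens :: "real \<Rightarrow> real" where
  "dens x = A * (\<Sum>J\<in>Pow I. (-1) ^ card J * (max 0 (x - real (\<Sum>i\<in>J. w i))) ^ (n - 1))"

lemma n2: "n \<ge> 2" using card2 by (simp add: n_def)

lemma A_pos: "A > 0"
  using wpos unfolding A_def by (intro divide_pos_pos mult_pos_pos prod_pos) auto

lemma W2: "W \<ge> 2"
proof -
  have "card I \<le> W" unfolding W_def using wpos sum_mono[of I "\<lambda>_. 1" w] by (auto simp: Suc_le_eq)
  then show ?thesis using card2 by simp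
qed

text \<open>A uniform variable on an interval of length \<open>w i\<close> is an equal mixture of
  uniform variables on its \<open>w i\<close> unit pieces. Algebraically this is
  \<open>sum_PiE_differences\<close> for the truncated power.\<close>

lemma dens_Irwin_Hall:
  "dens x = (\<Sum>t\<in>(\<Pi>\<^sub>E i\<in>I. {0..int (w i) - 1}). Irwin_Hall n (x - real_of_int (\<Sum>i\<in>I. t i))) / (\<Prod>i\<in>I. real (w i))"
proof -
  have "(\<Sum>t\<in>(\<Pi>\<^sub>E i\<in>I. {0..int (w i) - 1}). Irwin_Hall n (x - real_of_int (\<Sum>i\<in>I. t i))) =
    1 / fact (n - 1) * (\<Sum>J\<in>Pow I. (-1) ^ card J * (max 0 (x - real (\<Sum>i\<in>J. w i))) ^ (n - 1))"
    unfolding Irwin_Hall_Pow[OF fin n_def[symmetric] n2] sum_distrib_left[symmetric]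
    by (subst sum_PiE_differences[OF fin, where \<phi> = "\<lambda>y. max 0 y ^ (n - 1)"]) simp
  then show ?thesis unfolding dens_def A_def by simp
qed

lemma nsol_approx: "\<exists>C\<ge>0. \<forall>k. \<bar>real (nsol I w k) - A * real k ^ (n - 1)\<bar> \<le> C * (real k + 1) ^ (n - 2)"
proof -
  obtain C where C: "C \<ge> 0" "\<And>k. \<bar>real (nsol I w k) - A * real k ^ (n - 1)\<bar> \<le> C * real (n - 1) * (real k + 1) ^ (n - 2)"
    using nsol_asymp[of I w] fin wpos card2 gcd1 unfolding A_def n_def by fastforce
  then show ?thesis by (intro exI[of _ "C * real (n - 1)"]) auto
qed

lemma bsol_eq_nsol: "k \<le> N \<Longrightarrow> bsol I w N k = nsol I w k"
proof -
  assume k: "k \<le> N"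
  have "b i \<le> N" if "(\<Sum>i\<in>I. w i * b i) = k" "i \<in> I" for b i
    using sol_le[of I w b k i] fin wpos that k by auto
  then have "{b \<in> I \<rightarrow>\<^sub>E {..N}. (\<Sum>i\<in>I. w i * b i) = k} = {b \<in> I \<rightarrow>\<^sub>E UNIV. (\<Sum>i\<in>I. w i * b i) = k}"
    by (auto simp: PiE_iff)
  then show ?thesis unfolding bsol_def nsol_def by simp
qed

text \<open>The reflection of every entry at the middle of \<open>{..N}\<close>; it makes the two
  ends of the range look alike.\<close>

lemma bsol_sym:
  assumes "k \<le> N * W"
  shows "bsol I w N (N * W - k) = bsol I w N k"
proof -
  let ?S = "\<lambda>k. {b \<in> I \<rightarrow>\<^sub>E {..N}. (\<Sum>i\<in>I. w i * b i) = k}"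
  let ?f = "\<lambda>b. restrict (\<lambda>i. N - b i) I"
  have eq: "(\<Sum>i\<in>I. w i * ?f b i) + (\<Sum>i\<in>I. w i * b i) = N * W" if "b \<in> I \<rightarrow>\<^sub>E {..N}" for b
  proof -
    have "(\<Sum>i\<in>I. w i * ?f b i) + (\<Sum>i\<in>I. w i * b i) = (\<Sum>i\<in>I. w i * ?f b i + w i * b i)"
      by (simp add: sum.distrib)
    also have "\<dots> = (\<Sum>i\<in>I. w i * N)"
      using that by (intro sum.cong) (auto simp: PiE_iff simp flip: distrib_left)
    finally show ?thesis by (simp add: W_def sum_distrib_left mult.commute)
  qed
  have "bij_betw ?f (?S k) (?S (N * W - k))"
  proof (rule bij_betw_byWitness[where f' = ?f])
    show "\<forall>b\<in>?S k. ?f (?f b) = b" "\<forall>b\<in>?S (N * W - k). ?f (?f b) = b"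
      by (auto simp: fun_eq_iff PiE_iff extensional_def)
    show "?f ` ?S k \<subseteq> ?S (N * W - k)"
    proof (intro image_subsetI)
      fix b assume b: "b \<in> ?S k"
      then have b': "b \<in> I \<rightarrow>\<^sub>E {..N}" "(\<Sum>i\<in>I. w i * b i) = k" by blast+
      have "?f b \<in> I \<rightarrow>\<^sub>E {..N}" by auto
      moreover have "(\<Sum>i\<in>I. w i * ?f b i) = N * W - k" using eq[OF b'(1)] b'(2) by linarith
      ultimately show "?f b \<in> ?S (N * W - k)" by blast
    qed
    show "?f ` ?S (N * W - k) \<subseteq> ?S k"
    proof (intro image_subsetI)
      fix b assume b: "b \<in> ?S (N * W - k)"
      then have b': "b \<in> I \<rightarrow>\<^sub>E {..N}" "(\<Sum>i\<in>I. w i * b i) = N * W - k" by blast+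
      have "?f b \<in> I \<rightarrow>\<^sub>E {..N}" by auto
      moreover have "(\<Sum>i\<in>I. w i * ?f b i) = k" using eq[OF b'(1)] b'(2) assms by linarith
      ultimately show "?f b \<in> ?S k" by blast
    qed
  qed
  then show ?thesis unfolding bsol_def by (simp add: bij_betw_same_card)
qed

text \<open>\<open>J\<close> runs over sets of coordinates required to exceed \<open>N\<close>.
  Subtracting \<open>Suc N\<close> from these entries turns them into arbitrary natural numbers and
  lowers the target accordingly.\<close>

lemma bsol_inclusion_exclusion:
  "real (bsol I w N k) = (\<Sum>J\<in>Pow I. (-1) ^ card J *
     (if Suc N * (\<Sum>i\<in>J. w i) \<le> k then real (nsol I w (k - Suc N * (\<Sum>i\<in>J. w i))) else 0))"
proof -
  let ?S = "\<lambda>k. {b \<in> I \<rightarrow>\<^sub>E UNIV. (\<Sum>i\<in>I. w i * b i) = k}"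
  have finS: "finite (?S k)" for k by (rule finite_sol[OF fin wpos])
  have count: "card {b \<in> ?S k. \<forall>i\<in>J. b i > N} = (if Suc N * (\<Sum>i\<in>J. w i) \<le> k then nsol I w (k - Suc N * (\<Sum>i\<in>J. w i)) else 0)"
    if J: "J \<subseteq> I" for J
  proof -
    let ?sh = "\<lambda>b. restrict (\<lambda>i. if i \<in> J then b i + Suc N else b i) I"
    let ?un = "\<lambda>b. restrict (\<lambda>i. if i \<in> J then b i - Suc N else b i) I"
    have sumsh: "(\<Sum>i\<in>I. w i * ?sh b i) = (\<Sum>i\<in>I. w i * b i) + Suc N * (\<Sum>i\<in>J. w i)" for b
    proof -
      have "(\<Sum>i\<in>I. w i * ?sh b i) = (\<Sum>i\<in>I. w i * b i + (if i \<in> J then w i * Suc N else 0))"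
        by (intro sum.cong) (auto simp: algebra_simps)
      also have "\<dots> = (\<Sum>i\<in>I. w i * b i) + (\<Sum>i\<in>I. if i \<in> J then w i * Suc N else 0)"
        by (rule sum.distrib)
      also have "(\<Sum>i\<in>I. if i \<in> J then w i * Suc N else 0) = (\<Sum>i\<in>J. w i * Suc N)"
        using J fin by (simp add: sum.If_cases Int_absorb1)
      finally show ?thesis by (simp only: sum_distrib_left mult.commute)
    qed
    have un: "?sh (?un b) = b" if "b \<in> {b \<in> ?S k. \<forall>i\<in>J. b i > N}" for b
    proof
      fix i
      show "?sh (?un b) i = b i"
        using that J by (cases "i \<in> I"; cases "i \<in> J") (auto simp: PiE_iff extensional_def Suc_le_eq)
    qed
    show ?thesis
    proof (cases "Suc N * (\<Sum>i\<in>J. w i) \<le> k")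
      case True
      have "bij_betw ?sh (?S (k - Suc N * (\<Sum>i\<in>J. w i))) {b \<in> ?S k. \<forall>i\<in>J. b i > N}"
      proof (rule bij_betw_byWitness[where f' = ?un])
        show "\<forall>b\<in>?S (k - Suc N * (\<Sum>i\<in>J. w i)). ?un (?sh b) = b"
          by (auto simp: fun_eq_iff PiE_iff extensional_def)
        show "\<forall>b\<in>{b \<in> ?S k. \<forall>i\<in>J. b i > N}. ?sh (?un b) = b" using un by blast
        show "?sh ` ?S (k - Suc N * (\<Sum>i\<in>J. w i)) \<subseteq> {b \<in> ?S k. \<forall>i\<in>J. b i > N}"
        proof (intro image_subsetI)
          fix b assume b: "b \<in> ?S (k - Suc N * (\<Sum>i\<in>J. w i))"
          have "(\<Sum>i\<in>I. w i * ?sh b i) = k" using sumsh[of b] b True by simp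
          moreover have "?sh b \<in> I \<rightarrow>\<^sub>E UNIV" by auto
          moreover have "\<forall>i\<in>J. ?sh b i > N" using J by auto
          ultimately show "?sh b \<in> {b \<in> ?S k. \<forall>i\<in>J. b i > N}" by blast
        qed
        show "?un ` {b \<in> ?S k. \<forall>i\<in>J. b i > N} \<subseteq> ?S (k - Suc N * (\<Sum>i\<in>J. w i))"
        proof (intro image_subsetI)
          fix b assume b: "b \<in> {b \<in> ?S k. \<forall>i\<in>J. b i > N}"
          have "(\<Sum>i\<in>I. w i * ?un b i) = k - Suc N * (\<Sum>i\<in>J. w i)"
          proof -
            have "(\<Sum>i\<in>I. w i * b i) = (\<Sum>i\<in>I. w i * ?un b i) + Suc N * (\<Sum>i\<in>J. w i)"
              using sumsh[of "?un b"] unfolding un[OF b] .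
            moreover have "(\<Sum>i\<in>I. w i * b i) = k" using b by blast
            ultimately show ?thesis by linarith
          qed
          moreover have "?un b \<in> I \<rightarrow>\<^sub>E UNIV" by auto
          ultimately show "?un b \<in> ?S (k - Suc N * (\<Sum>i\<in>J. w i))" by blast
        qed
      qed
      then show ?thesis using True unfolding nsol_def by (simp add: bij_betw_same_card)
    next
      case False
      have "b \<notin> {b \<in> ?S k. \<forall>i\<in>J. b i > N}" for b
      proof
        assume b: "b \<in> {b \<in> ?S k. \<forall>i\<in>J. b i > N}"
        then have "(\<Sum>i\<in>I. w i * ?un b i) + Suc N * (\<Sum>i\<in>J. w i) = k"
          using sumsh[of "?un b"] un[OF b] by simp
        then show False using False by simp
      qed
      then have "{b \<in> ?S k. \<forall>i\<in>J. b i > N} = {}" by blast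
      then show ?thesis using False by (simp only: card.empty if_False)
    qed
  qed
  \<comment> \<open>Expansion of the product over \<open>i\<close> of 1 minus the indicator that
    \<open>b i > N\<close>.\<close>
  have ind: "of_bool (\<forall>i\<in>I. b i \<le> N) = (\<Sum>J\<in>Pow I. (-1) ^ card J * (of_bool (\<forall>i\<in>J. b i > N) :: real))" for b :: "'a \<Rightarrow> nat"
  proof -
    have pb: "(\<Prod>i\<in>J. of_bool (P i)) = (of_bool (\<forall>i\<in>J. P i) :: real)" if "finite J" for J P
      using that by (induction J rule: finite_induct) auto
    have "of_bool (\<forall>i\<in>I. b i \<le> N) = (\<Prod>i\<in>I. (of_bool (b i \<le> N) :: real))"
      using pb[OF fin, of "\<lambda>i. b i \<le> N"] by simp
    also have "\<dots> = (\<Prod>i\<in>I. (- 1) * of_bool (b i > N) + 1)" by (intro prod.cong) auto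
    also have "\<dots> = (\<Sum>J\<in>Pow I. (\<Prod>i\<in>J. (- 1) * of_bool (b i > N)) * (\<Prod>i\<in>I - J. 1))"
      by (rule prod_add[OF fin])
    also have "\<dots> = (\<Sum>J\<in>Pow I. (-1) ^ card J * (of_bool (\<forall>i\<in>J. b i > N) :: real))"
    proof (intro sum.cong refl)
      fix J assume "J \<in> Pow I"
      then have "finite J" using fin finite_subset by auto
      then show "(\<Prod>i\<in>J. (- 1) * of_bool (b i > N)) * (\<Prod>i\<in>I - J. 1) = (-1) ^ card J * (of_bool (\<forall>i\<in>J. b i > N) :: real)"
        unfolding prod.distrib using pb[of J "\<lambda>i. b i > N"] by simp
    qed
    finally show ?thesis .
  qed
  have "{b \<in> I \<rightarrow>\<^sub>E {..N}. (\<Sum>i\<in>I. w i * b i) = k} = {b \<in> ?S k. \<forall>i\<in>I. b i \<le> N}"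
    by (auto simp: PiE_iff)
  then have "real (bsol I w N k) = (\<Sum>b\<in>?S k. of_bool (\<forall>i\<in>I. b i \<le> N))"
    unfolding bsol_def using finS[of k] by (simp add: sum.If_cases of_bool_def Int_def)
  also have "\<dots> = (\<Sum>J\<in>Pow I. \<Sum>b\<in>?S k. (-1) ^ card J * of_bool (\<forall>i\<in>J. b i > N))"
    unfolding ind by (rule sum.swap)
  also have "\<dots> = (\<Sum>J\<in>Pow I. (-1) ^ card J * real (card {b \<in> ?S k. \<forall>i\<in>J. b i > N}))"
    unfolding sum_distrib_left[symmetric] using finS[of k]
    by (intro sum.cong refl arg_cong2[of _ _ _ _ "(*)"]) (simp add: sum.If_cases of_bool_def Int_def)
  also have "\<dots> = (\<Sum>J\<in>Pow I. (-1) ^ card J *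
     (if Suc N * (\<Sum>i\<in>J. w i) \<le> k then real (nsol I w (k - Suc N * (\<Sum>i\<in>J. w i))) else 0))"
    by (intro sum.cong refl) (use count in auto)
  finally show ?thesis .
qed

text \<open>The approximation of \<open>nsol\<close> is inserted into each term of the
  inclusion-exclusion sum. The error is one power of \<open>N\<close> below the main term, uniformly
  in \<open>k\<close>, as the Riemann sum at criticality requires.\<close>

lemma bsol_approx:
  "\<exists>C\<ge>0. \<forall>N\<ge>1. \<forall>k\<le>N * W. \<bar>real (bsol I w N k) - real N ^ (n - 1) * dens (real k / real N)\<bar> \<le> C * real N ^ (n - 2)"
proof -
  obtain C where C: "C \<ge> 0" "\<And>k. \<bar>real (nsol I w k) - A * real k ^ (n - 1)\<bar> \<le> C * (real k + 1) ^ (n - 2)"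
    using nsol_approx by auto
  define K where "K = C * (2 * real W) ^ (n - 2) + A * (real (n - 1) * real W ^ (n - 2) * real W)"
  have K: "K \<ge> 0" using C(1) A_pos by (simp add: K_def)
  have "\<bar>real (bsol I w N k) - real N ^ (n - 1) * dens (real k / real N)\<bar> \<le> (card (Pow I) * K) * real N ^ (n - 2)"
    if N: "N \<ge> 1" and k: "k \<le> N * W" for N k
  proof -
    define s where "s J = (\<Sum>i\<in>J. w i)" for J
    define F where "F J = (if Suc N * s J \<le> k then real (nsol I w (k - Suc N * s J)) else 0)" for J
    \<comment> \<open>\<open>z\<close> carries the true shift by \<open>N + 1\<close>,
      \<open>z'\<close> the shift by \<open>N\<close> that occurs in \<open>dens\<close>. They
      differ by at most \<open>W\<close>, which costs one power of \<open>N\<close>.\<close>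
    define z z' where "z J = max 0 (real k - (real N + 1) * real (s J))" and "z' J = max 0 (real k - real N * real (s J))" for J
    have dens: "real N ^ (n - 1) * dens (real k / real N) = (\<Sum>J\<in>Pow I. (-1) ^ card J * (A * z' J ^ (n - 1)))"
    proof -
      have "real N ^ (n - 1) * (max 0 (real k / real N - real (s J))) ^ (n - 1) = z' J ^ (n - 1)" for J
      proof -
        have "real N * max 0 (real k / real N - real (s J)) = z' J"
          using N by (simp add: z'_def max_mult_distrib_left algebra_simps)
        then show ?thesis by (simp flip: power_mult_distrib)
      qed
      then show ?thesis unfolding dens_def s_def[symmetric]
        by (simp add: sum_distrib_left mult_ac)
    qed
    have bound: "\<bar>F J - A * z' J ^ (n - 1)\<bar> \<le> K * real N ^ (n - 2)" if J: "J \<in> Pow I" for J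
    proof -
      have sJ: "s J \<le> W" unfolding s_def W_def using J fin by (intro sum_mono2) auto
      have zz: "0 \<le> z J" "z J \<le> z' J" "z' J - z J \<le> real W" "z' J \<le> real N * real W"
        using sJ k by (auto simp: z_def z'_def algebra_simps simp flip: of_nat_mult)
      have 1: "\<bar>F J - A * z J ^ (n - 1)\<bar> \<le> C * (2 * real W) ^ (n - 2) * real N ^ (n - 2)"
      proof (cases "Suc N * s J \<le> k")
        case True
        have r: "real (k - Suc N * s J) = z J"
        proof -
          have "real (Suc N * s J) \<le> real k" using True by (simp only: of_nat_le_iff)
          then show ?thesis unfolding z_def of_nat_diff[OF True] by (simp add: algebra_simps)
        qed
        have "\<bar>F J - A * z J ^ (n - 1)\<bar> \<le> C * (z J + 1) ^ (n - 2)"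
          using C(2)[of "k - Suc N * s J"] True unfolding r F_def by simp
        also have "\<dots> \<le> C * (2 * real W * real N) ^ (n - 2)"
        proof -
          have "1 \<le> real N * real W" using N W2 mult_mono[of 1 "real N" 1 "real W"] by simp
          moreover have "2 * real W * real N = real N * real W + real N * real W" by simp
          ultimately have "z J + 1 \<le> 2 * real W * real N" using zz by linarith
          then show ?thesis using C(1) zz by (intro mult_left_mono power_mono) auto
        qed
        finally show ?thesis by (simp add: power_mult_distrib mult_ac)
      next
        case False
        then have "real k < real (Suc N * s J)" by (simp only: of_nat_less_iff not_le)
        then have "z J = 0" by (simp add: z_def algebra_simps)
        then show ?thesis using False n2 C(1) by (simp add: F_def power_0_left)
      qed
      have "z' J ^ (n - 1) - z J ^ (n - 1) \<le> real (n - 1) * z' J ^ (n - 1 - 1) * (z' J - z J)"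
        using zz by (intro power_diff_le) auto
      also have "\<dots> \<le> real (n - 1) * (real N * real W) ^ (n - 1 - 1) * real W"
        using zz by (intro mult_mono power_mono) auto
      finally have "A * (z' J ^ (n - 1) - z J ^ (n - 1)) \<le> A * (real (n - 1) * (real N * real W) ^ (n - 1 - 1) * real W)"
        using A_pos by (intro mult_left_mono) auto
      moreover have "0 \<le> A * (z' J ^ (n - 1) - z J ^ (n - 1))"
        using zz A_pos by (intro mult_nonneg_nonneg) (auto intro: power_mono)
      ultimately have 2: "\<bar>A * z J ^ (n - 1) - A * z' J ^ (n - 1)\<bar> \<le> A * (real (n - 1) * real W ^ (n - 2) * real W) * real N ^ (n - 2)"
        by (simp add: right_diff_distrib power_mult_distrib mult_ac numeral_2_eq_2)
      show ?thesis unfolding K_def distrib_right using 1 2 by linarith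
    qed
    have "\<bar>real (bsol I w N k) - real N ^ (n - 1) * dens (real k / real N)\<bar> =
       \<bar>\<Sum>J\<in>Pow I. (-1) ^ card J * (F J - A * z' J ^ (n - 1))\<bar>"
      unfolding dens bsol_inclusion_exclusion F_def s_def
      by (simp add: sum_subtractf[symmetric] right_diff_distrib)
    also have "\<dots> \<le> (\<Sum>J\<in>Pow I. \<bar>(-1) ^ card J * (F J - A * z' J ^ (n - 1))\<bar>)" by (rule sum_abs)
    also have "\<dots> \<le> (\<Sum>J\<in>Pow I. K * real N ^ (n - 2))"
      using bound by (intro sum_mono) (simp add: abs_mult)
    finally show ?thesis by simp
  qed
  then show ?thesis using K by (intro exI[of _ "card (Pow I) * K"]) auto
qed

lemma nsol_lower: "\<exists>k1. \<forall>k\<ge>k1. A / 2 * real k ^ (n - 1) \<le> real (nsol I w k)"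
proof -
  obtain C where C: "C \<ge> 0" "\<And>k. \<bar>real (nsol I w k) - A * real k ^ (n - 1)\<bar> \<le> C * (real k + 1) ^ (n - 2)"
    using nsol_approx by auto
  define k1 where "k1 = max 1 (nat \<lceil>2 * C * 2 ^ (n - 2) / A\<rceil>)"
  have "A / 2 * real k ^ (n - 1) \<le> real (nsol I w k)" if "k \<ge> k1" for k
  proof -
    have k: "real k \<ge> 1" "real k \<ge> 2 * C * 2 ^ (n - 2) / A" using that unfolding k1_def by linarith+
    have "C * (real k + 1) ^ (n - 2) \<le> C * (2 * real k) ^ (n - 2)"
      using C k by (intro mult_left_mono power_mono) auto
    also have "\<dots> = (C * 2 ^ (n - 2)) * real k ^ (n - 2)" by (simp add: power_mult_distrib)
    also have "\<dots> \<le> (A / 2 * real k) * real k ^ (n - 2)"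
      using k A_pos by (intro mult_right_mono) (auto simp: field_simps)
    also have "\<dots> = A / 2 * real k ^ (n - 1)"
      using n2 by (simp add: power_eq_if numeral_2_eq_2)
    finally show ?thesis using C(2)[of k] by linarith
  qed
  then show ?thesis by blast
qed

text \<open>Lowering all entries of a solution by the same amount reduces a target in the bulk to one
  below \<open>N\<close>, where the bound on the entries is vacuous.\<close>

lemma bsol_lower:
  "\<exists>c>0. \<exists>k0. \<forall>N k. k0 \<le> k \<longrightarrow> 2 * k \<le> N * W \<longrightarrow> c * real k ^ (n - 1) \<le> real (bsol I w N k)"
proof -
  obtain k1 where k1: "\<And>k. k \<ge> k1 \<Longrightarrow> A / 2 * real k ^ (n - 1) \<le> real (nsol I w k)"
    using nsol_lower by auto
  define c where "c = A / 2 * (1 / (4 * real W)) ^ (n - 1)"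
  \<comment> \<open>Chosen so that \<open>k0 \<le> k\<close> and \<open>2 * k \<le> N * W\<close>
    force \<open>N\<close> to be large compared with \<open>k1\<close> and \<open>W\<close>. The
    factor \<open>1 / (4 * W)\<close> in \<open>c\<close> pays for replacing \<open>k\<close> by
    \<open>k'\<close>, since \<open>k \<le> 4 * W * k'\<close>.\<close>
  define k0 where "k0 = W * (4 * k1 + 8 * W + 8)"
  have W: "real W \<ge> 2" using W2 by simp
  have c: "c > 0" "c \<le> A / 2"
    using A_pos W by (auto simp: c_def mult_le_cancel_left2 intro!: power_le_one mult_pos_pos zero_less_power)
  have "c * real k ^ (n - 1) \<le> real (bsol I w N k)" if k: "k0 \<le> k" "2 * k \<le> N * W" for N k
  proof (cases "k \<le> N")
    case True
    have "1 * (4 * k1 + 8 * W + 8) \<le> k0" unfolding k0_def using W2 by (intro mult_le_mono) auto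
    then have "k1 \<le> k0" by simp
    then have "A / 2 * real k ^ (n - 1) \<le> real (nsol I w k)" using k by (intro k1) auto
    moreover have "c * real k ^ (n - 1) \<le> A / 2 * real k ^ (n - 1)" using c by (intro mult_right_mono) auto
    ultimately show ?thesis using bsol_eq_nsol[OF True] by simp
  next
    case False
    have "W * (2 * (4 * k1 + 8 * W + 8)) = 2 * k0" by (simp add: k0_def)
    also have "\<dots> \<le> W * N" using k by (simp only: mult.commute[of W])
    finally have "W * (2 * (4 * k1 + 8 * W + 8)) \<le> W * N" .
    then have N: "2 * (4 * k1 + 8 * W + 8) \<le> N" by (rule mult_left_le_imp_le) (use W2 in simp)
    \<comment> \<open>The reduced target \<open>k'\<close> is \<open>N div 4\<close> plus a
      remainder below \<open>W\<close>, and every entry is lowered by \<open>t \<le> N / 2\<close>.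
      This leaves room: \<open>k' + t \<le> N\<close>, so raising any solution for \<open>k'\<close>
      by \<open>t\<close> stays in the box.\<close>
    define K where "K = N div 4"
    define t where "t = (k - K) div W"
    define r where "r = (k - K) mod W"
    define k' where "k' = K + r"
    have K: "K \<le> k" "4 * K \<le> N" "N < 4 * K + 4" using False by (auto simp: K_def)
    have kt: "k = k' + W * t" using K by (simp add: k'_def t_def r_def)
    have r: "r < W" using W2 by (simp add: r_def)
    have "W * (2 * t) = 2 * (W * t)" by simp
    also have "\<dots> \<le> 2 * k" using kt by simp
    also have "\<dots> \<le> W * N" using k by (simp only: mult.commute[of W N])
    finally have "W * (2 * t) \<le> W * N" .
    then have t: "2 * t \<le> N" by (rule mult_left_le_imp_le) (use W2 in simp)
    have k't: "k' + t \<le> N" using K r t N by (simp add: k'_def)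
    let ?S = "{b \<in> I \<rightarrow>\<^sub>E UNIV. (\<Sum>i\<in>I. w i * b i) = k'}"
    let ?f = "\<lambda>b. restrict (\<lambda>i. b i + t) I"
    have "inj_on ?f ?S"
    proof (rule inj_onI)
      fix b b' assume b: "b \<in> ?S" "b' \<in> ?S" "?f b = ?f b'"
      show "b = b'"
      proof
        fix i show "b i = b' i"
          using fun_cong[OF b(3), of i] b(1,2) by (cases "i \<in> I") (auto simp: PiE_iff extensional_def)
      qed
    qed
    then have "nsol I w k' = card (?f ` ?S)" unfolding nsol_def by (simp add: card_image)
    also have "\<dots> \<le> bsol I w N k"
      unfolding bsol_def
    proof (intro card_mono image_subsetI)
      show "finite {b \<in> I \<rightarrow>\<^sub>E {..N}. (\<Sum>i\<in>I. w i * b i) = k}"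
        using fin by (intro finite_PiE_filter) auto
      fix b assume b: "b \<in> ?S"
      then have "b i \<le> k'" if "i \<in> I" for i using sol_le[of I w b k' i] fin wpos that by auto
      then have "?f b \<in> I \<rightarrow>\<^sub>E {..N}" using k't by fastforce
      moreover have "(\<Sum>i\<in>I. w i * ?f b i) = (\<Sum>i\<in>I. w i * b i) + W * t"
        unfolding W_def sum_distrib_right sum.distrib[symmetric] by (intro sum.cong) (auto simp: distrib_left)
      ultimately show "?f b \<in> {b \<in> I \<rightarrow>\<^sub>E {..N}. (\<Sum>i\<in>I. w i * b i) = k}" using b kt by auto
    qed
    finally have le: "nsol I w k' \<le> bsol I w N k" .
    have "k1 \<le> k'" using N K by (simp add: k'_def)
    have "real k \<le> 4 * real W * real k'"
    proof -
      have "2 * k \<le> 8 * k' * W"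
      proof -
        have "N \<le> 8 * k'" using K N by (simp add: k'_def)
        then have "N * W \<le> 8 * k' * W" by simp
        with k(2) show ?thesis by (rule order.trans)
      qed
      then have "k \<le> 4 * W * k'" by (simp add: mult_ac)
      then have "real k \<le> real (4 * W * k')" by (simp only: of_nat_le_iff)
      then show ?thesis by simp
    qed
    then have "(1 / (4 * real W)) * real k \<le> real k'" using W by (simp add: field_simps)
    then have "((1 / (4 * real W)) * real k) ^ (n - 1) \<le> real k' ^ (n - 1)" by (intro power_mono) auto
    then have "c * real k ^ (n - 1) \<le> A / 2 * real k' ^ (n - 1)"
      using A_pos unfolding c_def power_mult_distrib mult.assoc by (intro mult_left_mono) auto
    also have "\<dots> \<le> real (nsol I w k')" using \<open>k1 \<le> k'\<close> by (rule k1)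
    finally show ?thesis using le by simp
  qed
  then show ?thesis using c by blast
qed

end

subsection \<open>Symmetries and the probability of being missed\<close>

lemma card_fibers:
  assumes "finite A" "finite B" "f ` A \<subseteq> B"
  shows "card A = (\<Sum>b\<in>B. card {a\<in>A. f a = b})"
  using sum.group[OF assms, of "\<lambda>_. 1::nat"] by simp

context linear_form
begin

abbreviation "\<theta> \<equiv> form_symmetries h u"

lemma theta_pos: "\<theta> > 0"
proof -
  have "finite {\<sigma>. \<sigma> permutes {1..h} \<and> (\<forall>i\<in>{1..h}. u (\<sigma> i) = u i)}"
    by (rule finite_subset[OF _ finite_permutations[of "{1..h}"]]) auto
  moreover have "id \<in> {\<sigma>. \<sigma> permutes {1..h} \<and> (\<forall>i\<in>{1..h}. u (\<sigma> i) = u i)}"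
    by (auto simp: permutes_id)
  ultimately show ?thesis unfolding form_symmetries_def by (subst card_gt_0_iff) blast
qed

definition syms :: "(nat \<Rightarrow> nat) set" where
  "syms = {\<sigma>. \<sigma> permutes I \<and> (\<forall>i\<in>I. u (\<sigma> i) = u i)}"

lemma card_syms: "card syms = \<theta>" by (simp add: syms_def form_symmetries_def I_def)

lemma finite_syms [simp]: "finite syms"
  using theta_pos card_syms by (metis card_ge_0_finite)

lemma L_permute: "\<tau> permutes I \<Longrightarrow> L (restrict (a \<circ> \<tau>) I) = (\<Sum>i\<in>I. u (inv \<tau> i) * a i)"
proof -
  assume t: "\<tau> permutes I"
  have "L (restrict (a \<circ> \<tau>) I) = (\<Sum>i\<in>I. u i * a (\<tau> i))"
    unfolding L_def by (intro sum.cong) auto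
  also have "\<dots> = (\<Sum>i\<in>I. u (inv \<tau> (\<tau> i)) * a (\<tau> i))"
    using permutes_inverses(2)[OF t] by simp
  also have "\<dots> = (\<Sum>i\<in>I. u (inv \<tau> i) * a i)"
    by (rule sum.permute[OF t, of "\<lambda>i. u (inv \<tau> i) * a i", unfolded o_def, symmetric])
  finally show ?thesis .
qed

lemma sym_inv: "\<sigma> permutes I \<Longrightarrow> (\<forall>i\<in>I. u (inv \<sigma> i) = u i) \<longleftrightarrow> \<sigma> \<in> syms"
proof -
  assume s: "\<sigma> permutes I"
  show ?thesis
  proof
    assume *: "\<forall>i\<in>I. u (inv \<sigma> i) = u i"
    have "u (\<sigma> i) = u i" if "i \<in> I" for i
      using *[rule_format, of "\<sigma> i"] that permutes_in_image[OF s] permutes_inverses(2)[OF s] by simp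
    then show "\<sigma> \<in> syms" using s by (simp add: syms_def)
  next
    assume *: "\<sigma> \<in> syms"
    show "\<forall>i\<in>I. u (inv \<sigma> i) = u i"
    proof
      fix i assume "i \<in> I"
      then have "inv \<sigma> i \<in> I" using permutes_in_image[OF permutes_inv[OF s]] by simp
      then have "u (\<sigma> (inv \<sigma> i)) = u (inv \<sigma> i)" using * by (simp add: syms_def)
      then show "u (inv \<sigma> i) = u i" using permutes_inverses(1)[OF s] by simp
    qed
  qed
qed

lemma L_sym:
  assumes "\<sigma> \<in> syms"
  shows "L (restrict (a \<circ> \<sigma>) I) = L a"
proof -
  have s: "\<sigma> permutes I" using assms by (simp add: syms_def)
  have "L (restrict (a \<circ> \<sigma>) I) = (\<Sum>i\<in>I. u (inv \<sigma> i) * a i)" by (rule L_permute[OF s])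
  also have "\<dots> = L a" unfolding L_def using sym_inv[OF s] assms by (intro sum.cong) auto
  finally show ?thesis .
qed

lemma inj_on_syms_comp: "inj_on a I \<Longrightarrow> inj_on (\<lambda>\<sigma>. restrict (a \<circ> \<sigma>) I) {\<sigma>. \<sigma> permutes I}"
proof (rule inj_onI)
  fix \<sigma> \<tau> assume a: "inj_on a I" and st: "\<sigma> \<in> {\<sigma>. \<sigma> permutes I}" "\<tau> \<in> {\<sigma>. \<sigma> permutes I}"
    and eq: "restrict (a \<circ> \<sigma>) I = restrict (a \<circ> \<tau>) I"
  show "\<sigma> = \<tau>"
  proof
    fix i
    show "\<sigma> i = \<tau> i"
    proof (cases "i \<in> I")
      case True
      then have "a (\<sigma> i) = a (\<tau> i)" using fun_cong[OF eq, of i] by simp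
      then show ?thesis using inj_onD[OF a] st True by (simp add: permutes_in_image)
    next
      case False
      then show ?thesis using st permutes_not_in by (metis mem_Collect_eq)
    qed
  qed
qed

lemma comp_sym_mem:
  assumes "a \<in> tuples V n" "inj_on a I" "\<sigma> \<in> syms"
  shows "restrict (a \<circ> \<sigma>) I \<in> {b \<in> tuples V n. inj_on b I \<and> b ` I = a ` I}"
proof -
  have s: "\<sigma> permutes I" using assms by (simp add: syms_def)
  have "restrict (a \<circ> \<sigma>) I \<in> I \<rightarrow>\<^sub>E V"
    using assms(1) s by (auto simp: tuples_def permutes_in_image)
  moreover have "L (restrict (a \<circ> \<sigma>) I) = n" using L_sym[OF assms(3)] assms(1) by (simp add: tuples_def)
  moreover have "inj_on (a \<circ> \<sigma>) I"
    using assms(2) s by (intro comp_inj_on) (auto simp: permutes_image permutes_inj_on)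
  moreover have "(restrict (a \<circ> \<sigma>) I) ` I = a ` I"
    using permutes_image[OF s] by (metis image_comp image_restrict_eq)
  ultimately show ?thesis by (auto simp: tuples_def)
qed

lemma same_image_perm:
  assumes "inj_on a I" "inj_on b I" "a ` I = b ` I" "b \<in> extensional I"
  obtains \<tau> where "\<tau> permutes I" "b = restrict (a \<circ> \<tau>) I"
proof -
  define \<tau> where "\<tau> i = (if i \<in> I then inv_into I a (b i) else i)" for i
  have ab: "bij_betw a I (a ` I)" "bij_betw b I (a ` I)" using assms by (auto simp: bij_betw_def)
  have "bij_betw (inv_into I a \<circ> b) I I"
    by (rule bij_betw_trans[OF ab(2) bij_betw_inv_into[OF ab(1)]])
  then have "bij_betw \<tau> I I"
    by (rule bij_betw_cong[THEN iffD1, rotated]) (simp add: \<tau>_def)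
  then have "\<tau> permutes I" by (rule bij_imp_permutes) (simp add: \<tau>_def)
  moreover have "b = restrict (a \<circ> \<tau>) I"
  proof
    fix i show "b i = restrict (a \<circ> \<tau>) I i"
    proof (cases "i \<in> I")
      case True
      then have "b i \<in> a ` I" using assms(3) by auto
      then show ?thesis using True by (simp add: \<tau>_def f_inv_into_f)
    next
      case False
      then show ?thesis using assms(4) by (simp add: extensional_def)
    qed
  qed
  ultimately show thesis by (rule that)
qed

text \<open>The symmetries act freely on injective solutions and preserve the image, so every
  support comes from at least \<open>\<theta>\<close> of them.\<close>

lemma card_supports_upper:
  assumes "finite V"
  shows "\<theta> * card (supports V n) \<le> card {a \<in> tuples V n. inj_on a I}"
proof -
  have fin: "finite {a \<in> tuples V n. inj_on a I}" using assms by simp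
  have "\<theta> \<le> card {a \<in> {a \<in> tuples V n. inj_on a I}. a ` I = B}" if B: "B \<in> supports V n" for B
  proof -
    obtain a where a: "a \<in> tuples V n" "inj_on a I" "B = a ` I" using B by (auto simp: supports_def)
    have "inj_on (\<lambda>\<sigma>. restrict (a \<circ> \<sigma>) I) syms"
      using inj_on_syms_comp[OF a(2)] by (rule inj_on_subset) (auto simp: syms_def)
    then have "\<theta> = card ((\<lambda>\<sigma>. restrict (a \<circ> \<sigma>) I) ` syms)" by (simp only: card_image card_syms)
    also have "\<dots> \<le> card {a \<in> {a \<in> tuples V n. inj_on a I}. a ` I = B}"
      using comp_sym_mem[OF a(1,2)] a(3) assms by (intro card_mono image_subsetI) (auto simp del: o_apply)
    finally show ?thesis .
  qed
  then have "(\<Sum>B\<in>supports V n. \<theta>) \<le> (\<Sum>B\<in>supports V n. card {a \<in> {a \<in> tuples V n. inj_on a I}. a ` I = B})"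
    by (intro sum_mono)
  also have "\<dots> = card {a \<in> tuples V n. inj_on a I}"
    by (rule card_fibers[OF fin finite_supports[OF assms], symmetric]) (simp add: supports_def)
  finally show ?thesis by (simp add: mult.commute)
qed

text \<open>If two injective solutions with the same image differ by a permutation that is not a
  symmetry, one of them also solves the equation with permuted coefficients. Solutions with such a
  twist are \<open>bad\<close>, and \<open>card_tuples_twist\<close> makes them few; any image comes
  from at most \<open>\<theta>\<close> of the other injective solutions.\<close>

lemma card_supports_lower:
  assumes "finite V" "n \<noteq> 0" "card V \<le> M" "M \<ge> 1"
  shows "card (tuples V n) \<le> \<theta> * card (supports V n) + (h ^ (h + 1) + fact h) * M ^ (h - 2)"
proof -
  define Inj where "Inj = {a \<in> tuples V n. inj_on a I}"
  define tw where "tw \<sigma> = {a \<in> tuples V n. (\<Sum>i\<in>I. u (\<sigma> i) * a i) = n}" for \<sigma>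
  define T where "T = {\<sigma>. \<sigma> permutes I \<and> (\<exists>j\<in>I. u (\<sigma> j) \<noteq> u j)}"
  define bad where "bad = (\<Union>\<sigma>\<in>T. tw \<sigma>)"
  have finT: "finite T" unfolding T_def
    by (rule finite_subset[OF _ finite_permutations[OF finite_I]]) auto
  have finI: "finite Inj" using assms by (simp add: Inj_def)
  have cT: "card T \<le> fact h"
    using card_mono[OF finite_permutations[OF finite_I], of T] card_permutations[OF card_I finite_I]
    by (auto simp: T_def)
  have fintw: "finite (tw \<sigma>)" for \<sigma> unfolding tw_def using assms by simp
  have "card bad \<le> (\<Sum>\<sigma>\<in>T. card (tw \<sigma>))" unfolding bad_def by (rule card_UN_le[OF finT])
  also have "\<dots> \<le> (\<Sum>\<sigma>\<in>T. M ^ (h - 2))"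
  proof (rule sum_mono)
    fix \<sigma> assume "\<sigma> \<in> T"
    then obtain j where "\<sigma> permutes I" "j \<in> I" "u (\<sigma> j) \<noteq> u j" by (auto simp: T_def)
    then have "card (tw \<sigma>) \<le> card V ^ (h - 2)" unfolding tw_def
      using assms by (intro card_tuples_twist[where j = j]) auto
    also have "\<dots> \<le> M ^ (h - 2)" using assms by (intro power_mono) auto
    finally show "card (tw \<sigma>) \<le> M ^ (h - 2)" .
  qed
  also have "\<dots> \<le> fact h * M ^ (h - 2)" using cT by simp
  finally have cbad: "card bad \<le> fact h * M ^ (h - 2)" .
  have finbad: "finite bad" unfolding bad_def using finT fintw by auto
  have fib: "card {a \<in> Inj - bad. a ` I = B} \<le> \<theta>" for B
  proof (cases "{a \<in> Inj - bad. a ` I = B} = {}")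
    case True
    then show ?thesis by (simp only: card.empty)
  next
    case False
    then obtain a where a: "a \<in> tuples V n" "inj_on a I" "a \<notin> bad" "a ` I = B" by (auto simp: Inj_def)
    have "{a \<in> Inj - bad. a ` I = B} \<subseteq> (\<lambda>\<sigma>. restrict (a \<circ> \<sigma>) I) ` syms"
    proof
      fix b assume b: "b \<in> {a \<in> Inj - bad. a ` I = B}"
      then have b': "inj_on b I" "b ` I = B" "L b = n" "b \<in> extensional I"
        by (auto simp: Inj_def tuples_def PiE_iff)
      obtain \<tau> where t: "\<tau> permutes I" "b = restrict (a \<circ> \<tau>) I"
        using same_image_perm[of a b] a b' by metis
      have "(\<Sum>i\<in>I. u (inv \<tau> i) * a i) = n" using L_permute[OF t(1), of a] t(2) b'(3) by simp
      then have "a \<in> tw (inv \<tau>)" using a by (simp add: tw_def)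
      then have "inv \<tau> \<notin> T" using a(3) by (auto simp: bad_def)
      then have "\<forall>j\<in>I. u (inv \<tau> j) = u j" using permutes_inv[OF t(1)] by (auto simp: T_def)
      then have "\<tau> \<in> syms" using sym_inv[OF t(1)] by simp
      then show "b \<in> (\<lambda>\<sigma>. restrict (a \<circ> \<sigma>) I) ` syms" using t(2) by blast
    qed
    then have "card {a \<in> Inj - bad. a ` I = B} \<le> card ((\<lambda>\<sigma>. restrict (a \<circ> \<sigma>) I) ` syms)"
      by (intro card_mono) auto
    also have "\<dots> \<le> \<theta>" using card_image_le[of syms] card_syms by auto
    finally show ?thesis .
  qed
  have fingd: "finite (Inj - bad)" using finI by simp
  have "card (Inj - bad) = (\<Sum>B\<in>supports V n. card {a \<in> Inj - bad. a ` I = B})"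
    by (rule card_fibers[OF fingd finite_supports[OF assms(1)]]) (auto simp: supports_def Inj_def)
  also have "\<dots> \<le> (\<Sum>B\<in>supports V n. \<theta>)" by (intro sum_mono fib)
  finally have good: "card (Inj - bad) \<le> \<theta> * card (supports V n)" by (simp add: mult.commute)
  have "tuples V n = {a \<in> tuples V n. \<not> inj_on a I} \<union> Inj" by (auto simp: Inj_def)
  then have "card (tuples V n) \<le> card {a \<in> tuples V n. \<not> inj_on a I} + card Inj"
    using card_Un_le by metis
  also have "card Inj \<le> card ((Inj - bad) \<union> bad)" using finI finbad by (intro card_mono) auto
  also have "\<dots> \<le> card (Inj - bad) + card bad" by (rule card_Un_le)
  finally show ?thesis
    using good cbad card_tuples_noninj[OF assms] by (simp add: add_mult_distrib)
qed

text \<open>A set of size \<open>h\<close> has \<open>fact h\<close> orderings. This loses a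
  constant factor against \<open>\<theta>\<close>, which is harmless in the bulk, where only the
  order of magnitude counts.\<close>

lemma card_supports_crude:
  assumes "finite V"
  shows "card {a \<in> tuples V n. inj_on a I} \<le> fact h * card (supports V n)"
proof -
  define Inj where "Inj = {a \<in> tuples V n. inj_on a I}"
  have finI: "finite Inj" using assms by (simp add: Inj_def)
  have fib: "card {a \<in> Inj. a ` I = B} \<le> fact h" for B
  proof (cases "{a \<in> Inj. a ` I = B} = {}")
    case True
    then show ?thesis by (simp only: card.empty)
  next
    case False
    then obtain a where a: "a \<in> tuples V n" "inj_on a I" "a ` I = B" by (auto simp: Inj_def)
    have "{a \<in> Inj. a ` I = B} \<subseteq> (\<lambda>\<sigma>. restrict (a \<circ> \<sigma>) I) ` {\<sigma>. \<sigma> permutes I}"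
    proof
      fix b assume "b \<in> {a \<in> Inj. a ` I = B}"
      then have "inj_on b I" "b ` I = B" "b \<in> extensional I"
        by (auto simp: Inj_def tuples_def PiE_iff)
      then obtain \<tau> where t: "\<tau> permutes I" "b = restrict (a \<circ> \<tau>) I"
        using same_image_perm[of a b] a by metis
      then show "b \<in> (\<lambda>\<sigma>. restrict (a \<circ> \<sigma>) I) ` {\<sigma>. \<sigma> permutes I}" by blast
    qed
    then have "card {a \<in> Inj. a ` I = B} \<le> card ((\<lambda>\<sigma>. restrict (a \<circ> \<sigma>) I) ` {\<sigma>. \<sigma> permutes I})"
      by (intro card_mono finite_imageI finite_permutations) auto
    also have "\<dots> \<le> card {\<sigma>. \<sigma> permutes I}" by (intro card_image_le finite_permutations) auto
    also have "\<dots> = fact h" by (rule card_permutations[OF card_I finite_I])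
    finally show ?thesis .
  qed
  have "card Inj = (\<Sum>B\<in>supports V n. card {a \<in> Inj. a ` I = B})"
    by (rule card_fibers[OF finI finite_supports[OF assms(1)]]) (auto simp: supports_def Inj_def)
  also have "\<dots> \<le> (\<Sum>B\<in>supports V n. fact h)" by (intro sum_mono fib)
  finally show ?thesis by (simp add: Inj_def mult.commute)
qed

text \<open>A common support carries a solution for \<open>n\<close> which, after a permutation of
  its entries, becomes a solution for \<open>n'\<close>. It thus solves two equations, and
  \<open>card_tuples_twist\<close> applies for each permutation.\<close>

lemma card_supports_inter:
  assumes "finite V" "\<bar>n\<bar> \<noteq> \<bar>n'\<bar>" "card V \<le> M" "M \<ge> 1"
  shows "card (supports V n \<inter> supports V n') \<le> fact h * M ^ (h - 2)"
proof -
  define tw where "tw \<sigma> = {a \<in> tuples V n. (\<Sum>i\<in>I. u (\<sigma> i) * a i) = n'}" for \<sigma>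
  let ?P = "{\<sigma>. \<sigma> permutes I}"
  have finP: "finite ?P" by (rule finite_permutations[OF finite_I])
  have fintw: "finite (tw \<sigma>)" for \<sigma> unfolding tw_def using assms by simp
  have "supports V n \<inter> supports V n' \<subseteq> (\<Union>\<sigma>\<in>?P. (\<lambda>a. a ` I) ` tw \<sigma>)"
  proof
    fix B assume B: "B \<in> supports V n \<inter> supports V n'"
    then obtain a b where a: "a \<in> tuples V n" "inj_on a I" "B = a ` I"
      and b: "b \<in> tuples V n'" "inj_on b I" "B = b ` I" by (auto simp: supports_def)
    have "b \<in> extensional I" "L b = n'" using b by (auto simp: tuples_def PiE_iff)
    then obtain \<tau> where t: "\<tau> permutes I" "b = restrict (a \<circ> \<tau>) I"
      using same_image_perm[of a b] a b by metis
    have "(\<Sum>i\<in>I. u (inv \<tau> i) * a i) = n'" using L_permute[OF t(1), of a] t(2) \<open>L b = n'\<close> by simp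
    then have "a \<in> tw (inv \<tau>)" using a by (simp add: tw_def)
    then show "B \<in> (\<Union>\<sigma>\<in>?P. (\<lambda>a. a ` I) ` tw \<sigma>)" using permutes_inv[OF t(1)] a(3) by blast
  qed
  then have "card (supports V n \<inter> supports V n') \<le> card (\<Union>\<sigma>\<in>?P. (\<lambda>a. a ` I) ` tw \<sigma>)"
    using finP fintw by (intro card_mono) auto
  also have "\<dots> \<le> (\<Sum>\<sigma>\<in>?P. card ((\<lambda>a. a ` I) ` tw \<sigma>))" by (rule card_UN_le[OF finP])
  also have "\<dots> \<le> (\<Sum>\<sigma>\<in>?P. M ^ (h - 2))"
  proof (rule sum_mono)
    fix \<sigma> assume s: "\<sigma> \<in> ?P"
    \<comment> \<open>Otherwise summing absolute values over \<open>j\<close> cancels the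
      permutation and leaves \<open>\<bar>n\<bar> = \<bar>n'\<bar>\<close>, because the coefficients
      do not all vanish.\<close>
    have "\<exists>j\<in>I. n * u (\<sigma> j) \<noteq> n' * u j"
    proof (rule ccontr)
      assume "\<not> ?thesis"
      then have *: "\<bar>n\<bar> * \<bar>u (\<sigma> j)\<bar> = \<bar>n'\<bar> * \<bar>u j\<bar>" if "j \<in> I" for j
        using that by (metis abs_mult)
      have "\<bar>n\<bar> * (\<Sum>j\<in>I. \<bar>u j\<bar>) = \<bar>n\<bar> * (\<Sum>j\<in>I. \<bar>u (\<sigma> j)\<bar>)"
        using s sum.permute[of \<sigma> I "\<lambda>j. \<bar>u j\<bar>"] by (simp add: o_def)
      also have "\<dots> = \<bar>n'\<bar> * (\<Sum>j\<in>I. \<bar>u j\<bar>)"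
        unfolding sum_distrib_left using * by (intro sum.cong) auto
      finally have "(\<Sum>j\<in>I. \<bar>u j\<bar>) = 0" using assms(2) by simp
      then have "\<forall>j\<in>I. \<bar>u j\<bar> = 0" by (subst (asm) sum_nonneg_eq_0_iff) auto
      then show False using I_nonempty u_nz by auto
    qed
    then obtain j where "j \<in> I" "n * u (\<sigma> j) \<noteq> n' * u j" by auto
    then have "card (tw \<sigma>) \<le> card V ^ (h - 2)" unfolding tw_def
      using assms s by (intro card_tuples_twist[where j = j]) auto
    also have "\<dots> \<le> M ^ (h - 2)" using assms by (intro power_mono) auto
    finally show "card ((\<lambda>a. a ` I) ` tw \<sigma>) \<le> M ^ (h - 2)"
      using card_image_le[OF fintw] order.trans by blast
  qed
  also have "\<dots> = fact h * M ^ (h - 2)" using card_permutations[OF card_I finite_I] by simp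
  finally show ?thesis .
qed

text \<open>With \<open>M\<close> available elements and \<open>q * M \<ge> 1\<close>, the largest
  admissible number of distinct entries dominates. For \<open>err1\<close> these are
  \<open>h - 1\<close> entries under one equation (degenerate supports), for \<open>err2\<close>
  they are \<open>2 * h - 1\<close> entries under two equations (intersecting pairs of
  supports).\<close>

definition "err1 q M = (q * real M) ^ (h - 1) / real M"
definition "err2 q M = (q * real M) ^ (2 * h - 1) / (real M)\<^sup>2"

lemma deg_supports_sum:
  assumes "finite V" "n \<noteq> 0" "card V \<le> M" "q \<ge> 0" "q * real M \<ge> 1"
  shows "(\<Sum>B\<in>deg_supports V n. q ^ card B) \<le> real (h ^ (h + 1)) * err1 q M"
proof -
  have M: "M > 0" using assms(5) by (cases M) auto
  have "(\<Sum>B\<in>deg_supports V n. q ^ card B) = (\<Sum>j\<in>{1..<h}. \<Sum>B\<in>{B\<in>deg_supports V n. card B = j}. q ^ card B)"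
    using assms card_deg_supports by (intro sum.group[symmetric]) fastforce+
  also have "\<dots> = (\<Sum>j\<in>{1..<h}. real (card {B\<in>deg_supports V n. card B = j}) * q ^ j)"
    by (intro sum.cong refl) simp
  also have "\<dots> \<le> (\<Sum>j\<in>{1..<h}. real (h ^ h) * err1 q M)"
  proof (rule sum_mono)
    fix j assume j: "j \<in> {1..<h}"
    have "card {B\<in>deg_supports V n. card B = j} \<le> j ^ h * card V ^ (j - 1)"
      by (rule card_deg_supports_size[OF assms(1,2)])
    also have "\<dots> \<le> h ^ h * M ^ (j - 1)" using j assms by (intro mult_le_mono power_mono) auto
    finally have "real (card {B\<in>deg_supports V n. card B = j}) \<le> real (h ^ h * M ^ (j - 1))"
      by (simp only: of_nat_le_iff)
    then have "real (card {B\<in>deg_supports V n. card B = j}) * q ^ j \<le> real (h ^ h * M ^ (j - 1)) * q ^ j"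
      using assms by (intro mult_right_mono) auto
    also have "\<dots> = real (h ^ h) * ((q * real M) ^ j / real M)"
    proof -
      have "real M ^ j = real M ^ (j - 1) * real M" using j by (cases j) auto
      then show ?thesis using M by (simp add: power_mult_distrib)
    qed
    also have "\<dots> \<le> real (h ^ h) * err1 q M"
      unfolding err1_def using j assms M by (intro mult_left_mono divide_right_mono power_increasing) auto
    finally show "real (card {B\<in>deg_supports V n. card B = j}) * q ^ j \<le> real (h ^ h) * err1 q M" .
  qed
  also have "\<dots> = real (h - 1) * (real (h ^ h) * err1 q M)" by simp
  also have "\<dots> \<le> real h * (real (h ^ h) * err1 q M)"
    using assms by (intro mult_right_mono) (auto simp: err1_def)
  finally show ?thesis by simp
qed

lemma supports_pair_sum:
  assumes "finite V" "card V \<le> M" "q \<ge> 0" "q * real M \<ge> 1"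
  shows "(\<Sum>(B, C)\<in>{(B, C). B \<in> supports V n \<and> C \<in> supports V n' \<and> C \<noteq> B \<and> B \<inter> C \<noteq> {}}. q ^ card (B \<union> C))
    \<le> real ((2 * h) ^ (2 * h + 1)) * err2 q M"
proof -
  define P where "P = {(B, C). B \<in> supports V n \<and> C \<in> supports V n' \<and> C \<noteq> B \<and> B \<inter> C \<noteq> {}}"
  have M: "M > 0" using assms(4) by (cases M) auto
  have finP: "finite P"
    by (rule finite_subset[of _ "supports V n \<times> supports V n'"]) (use assms in \<open>auto simp: P_def\<close>)
  have range: "card (B \<union> C) \<in> {2..2 * h - 1}" if "(B, C) \<in> P" for B C
  proof -
    have BC: "card B = h" "card C = h" "B \<inter> C \<noteq> {}" "finite B" "finite C"
    proof -
      have *: "B \<in> supports V n" "C \<in> supports V n'" "B \<inter> C \<noteq> {}" using that by (simp_all add: P_def)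
      show "card B = h" "card C = h" "B \<inter> C \<noteq> {}" using *(3) card_supports[OF *(1)] card_supports[OF *(2)] by simp_all
      have "B \<subseteq> V" "C \<subseteq> V" using *(1,2) supports_subset[of V n] supports_subset[of V n'] by auto
      then show "finite B" "finite C" using assms(1) by (auto intro: finite_subset)
    qed
    then have "card (B \<inter> C) > 0" by (simp add: card_gt_0_iff)
    moreover have "card (B \<union> C) + card (B \<inter> C) = 2 * h" using card_Un_Int[of B C] BC by simp
    moreover have "card (B \<union> C) \<ge> h" using BC card_mono[of "B \<union> C" B] by auto
    ultimately show ?thesis using h2 by auto
  qed
  have "(\<Sum>(B, C)\<in>P. q ^ card (B \<union> C)) = (\<Sum>w\<in>{2..2 * h - 1}. \<Sum>x\<in>{x\<in>P. card (fst x \<union> snd x) = w}. q ^ card (fst x \<union> snd x))"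
    using finP range by (subst sum.group) (auto simp: case_prod_unfold)
  also have "\<dots> = (\<Sum>w\<in>{2..2 * h - 1}. real (card {x\<in>P. card (fst x \<union> snd x) = w}) * q ^ w)"
    by (intro sum.cong refl) simp
  also have "\<dots> \<le> (\<Sum>w\<in>{2..2 * h - 1}. real ((2 * h) ^ (2 * h)) * err2 q M)"
  proof (rule sum_mono)
    fix w assume w: "w \<in> {2..2 * h - 1}"
    have "card {x\<in>P. card (fst x \<union> snd x) = w} \<le> card {(B, C). B \<in> supports V n \<and> C \<in> supports V n' \<and> B \<noteq> C \<and> card (B \<union> C) = w}"
    proof (rule card_mono)
      show "finite {(B, C). B \<in> supports V n \<and> C \<in> supports V n' \<and> B \<noteq> C \<and> card (B \<union> C) = w}"
        by (rule finite_subset[of _ "supports V n \<times> supports V n'"]) (use assms in auto)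
    qed (auto simp: P_def)
    also have "\<dots> \<le> w ^ (2 * h) * card V ^ (w - 2)" by (rule card_supports_pairs[OF assms(1)])
    also have "\<dots> \<le> (2 * h) ^ (2 * h) * M ^ (w - 2)" using w assms by (intro mult_le_mono power_mono) auto
    finally have "real (card {x\<in>P. card (fst x \<union> snd x) = w}) \<le> real ((2 * h) ^ (2 * h) * M ^ (w - 2))"
      by (simp only: of_nat_le_iff)
    then have "real (card {x\<in>P. card (fst x \<union> snd x) = w}) * q ^ w \<le> real ((2 * h) ^ (2 * h) * M ^ (w - 2)) * q ^ w"
      using assms by (intro mult_right_mono) auto
    also have "\<dots> = real ((2 * h) ^ (2 * h)) * ((q * real M) ^ w / (real M)\<^sup>2)"
    proof -
      have "real M ^ w = real M ^ (w - 2) * (real M)\<^sup>2" using w by (metis atLeastAtMost_iff le_add_diff_inverse2 power_add)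
      then show ?thesis using M by (simp add: power_mult_distrib)
    qed
    also have "\<dots> \<le> real ((2 * h) ^ (2 * h)) * err2 q M"
      unfolding err2_def using w assms M by (intro mult_left_mono divide_right_mono power_increasing) auto
    finally show "real (card {x\<in>P. card (fst x \<union> snd x) = w}) * q ^ w \<le> real ((2 * h) ^ (2 * h)) * err2 q M" .
  qed
  also have "\<dots> = real (card {2..2 * h - 1}) * (real ((2 * h) ^ (2 * h)) * err2 q M)" by simp
  also have "\<dots> \<le> real (2 * h) * (real ((2 * h) ^ (2 * h)) * err2 q M)"
    using assms by (intro mult_right_mono) (auto simp: err2_def)
  finally show ?thesis by (simp add: P_def)
qed

text \<open>Janson's correction for the union of two families: ordered pairs fall into four classes,
  by the target to which each member belongs. The classes may overlap, so they are only bounded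
  together, whence the factor 4.\<close>

lemma supports_Delta:
  assumes "finite V" "card V \<le> M" "q \<ge> 0" "q * real M \<ge> 1" "F = supports V n \<union> supports V n'"
  shows "(\<Sum>B\<in>F. \<Sum>C\<in>{C\<in>F. C \<noteq> B \<and> B \<inter> C \<noteq> {}}. q ^ card (B \<union> C)) \<le> 4 * real ((2 * h) ^ (2 * h + 1)) * err2 q M"
proof -
  define P where "P m m' = {(B, C). B \<in> supports V m \<and> C \<in> supports V m' \<and> C \<noteq> B \<and> B \<inter> C \<noteq> {}}" for m m'
  let ?f = "\<lambda>(B, C). q ^ card (B \<union> C :: int set)"
  have fin: "finite (P m m')" for m m'
    by (rule finite_subset[of _ "supports V m \<times> supports V m'"]) (use assms in \<open>auto simp: P_def\<close>)
  have un: "sum ?f (X \<union> Y) \<le> sum ?f X + sum ?f Y" if "finite X" "finite Y" for X Y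
    using sum.union_inter[OF that, of ?f] sum_nonneg[of "X \<inter> Y" ?f] assms(3) by (auto simp: case_prod_unfold)
  have bnd: "sum ?f (P m m') \<le> real ((2 * h) ^ (2 * h + 1)) * err2 q M" for m m'
    unfolding P_def by (rule supports_pair_sum[OF assms(1-4)])
  have "(\<Sum>B\<in>F. \<Sum>C\<in>{C\<in>F. C \<noteq> B \<and> B \<inter> C \<noteq> {}}. q ^ card (B \<union> C)) =
    sum ?f (SIGMA B:F. {C\<in>F. C \<noteq> B \<and> B \<inter> C \<noteq> {}})"
    using assms by (intro sum.Sigma) auto
  also have "(SIGMA B:F. {C\<in>F. C \<noteq> B \<and> B \<inter> C \<noteq> {}}) = P n n \<union> (P n n' \<union> (P n' n \<union> P n' n'))"
    by (auto simp: assms(5) P_def)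
  also have "sum ?f \<dots> \<le> sum ?f (P n n) + (sum ?f (P n n') + (sum ?f (P n' n) + sum ?f (P n' n')))"
    using un[of "P n n" "P n n' \<union> (P n' n \<union> P n' n')"] un[of "P n n'" "P n' n \<union> P n' n'"]
      un[of "P n' n" "P n' n'"] fin by simp
  finally show ?thesis using bnd[of n n] bnd[of n n'] bnd[of n' n] bnd[of n' n'] by linarith
qed

section \<open>Bounds for the probability of missing one value or two\<close>

definition missed :: "int set \<Rightarrow> int \<Rightarrow> bool" where
  "missed S n \<longleftrightarrow> n \<notin> form_values h u S"

lemma form_values_eq: "form_values h u S = L ` (I \<rightarrow>\<^sub>E S)"
proof (intro equalityI subsetI)
  fix v assume "v \<in> form_values h u S"
  then obtain a where a: "\<forall>i\<in>I. a i \<in> S" "v = (\<Sum>i\<in>I. u i * a i)"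
    by (auto simp: form_values_def I_def)
  then have "v = L (restrict a I)" "restrict a I \<in> I \<rightarrow>\<^sub>E S" by (auto simp: L_def)
  then show "v \<in> L ` (I \<rightarrow>\<^sub>E S)" by blast
qed (auto simp: form_values_def I_def L_def PiE_iff)

text \<open>\<open>U\<close> carries the random set, while \<open>V\<close> is a possibly much
  smaller set that contains all representations of \<open>n\<close>. The separation makes the error
  terms depend on the size of the window.\<close>

lemma missed_iff:
  assumes "S \<subseteq> U" "tuples U n \<subseteq> tuples V n" "V \<subseteq> U"
  shows "missed S n \<longleftrightarrow> avoids (supports V n \<union> deg_supports V n) S"
proof -
  have "supports V n \<union> deg_supports V n = (\<lambda>a. a ` I) ` tuples V n"
    by (auto simp: supports_def deg_supports_def)
  moreover have "(\<exists>a\<in>I \<rightarrow>\<^sub>E S. L a = n) \<longleftrightarrow> (\<exists>a\<in>tuples V n. a ` I \<subseteq> S)"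
  proof
    assume "\<exists>a\<in>I \<rightarrow>\<^sub>E S. L a = n"
    then obtain a where a: "a \<in> I \<rightarrow>\<^sub>E S" "L a = n" by auto
    then have "a \<in> tuples U n" using assms(1) by (auto simp: tuples_def PiE_iff)
    then show "\<exists>a\<in>tuples V n. a ` I \<subseteq> S" using a assms(2) by (intro bexI[of _ a]) auto
  next
    assume "\<exists>a\<in>tuples V n. a ` I \<subseteq> S"
    then obtain a where "a \<in> tuples V n" "a ` I \<subseteq> S" by auto
    then show "\<exists>a\<in>I \<rightarrow>\<^sub>E S. L a = n"
      by (intro bexI[of _ a]) (auto simp: tuples_def PiE_iff)
  qed
  ultimately show ?thesis unfolding missed_def form_values_eq avoids_def by auto
qed

text \<open>To be missed, a value must avoid the degenerate supports too, so they lower the bound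
  through \<open>err1\<close>; the true supports are bounded from above through
  \<open>card_supports_upper\<close>.\<close>

lemma missed_lower:
  assumes "finite U" "V \<subseteq> U" "tuples U n \<subseteq> tuples V n" "n \<noteq> 0" "card V \<le> M"
    and q: "0 \<le> q" "q \<le> 1 / 2" "q * real M \<ge> 1"
  shows "exp (- ((1 + 2 * q) * (q ^ h * real (card (tuples U n)) / real \<theta> + real (h ^ (h + 1)) * err1 q M)))
    \<le> subset_exp U q (\<lambda>S. of_bool (missed S n))"
proof -
  have finV: "finite V" by (rule finite_subset[OF assms(2,1)])
  have tup: "tuples V n = tuples U n" using assms by (auto simp: tuples_def)
  define F where "F = supports V n \<union> deg_supports V n"
  have F: "finite F" "F \<subseteq> Pow U" using finV supports_subset deg_supports_subset assms(2) by (fastforce simp: F_def)+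
  have cardF: "card B \<ge> 1" if "B \<in> F" for B
    using that card_supports card_deg_supports h2 by (fastforce simp: F_def)
  \<comment> \<open>The quadratic bound for \<open>ln (1 - x)\<close> holds up to
    \<open>1 / 2\<close>. Every support is nonempty, so \<open>x = q ^ card B\<close> is at most
    \<open>q\<close>, and the square becomes the factor \<open>1 + 2 * q\<close>.\<close>
  have "exp (- ((1 + 2 * q) * x)) \<le> 1 - x" if x: "0 \<le> x" "x \<le> q" for x
  proof -
    have "- (x + 2 * x\<^sup>2) \<le> ln (1 - x)" using ln_one_minus_pos_lower_bound[of x] x q by (simp add: algebra_simps)
    moreover have "x * x \<le> q * x" using x by (intro mult_right_mono) auto
    ultimately have "- ((1 + 2 * q) * x) \<le> ln (1 - x)" by (simp add: algebra_simps power2_eq_square)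
    then have "exp (- ((1 + 2 * q) * x)) \<le> exp (ln (1 - x))" by simp
    then show ?thesis using x q by simp
  qed
  then have factor: "exp (- ((1 + 2 * q) * q ^ card B)) \<le> 1 - q ^ card B" if "B \<in> F" for B
    using cardF[OF that] q power_decreasing[of 1 "card B" q] by simp
  have "real \<theta> * real (card (supports V n)) \<le> real (card (tuples U n))"
  proof -
    have "\<theta> * card (supports V n) \<le> card {a \<in> tuples V n. inj_on a I}" by (rule card_supports_upper[OF finV])
    also have "\<dots> \<le> card (tuples V n)" using finV by (intro card_mono) auto
    finally show ?thesis using tup by (simp flip: of_nat_mult)
  qed
  then have sup: "q ^ h * real (card (supports V n)) \<le> q ^ h * real (card (tuples U n)) / real \<theta>"
    using theta_pos q mult_left_mono[of "real \<theta> * real (card (supports V n))" "real (card (tuples U n))" "q ^ h"]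
    by (simp add: field_simps)
  have "(\<Sum>B\<in>F. q ^ card B) \<le> (\<Sum>B\<in>supports V n. q ^ card B) + (\<Sum>B\<in>deg_supports V n. q ^ card B)"
    unfolding F_def using sum.union_inter[of "supports V n" "deg_supports V n" "\<lambda>B. q ^ card B"] finV
      sum_nonneg[of "supports V n \<inter> deg_supports V n" "\<lambda>B. q ^ card B"] q by simp
  also have "(\<Sum>B\<in>supports V n. q ^ card B) = q ^ h * real (card (supports V n))"
    using card_supports by simp
  finally have "(\<Sum>B\<in>F. q ^ card B) \<le> q ^ h * real (card (tuples U n)) / real \<theta> + real (h ^ (h + 1)) * err1 q M"
    using sup deg_supports_sum[OF finV assms(4,5) q(1,3)] by linarith
  then have "exp (- ((1 + 2 * q) * (q ^ h * real (card (tuples U n)) / real \<theta> + real (h ^ (h + 1)) * err1 q M)))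
     \<le> exp (- ((1 + 2 * q) * (\<Sum>B\<in>F. q ^ card B)))"
    using q by (simp add: mult_left_mono)
  also have "\<dots> = (\<Prod>B\<in>F. exp (- ((1 + 2 * q) * q ^ card B)))"
    using F by (simp add: exp_sum sum_distrib_left sum_negf[symmetric])
  also have "\<dots> \<le> (\<Prod>B\<in>F. 1 - q ^ card B)" using factor by (intro prod_mono) auto
  also have "\<dots> \<le> subset_exp U q (\<lambda>S. of_bool (avoids F S))"
    using assms F by (intro subset_exp_avoids_lower) auto
  also have "\<dots> = subset_exp U q (\<lambda>S. of_bool (missed S n))"
    using missed_iff[OF _ assms(3,2)] by (intro subset_exp_cong) (auto simp: F_def)
  finally show ?thesis .
qed

lemma avoids_upper:
  assumes "finite U" "V \<subseteq> U" "card V \<le> M" and q: "0 \<le> q" "q \<le> 1" "q * real M \<ge> 1"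
  shows "subset_exp U q (\<lambda>S. of_bool (avoids (supports V n \<union> supports V n') S))
    \<le> exp (- (q ^ h * real (card (supports V n \<union> supports V n'))) + 4 * real ((2 * h) ^ (2 * h + 1)) * err2 q M)"
proof -
  have finV: "finite V" by (rule finite_subset[OF assms(2,1)])
  define F where "F = supports V n \<union> supports V n'"
  have F: "finite F" "F \<subseteq> Pow U" using finV supports_subset assms(2) by (fastforce simp: F_def)+
  have "subset_exp U q (\<lambda>S. of_bool (avoids F S)) \<le>
    exp (- (\<Sum>B\<in>F. q ^ card B) + (\<Sum>B\<in>F. \<Sum>C\<in>{C\<in>F. C \<noteq> B \<and> B \<inter> C \<noteq> {}}. q ^ card (B \<union> C)))"
    by (rule Janson_inequality[OF assms(1) q(1,2) F])
  also have "(\<Sum>B\<in>F. q ^ card B) = q ^ h * real (card F)"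
  proof -
    have "(\<Sum>B\<in>F. q ^ card B) = (\<Sum>B\<in>F. q ^ h)"
      using card_supports by (intro sum.cong) (auto simp: F_def)
    then show ?thesis by simp
  qed
  also have "exp (- (q ^ h * real (card F)) + (\<Sum>B\<in>F. \<Sum>C\<in>{C\<in>F. C \<noteq> B \<and> B \<inter> C \<noteq> {}}. q ^ card (B \<union> C)))
     \<le> exp (- (q ^ h * real (card F)) + 4 * real ((2 * h) ^ (2 * h + 1)) * err2 q M)"
    using supports_Delta[OF finV assms(3) q(1,3) F_def] by simp
  finally show ?thesis unfolding F_def .
qed

text \<open>Dropping the degenerate supports only enlarges the event, so Janson's inequality for the
  union of the two families of supports suffices. The union is nearly as large as both families
  together, because they have few sets in common.\<close>

lemma missed_pair_upper:
  assumes "finite U" "V \<subseteq> U" "tuples U n \<subseteq> tuples V n" "tuples U n' \<subseteq> tuples V n'"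
    and "n \<noteq> 0" "n' \<noteq> 0" "\<bar>n\<bar> \<noteq> \<bar>n'\<bar>" "card V \<le> M"
    and q: "0 \<le> q" "q \<le> 1" "q * real M \<ge> 1"
  shows "subset_exp U q (\<lambda>S. of_bool (missed S n) * of_bool (missed S n')) \<le>
    exp (- (q ^ h * real (card (tuples U n)) / real \<theta>) - q ^ h * real (card (tuples U n')) / real \<theta>
      + (4 * real ((2 * h) ^ (2 * h + 1)) + 2 * real (h ^ (h + 1)) + 3 * fact h) * err2 q M)"
proof -
  have finV: "finite V" by (rule finite_subset[OF assms(2,1)])
  have M: "M \<ge> 1" using q(3) by (cases M) auto
  have "subset_exp U q (\<lambda>S. of_bool (missed S n) * of_bool (missed S n')) \<le>
     subset_exp U q (\<lambda>S. of_bool (avoids (supports V n \<union> supports V n') S))"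
  proof (intro subset_exp_mono q)
    fix S assume "S \<subseteq> U"
    then show "(of_bool (missed S n) * of_bool (missed S n') :: real) \<le> of_bool (avoids (supports V n \<union> supports V n') S)"
      using missed_iff[of S U n V] missed_iff[of S U n' V] assms by (auto simp: avoids_def)
  qed
  also note avoids_upper[OF assms(1,2,8) q]
  finally have 1: "subset_exp U q (\<lambda>S. of_bool (missed S n) * of_bool (missed S n')) \<le>
    exp (- (q ^ h * real (card (supports V n \<union> supports V n'))) + 4 * real ((2 * h) ^ (2 * h + 1)) * err2 q M)" .
  \<comment> \<open>Up to a constant, the expected number of exceptional supports inside the random
    set: those lost against \<open>card (tuples U n) / \<theta>\<close> and those common to both
    targets. As \<open>E = (q * M) ^ h / M ^ 2\<close>, it is absorbed by
    \<open>err2\<close>.\<close>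
  define E where "E = q ^ h * real M ^ (h - 2)"
  have E: "0 \<le> E" "E \<le> err2 q M"
  proof -
    show "0 \<le> E" using q by (simp add: E_def)
    have "E = (q * real M) ^ h / (real M)\<^sup>2"
    proof -
      have "real M ^ h = real M ^ (h - 2) * (real M)\<^sup>2" using h2 by (metis le_add_diff_inverse2 power_add)
      then show ?thesis using M by (simp add: E_def power_mult_distrib)
    qed
    also have "\<dots> \<le> err2 q M" unfolding err2_def using q h2 by (intro divide_right_mono power_increasing) auto
    finally show "E \<le> err2 q M" .
  qed
  define K where "K = real (h ^ (h + 1)) + fact h"
  have K: "K \<ge> 0" by (simp add: K_def)
  have low: "q ^ h * real (card (tuples U m)) / real \<theta> \<le> q ^ h * real (card (supports V m)) + K * E"
    if "m \<noteq> 0" "tuples U m \<subseteq> tuples V m" for m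
  proof -
    have "tuples U m = tuples V m" using that assms(2) by (auto simp: tuples_def)
    then have "card (tuples U m) \<le> \<theta> * card (supports V m) + (h ^ (h + 1) + fact h) * M ^ (h - 2)"
      using card_supports_lower[OF finV that(1) assms(8) M] by simp
    then have "real (card (tuples U m)) \<le> real (\<theta> * card (supports V m) + (h ^ (h + 1) + fact h) * M ^ (h - 2))"
      by (simp only: of_nat_le_iff)
    then have "q ^ h * real (card (tuples U m)) \<le> q ^ h * (real \<theta> * real (card (supports V m)) + K * real M ^ (h - 2))"
      using q by (intro mult_left_mono) (auto simp: K_def)
    also have "\<dots> = real \<theta> * (q ^ h * real (card (supports V m))) + K * E"
      by (simp add: E_def algebra_simps)
    also have "K * E \<le> real \<theta> * (K * E)"
    proof -
      have "1 * (K * E) \<le> real \<theta> * (K * E)" using theta_pos K E(1) by (intro mult_right_mono) auto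
      then show ?thesis by simp
    qed
    finally have "q ^ h * real (card (tuples U m)) \<le> real \<theta> * (q ^ h * real (card (supports V m)) + K * E)"
      by (simp add: distrib_left)
    then show ?thesis using theta_pos by (simp add: field_simps)
  qed
  have "card (supports V n) + card (supports V n') = card (supports V n \<union> supports V n') + card (supports V n \<inter> supports V n')"
    using finV by (intro card_Un_Int) auto
  also have "\<dots> \<le> card (supports V n \<union> supports V n') + fact h * M ^ (h - 2)"
    using card_supports_inter[OF finV assms(7,8) M] by simp
  finally have "real (card (supports V n) + card (supports V n')) \<le> real (card (supports V n \<union> supports V n') + fact h * M ^ (h - 2))"
    by (simp only: of_nat_le_iff)
  then have "q ^ h * (real (card (supports V n)) + real (card (supports V n'))) \<le>
      q ^ h * (real (card (supports V n \<union> supports V n')) + fact h * real M ^ (h - 2))"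
    using q by (intro mult_left_mono) auto
  then have "q ^ h * real (card (supports V n)) + q ^ h * real (card (supports V n')) \<le>
      q ^ h * real (card (supports V n \<union> supports V n')) + fact h * E"
    by (simp add: E_def algebra_simps)
  then have "- (q ^ h * real (card (supports V n \<union> supports V n'))) \<le>
     - (q ^ h * real (card (tuples U n)) / real \<theta>) - q ^ h * real (card (tuples U n')) / real \<theta> + (2 * K + fact h) * E"
    using low[OF assms(5,3)] low[OF assms(6,4)] unfolding distrib_right by linarith
  moreover have "(2 * K + fact h) * E \<le> (2 * K + fact h) * err2 q M"
    using E K by (intro mult_left_mono) auto
  ultimately have "- (q ^ h * real (card (supports V n \<union> supports V n'))) + 4 * real ((2 * h) ^ (2 * h + 1)) * err2 q M \<le>
    - (q ^ h * real (card (tuples U n)) / real \<theta>) - q ^ h * real (card (tuples U n')) / real \<theta>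
      + (4 * real ((2 * h) ^ (2 * h + 1)) + 2 * real (h ^ (h + 1)) + 3 * fact h) * err2 q M"
    unfolding K_def by (simp add: algebra_simps)
  then show ?thesis using 1 by (meson exp_le_cancel_iff order.trans)
qed

end

subsection \<open>Targets near the ends of the range\<close>

lemma riemann_sum_tendsto:
  fixes g :: "real \<Rightarrow> real" and s :: "nat \<Rightarrow> real"
  assumes g: "continuous_on {0..T} g" and T: "T > 0" and s: "filterlim s at_top sequentially"
  shows "(\<lambda>N. (\<Sum>k<nat \<lceil>T * s N\<rceil>. g (real k / s N)) / s N) \<longlonglongrightarrow> integral {0..T} g"
proof -
  \<comment> \<open>The last cell of the sum may reach beyond \<open>T\<close> by up to
    \<open>1 / s N\<close>; extending \<open>g\<close> by constants gives the integrals there a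
    meaning.\<close>
  define g' where "g' x = g (max 0 (min x T))" for x
  have g'c: "continuous_on A g'" for A
    unfolding g'_def using T by (intro continuous_on_compose2[OF g] continuous_intros) auto
  have g'i: "g' integrable_on {a..b}" for a b by (intro integrable_continuous_interval g'c)
  obtain B where B: "\<And>x. \<bar>g' x\<bar> \<le> B"
  proof -
    have "bounded (g ` {0..T})" by (intro compact_imp_bounded compact_continuous_image g compact_Icc)
    then obtain B where "\<forall>y\<in>g ` {0..T}. norm y \<le> B" unfolding bounded_iff by blast
    then show thesis using T by (intro that[of B]) (auto simp: g'_def)
  qed
  have B0: "B \<ge> 0" using B[of 0] by linarith
  have g'eq: "g' x = g x" if "x \<in> {0..T}" for x using that by (simp add: g'_def)
  have split: "integral {0..real n / t} g' = (\<Sum>k<n. integral {real k / t..real (Suc k) / t} g')" if "t > 0" for n t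
  proof (induction n)
    case (Suc n)
    have "integral {0..real (Suc n) / t} g' = integral {0..real n / t} g' + integral {real n / t..real (Suc n) / t} g'"
      using that by (intro Henstock_Kurzweil_Integration.integral_combine[symmetric] g'i) (auto simp: divide_right_mono)
    then show ?case using Suc by simp
  qed simp
  show ?thesis
  proof (rule tendstoI)
    fix \<epsilon> :: real assume \<epsilon>: "\<epsilon> > 0"
    define \<eta> where "\<eta> = \<epsilon> / (2 * (T + 1))"
    have \<eta>: "\<eta> > 0" using \<epsilon> T by (simp add: \<eta>_def)
    have "uniformly_continuous_on {0..T + 1} g'" by (intro compact_uniformly_continuous g'c compact_Icc)
    then obtain \<delta> where \<delta>: "\<delta> > 0" "\<And>x y. x \<in> {0..T+1} \<Longrightarrow> y \<in> {0..T+1} \<Longrightarrow> dist y x < \<delta> \<Longrightarrow> dist (g' y) (g' x) < \<eta>"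
      unfolding uniformly_continuous_on_def using \<eta> by metis
    \<comment> \<open>The three conditions keep all cells inside \<open>{0..T + 1}\<close>, make a
      cell shorter than the modulus \<open>\<delta>\<close>, and make the overshoot beyond
      \<open>T\<close> cost less than half of \<open>\<epsilon>\<close>.\<close>
    have "eventually (\<lambda>N. s N > 1 \<and> s N > 1 / \<delta> \<and> s N > 4 * B / \<epsilon>) sequentially"
      using s by (intro eventually_conj) (auto simp: filterlim_at_top_dense)
    then show "\<forall>\<^sub>F N in sequentially. dist ((\<Sum>k<nat \<lceil>T * s N\<rceil>. g (real k / s N)) / s N) (integral {0..T} g) < \<epsilon>"
    proof eventually_elim
      case (elim N)
      define t where "t = s N"
      have t: "t > 1" "1 / t < \<delta>" "4 * B < \<epsilon> * t" using elim \<delta>(1) \<epsilon> by (simp_all add: t_def field_simps)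
      define n where "n = nat \<lceil>T * t\<rceil>"
      have n: "T * t \<le> real n" "real n < T * t + 1" 
      proof -
        have "0 < T * t" using T t by simp
        then have "real n = of_int \<lceil>T * t\<rceil>" by (simp add: n_def)
        then show "T * t \<le> real n" "real n < T * t + 1" by linarith+
      qed
      have nt: "T \<le> real n / t" "real n / t < T + 1 / t" "real n / t \<le> T + 1" 
      proof -
        show "T \<le> real n / t" using n t by (simp add: field_simps)
        show less: "real n / t < T + 1 / t" using n t by (simp add: field_simps)
        have "1 / t \<le> 1" using t by simp
        then show "real n / t \<le> T + 1" using less by linarith
      qed
      have kin: "real k / t \<in> {0..T}" if "k < n" for k
      proof -
        have "real k < T * t" using that unfolding n_def by linarith
        then show ?thesis using t by (auto simp: field_simps)
      qed
      have piece: "\<bar>g (real k / t) / t - integral {real k / t..real (Suc k) / t} g'\<bar> \<le> \<eta> / t" if k: "k < n" for k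
      proof -
        have kk: "real k / t \<le> real (Suc k) / t" using t by (simp add: divide_right_mono)
        have len: "real (Suc k) / t - real k / t = 1 / t" by (simp add: add_divide_distrib)
        have "((\<lambda>x. g' (real k / t) - g' x) has_integral ((real (Suc k) / t - real k / t) * g' (real k / t) - integral {real k / t..real (Suc k) / t} g'))
           {real k / t..real (Suc k) / t}"
          using has_integral_const_real[of "g' (real k / t)" "real k / t" "real (Suc k) / t"] kk
          by (intro has_integral_diff integrable_integral g'i) auto
        moreover have "norm (g' (real k / t) - g' x) \<le> \<eta>" if x: "x \<in> {real k / t..real (Suc k) / t}" for x
        proof -
          have "real (Suc k) / t \<le> real n / t" using k t by (intro divide_right_mono) auto
          then have "x \<in> {0..T+1}" "real k / t \<in> {0..T+1}" using x nt kin[OF k] by auto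
          moreover have "dist (real k / t) x < \<delta>" using x len t by (auto simp: dist_real_def)
          ultimately show ?thesis using \<delta>(2) by (auto simp: dist_real_def less_imp_le)
        qed
        ultimately have "norm ((real (Suc k) / t - real k / t) * g' (real k / t) - integral {real k / t..real (Suc k) / t} g') \<le> \<eta> * measure lborel (cbox (real k / t) (real (Suc k) / t))"
          using \<eta> by (intro has_integral_bound[of \<eta> "\<lambda>x. g' (real k / t) - g' x"]) auto
        moreover have "measure lborel (cbox (real k / t) (real (Suc k) / t)) = 1 / t"
          unfolding len[symmetric] using kk by (simp del: of_nat_Suc)
        ultimately show ?thesis unfolding len g'eq[OF kin[OF k]] by simp
      qed
      have "\<bar>(\<Sum>k<n. g (real k / t)) / t - integral {0..real n / t} g'\<bar> \<le> real n * (\<eta> / t)"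
      proof -
        have "(\<Sum>k<n. g (real k / t)) / t - integral {0..real n / t} g' = (\<Sum>k<n. g (real k / t) / t - integral {real k / t..real (Suc k) / t} g')"
          using t by (subst split) (auto simp: sum_subtractf sum_divide_distrib)
        also have "\<bar>\<dots>\<bar> \<le> (\<Sum>k<n. \<eta> / t)" using piece by (intro order.trans[OF sum_abs] sum_mono) auto
        finally show ?thesis by simp
      qed
      moreover have "real n * (\<eta> / t) \<le> \<epsilon> / 2"
      proof -
        have "real n / t * \<eta> \<le> (T + 1) * \<eta>" using nt \<eta> by (intro mult_right_mono) auto
        moreover have "(T + 1) * \<eta> = \<epsilon> / 2" unfolding \<eta>_def using T by (simp add: field_simps)
        ultimately show ?thesis by simp
      qed
      moreover have "\<bar>integral {0..real n / t} g' - integral {0..T} g\<bar> \<le> B * (1 / t)"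
      proof -
        have "integral {0..T} g = integral {0..T} g'" by (intro integral_cong) (simp add: g'eq)
        moreover have "integral {0..real n / t} g' = integral {0..T} g' + integral {T..real n / t} g'"
          using nt T by (intro Henstock_Kurzweil_Integration.integral_combine[symmetric] g'i) auto
        moreover have "norm (integral {T..real n / t} g') \<le> B * (real n / t - T)"
          using integral_bound[OF nt(1) g'c, of B] B by auto
        moreover have "B * (real n / t - T) \<le> B * (1 / t)" using nt B0 by (intro mult_left_mono) auto
        ultimately show ?thesis by simp
      qed
      moreover have "B * (1 / t) < \<epsilon> / 2" using t B0 \<epsilon> by (simp add: field_simps)
      ultimately show ?case unfolding t_def[symmetric] n_def[symmetric] dist_real_def by linarith
    qed
  qed
qed

locale primitive_form = linear_form +
  assumes primitive: "(GCD i\<in>{1..h}. u i) = 1"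
begin

definition "wt i = nat \<bar>u i\<bar>"

lemma int_wt: "int (wt i) = \<bar>u i\<bar>" by (simp add: wt_def)

sublocale wts: weights I wt
proof
  show "Gcd (wt ` I) = 1"
  proof -
    define g where "g = Gcd (wt ` I)"
    have "int g dvd u i" if "i \<in> I" for i
    proof -
      have "g dvd wt i" using that by (simp add: g_def)
      then have "int g dvd int (wt i)" by simp
      then show ?thesis by (simp add: int_wt)
    qed
    then have "int g dvd (GCD i\<in>{1..h}. u i)" by (intro Gcd_greatest) (auto simp: I_def)
    then show ?thesis using primitive by (simp add: g_def)
  qed
qed (use h2 u_nz in \<open>auto simp: wt_def\<close>)

lemma wts_n: "wts.n = h" by (simp add: wts.n_def)

abbreviation "m \<equiv> wts.W"
abbreviation "d \<equiv> neg_sum h u"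

lemma sum_wt: "pos_sum h u + d = int m"
proof -
  have "pos_sum h u + d = (\<Sum>i\<in>{i\<in>I. u i > 0}. \<bar>u i\<bar>) + (\<Sum>i\<in>{i\<in>I. u i < 0}. \<bar>u i\<bar>)"
    unfolding pos_sum_def neg_sum_def I_def by (intro arg_cong2[of _ _ _ _ "(+)"] sum.cong) auto
  also have "\<dots> = (\<Sum>i\<in>{i\<in>I. u i > 0} \<union> {i\<in>I. u i < 0}. \<bar>u i\<bar>)"
    by (intro sum.union_disjoint[symmetric]) auto
  also have "{i\<in>I. u i > 0} \<union> {i\<in>I. u i < 0} = I" using u_nz by force
  finally show ?thesis by (simp add: wts.W_def int_wt)
qed

text \<open>The values at distance \<open>k\<close> from the lower and from the upper end of the range; their
  representations only use elements of \<open>{0..N}\<close> within \<open>k\<close> of an end.\<close>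

definition "lo N k = int k - d * int N"
definition "hi N k = pos_sum h u * int N - int k"
definition "window N \<kappa> = {x \<in> {0..int N}. x < int \<kappa> \<or> x > int N - int \<kappa>}"

text \<open>Reflecting the entries with negative coefficient makes all coefficients positive and
  shifts the value by \<open>d * N\<close>. Representations of a value thereby become bounded
  solutions for the weights \<open>wt\<close>, counted by \<open>bsol\<close>.\<close>

definition flip :: "nat \<Rightarrow> (nat \<Rightarrow> int) \<Rightarrow> nat \<Rightarrow> nat" where
  "flip N a = restrict (\<lambda>i. if u i > 0 then nat (a i) else nat (int N - a i)) I"

lemma card_window: "card (window N \<kappa>) \<le> 2 * \<kappa>"
proof -
  have "window N \<kappa> \<subseteq> {0..<int \<kappa>} \<union> {int N - int \<kappa><..int N}" by (auto simp: window_def)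
  then have "card (window N \<kappa>) \<le> card ({0..<int \<kappa>} \<union> {int N - int \<kappa><..int N})" by (intro card_mono) auto
  also have "\<dots> \<le> card {0..<int \<kappa>} + card {int N - int \<kappa><..int N}" by (rule card_Un_le)
  finally show ?thesis by simp
qed

lemma flip_mem: "a \<in> I \<rightarrow>\<^sub>E {0..int N} \<Longrightarrow> flip N a \<in> I \<rightarrow>\<^sub>E {..N}"
  by (fastforce simp: flip_def PiE_iff)

lemma flip_sum:
  assumes "a \<in> I \<rightarrow>\<^sub>E {0..int N}"
  shows "int (\<Sum>i\<in>I. wt i * flip N a i) = L a + d * int N"
proof -
  have "int (\<Sum>i\<in>I. wt i * flip N a i) = (\<Sum>i\<in>I. u i * a i + (if u i < 0 then \<bar>u i\<bar> * int N else 0))"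
    unfolding of_nat_sum
  proof (intro sum.cong refl)
    fix i assume i: "i \<in> I"
    then have "0 \<le> a i" "a i \<le> int N" "u i \<noteq> 0" using assms u_nz by (auto simp: PiE_iff)
    then show "int (wt i * flip N a i) = u i * a i + (if u i < 0 then \<bar>u i\<bar> * int N else 0)"
      using i by (auto simp: flip_def int_wt algebra_simps)
  qed
  also have "\<dots> = L a + (\<Sum>i\<in>I. if u i < 0 then \<bar>u i\<bar> * int N else 0)"
    by (simp add: sum.distrib L_def)
  also have "(\<Sum>i\<in>I. if u i < 0 then \<bar>u i\<bar> * int N else 0) = d * int N"
    unfolding neg_sum_def I_def sum_distrib_right by (simp only: sum.inter_filter[OF finite_atLeastAtMost])
  finally show ?thesis .
qed

lemma card_tuples_bsol:
  assumes "n + d * int N = int k"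
  shows "card (tuples {0..int N} n) = bsol I wt N k"
proof -
  let ?g = "\<lambda>b. restrict (\<lambda>i. if u i > 0 then int (b i) else int N - int (b i)) I"
  let ?B = "{b \<in> I \<rightarrow>\<^sub>E {..N}. (\<Sum>i\<in>I. wt i * b i) = k}"
  have gm: "?g b \<in> I \<rightarrow>\<^sub>E {0..int N}" if "b \<in> I \<rightarrow>\<^sub>E {..N}" for b
    using that by (fastforce simp: PiE_iff)
  have fg: "flip N (?g b) = b" if "b \<in> I \<rightarrow>\<^sub>E {..N}" for b
    using that by (auto simp: flip_def fun_eq_iff PiE_iff extensional_def)
  have "bij_betw (flip N) (tuples {0..int N} n) ?B"
  proof (rule bij_betw_byWitness[where f' = ?g])
    show "\<forall>a\<in>tuples {0..int N} n. ?g (flip N a) = a"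
      by (auto simp: flip_def tuples_def fun_eq_iff PiE_iff extensional_def)
    show "\<forall>b\<in>?B. flip N (?g b) = b" using fg by blast
    show "flip N ` tuples {0..int N} n \<subseteq> ?B"
    proof (intro image_subsetI)
      fix a assume a: "a \<in> tuples {0..int N} n"
      then have a': "a \<in> I \<rightarrow>\<^sub>E {0..int N}" "L a = n" by (auto simp: tuples_def)
      have "int (\<Sum>i\<in>I. wt i * flip N a i) = int k" using flip_sum[OF a'(1)] a'(2) assms by simp
      then show "flip N a \<in> ?B" using flip_mem[OF a'(1)] by (simp only: of_nat_eq_iff mem_Collect_eq)
    qed
    show "?g ` ?B \<subseteq> tuples {0..int N} n"
    proof (intro image_subsetI)
      fix b assume b: "b \<in> ?B"
      then have b': "b \<in> I \<rightarrow>\<^sub>E {..N}" "(\<Sum>i\<in>I. wt i * b i) = k" by blast+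
      have "int k = L (?g b) + d * int N" using flip_sum[OF gm[OF b'(1)]] unfolding fg[OF b'(1)] b'(2) .
      then show "?g b \<in> tuples {0..int N} n" using gm[OF b'(1)] assms by (auto simp: tuples_def)
    qed
  qed
  then show ?thesis unfolding bsol_def by (simp add: bij_betw_same_card)
qed

lemma card_tuples_lo: "card (tuples {0..int N} (lo N k)) = bsol I wt N k"
  by (rule card_tuples_bsol) (simp add: lo_def)

lemma card_tuples_hi:
  assumes "k \<le> N * m"
  shows "card (tuples {0..int N} (hi N k)) = bsol I wt N k"
proof -
  have "hi N k + d * int N = (pos_sum h u + d) * int N - int k" by (simp add: hi_def algebra_simps)
  also have "\<dots> = int (N * m - k)" using assms by (simp add: sum_wt of_nat_diff mult.commute)
  finally have "card (tuples {0..int N} (hi N k)) = bsol I wt N (N * m - k)" by (rule card_tuples_bsol)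
  then show ?thesis using wts.bsol_sym[OF assms] by simp
qed

lemma tuples_lo_window:
  assumes "k < \<kappa>"
  shows "tuples {0..int N} (lo N k) \<subseteq> tuples (window N \<kappa>) (lo N k)"
proof
  fix a assume "a \<in> tuples {0..int N} (lo N k)"
  then have a: "a \<in> I \<rightarrow>\<^sub>E {0..int N}" "L a = lo N k" by (auto simp: tuples_def)
  have "int (\<Sum>i\<in>I. wt i * flip N a i) = int k" using flip_sum[OF a(1)] a(2) by (simp add: lo_def)
  then have s: "(\<Sum>i\<in>I. wt i * flip N a i) = k" by (simp only: of_nat_eq_iff)
  have "a i \<in> window N \<kappa>" if i: "i \<in> I" for i
  proof -
    have "flip N a i \<le> k" using sol_le[of I wt "flip N a" k i] s wts.wpos[OF i] i by simp
    moreover have "0 \<le> a i" "a i \<le> int N" using a i by (auto simp: PiE_iff)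
    ultimately show ?thesis using i assms by (auto simp: window_def flip_def split: if_splits)
  qed
  then show "a \<in> tuples (window N \<kappa>) (lo N k)" using a by (auto simp: tuples_def PiE_iff)
qed

lemma tuples_hi_window:
  assumes "k < \<kappa>"
  shows "tuples {0..int N} (hi N k) \<subseteq> tuples (window N \<kappa>) (hi N k)"
proof
  fix a assume "a \<in> tuples {0..int N} (hi N k)"
  then have a: "a \<in> I \<rightarrow>\<^sub>E {0..int N}" "L a = hi N k" by (auto simp: tuples_def)
  have fl: "flip N a i \<le> N" if "i \<in> I" for i using flip_mem[OF a(1)] that by (auto simp: PiE_iff)
  have "int (\<Sum>i\<in>I. wt i * flip N a i) = (pos_sum h u + d) * int N - int k"
    using flip_sum[OF a(1)] a(2) by (simp add: hi_def algebra_simps)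
  moreover have "(\<Sum>i\<in>I. wt i * (N - flip N a i)) + (\<Sum>i\<in>I. wt i * flip N a i) = m * N"
    unfolding sum.distrib[symmetric] wts.W_def sum_distrib_right
    using fl by (intro sum.cong) (auto simp flip: distrib_left)
  then have "int (\<Sum>i\<in>I. wt i * (N - flip N a i)) + int (\<Sum>i\<in>I. wt i * flip N a i) = int m * int N"
    by (metis of_nat_add of_nat_mult)
  ultimately have "int (\<Sum>i\<in>I. wt i * (N - flip N a i)) = int k" unfolding sum_wt by linarith
  then have s: "(\<Sum>i\<in>I. wt i * (N - flip N a i)) = k" by (simp only: of_nat_eq_iff)
  have "a i \<in> window N \<kappa>" if i: "i \<in> I" for i
  proof -
    have "N - flip N a i \<le> k" using sol_le[of I wt "\<lambda>i. N - flip N a i" k i] s wts.wpos[OF i] i by simp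
    moreover have "0 \<le> a i" "a i \<le> int N" using a i by (auto simp: PiE_iff)
    ultimately show ?thesis using i assms by (auto simp: window_def flip_def split: if_splits)
  qed
  then show "a \<in> tuples (window N \<kappa>) (hi N k)" using a by (auto simp: tuples_def PiE_iff)
qed

lemma lo_inj: "lo N k = lo N k' \<longleftrightarrow> k = k'" and hi_inj: "hi N k = hi N k' \<longleftrightarrow> k = k'"
  by (auto simp: lo_def hi_def)

lemma lo_eq_hi: "lo N k = hi N k' \<longleftrightarrow> k + k' = N * m"
proof -
  have "lo N k = hi N k' \<longleftrightarrow> int k + int k' = (pos_sum h u + d) * int N"
    by (auto simp: lo_def hi_def algebra_simps)
  also have "\<dots> \<longleftrightarrow> int (k + k') = int (N * m)" unfolding sum_wt by (simp add: mult.commute)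
  finally show ?thesis by (simp only: of_nat_eq_iff)
qed

definition targets :: "nat \<Rightarrow> nat \<Rightarrow> int set" where
  "targets N \<kappa> = lo N ` {..<\<kappa>} \<union> hi N ` {..<\<kappa>}"

lemma finite_targets [simp]: "finite (targets N \<kappa>)" by (simp add: targets_def)

text \<open>Two indices below \<open>\<kappa>\<close> add up to at most \<open>N * m - 1\<close>, so
  the values counted from the two ends are distinct.\<close>

lemma sum_targets:
  fixes f :: "int \<Rightarrow> real"
  assumes "2 * \<kappa> \<le> N * m + 1"
  shows "(\<Sum>n\<in>targets N \<kappa>. f n) = (\<Sum>k<\<kappa>. f (lo N k) + f (hi N k))"
proof -
  have "(\<Sum>n\<in>targets N \<kappa>. f n) = (\<Sum>n\<in>lo N ` {..<\<kappa>}. f n) + (\<Sum>n\<in>hi N ` {..<\<kappa>}. f n)"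
    unfolding targets_def
  proof (intro sum.union_disjoint)
    show "lo N ` {..<\<kappa>} \<inter> hi N ` {..<\<kappa>} = {}"
    proof (rule ccontr)
      assume "\<not> ?thesis"
      then obtain k k' where "k < \<kappa>" "k' < \<kappa>" "lo N k = hi N k'" by auto
      then show False using lo_eq_hi assms by fastforce
    qed
  qed auto
  also have "\<dots> = (\<Sum>k<\<kappa>. f (lo N k)) + (\<Sum>k<\<kappa>. f (hi N k))"
    by (simp add: sum.reindex inj_on_def lo_inj hi_inj)
  finally show ?thesis by (simp add: sum.distrib)
qed

end

context linear_form
begin

text \<open>Expressed through \<open>q ^ h * M ^ (h - 1)\<close>, which bounds the expected number
  of supports in the random set up to a constant and stays bounded on the natural scale. Both errors
  are then of order \<open>1 / (q * M)\<close>.\<close>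

lemma err1_eq: "M > 0 \<Longrightarrow> q > 0 \<Longrightarrow> err1 q M = (q ^ h * real M ^ (h - 1)) / (q * real M)"
  using h2 unfolding err1_def power_mult_distrib
  by (cases h) (auto simp: field_simps)

lemma err2_eq: "M > 0 \<Longrightarrow> q > 0 \<Longrightarrow> err2 q M = (q ^ h * real M ^ (h - 1))\<^sup>2 / (q * real M)"
proof -
  assume M: "M > 0" "q > 0"
  obtain j where j: "h = Suc (Suc j)" using h2 by (cases h; cases "h - 1") auto
  have "2 * h - 1 = Suc (Suc (Suc (2 * j)))" by (simp add: j)
  then show ?thesis unfolding err2_def using M by (simp add: j power_mult_distrib field_simps power2_eq_square power_mult power_even_eq)
qed

end

context primitive_form
begin

section \<open>First and second moment of the number of missed values near the ends\<close>

definition "intensity N q n = q ^ h * real (card (tuples {0..int N} n)) / real \<theta>"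

definition edge_missing :: "nat \<Rightarrow> nat \<Rightarrow> int set \<Rightarrow> real" where
  "edge_missing N \<kappa> S = (\<Sum>n\<in>targets N \<kappa>. of_bool (missed S n))"

lemma intensity_lo: "intensity N q (lo N k) = q ^ h * real (bsol I wt N k) / real \<theta>"
  by (simp add: intensity_def card_tuples_lo)

lemma intensity_hi: "k \<le> N * m \<Longrightarrow> intensity N q (hi N k) = q ^ h * real (bsol I wt N k) / real \<theta>"
  by (simp add: intensity_def card_tuples_hi)

lemma targets_window: "n \<in> targets N \<kappa> \<Longrightarrow> tuples {0..int N} n \<subseteq> tuples (window N \<kappa>) n"
  unfolding targets_def by (auto dest: subsetD[OF tuples_lo_window] subsetD[OF tuples_hi_window])

lemma window_subset: "window N \<kappa> \<subseteq> {0..int N}" by (auto simp: window_def)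

lemma sum_targets_zero:
  assumes "2 * \<kappa> \<le> N * m + 1"
  shows "(\<Sum>k<\<kappa>. of_bool (lo N k = 0) + of_bool (hi N k = 0)) \<le> (1::real)"
proof -
  have "(\<Sum>k<\<kappa>. of_bool (lo N k = 0) + of_bool (hi N k = 0)) = (\<Sum>n\<in>targets N \<kappa>. of_bool (n = 0) :: real)"
    by (rule sum_targets[OF assms, symmetric])
  also have "\<dots> \<le> 1" by (simp add: of_bool_def sum.If_cases)
  finally show ?thesis .
qed

lemma card_targets: "card (targets N \<kappa>) \<le> 2 * \<kappa>"
proof -
  have "card (targets N \<kappa>) \<le> card (lo N ` {..<\<kappa>}) + card (hi N ` {..<\<kappa>})"
    unfolding targets_def by (rule card_Un_le)
  also have "\<dots> \<le> \<kappa> + \<kappa>" by (intro add_mono order.trans[OF card_image_le]) auto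
  finally show ?thesis by simp
qed

text \<open>\<open>missed_lower\<close> requires \<open>n \<noteq> 0\<close>. The single target 0,
  if present, is given up, which accounts for the \<open>- 1\<close>.\<close>

lemma edge_missing_mean_lower:
  assumes \<kappa>: "2 * \<kappa> \<le> N * m + 1" and q: "0 \<le> q" "q \<le> 1 / 2" "q * real (2 * \<kappa>) \<ge> 1"
    and approx: "\<And>k. k < \<kappa> \<Longrightarrow> (1 + 2 * q) * (q ^ h * real (bsol I wt N k) / real \<theta> + real (h ^ (h + 1)) * err1 q (2 * \<kappa>)) \<le> g k + \<epsilon>"
    and g: "\<And>k. k < \<kappa> \<Longrightarrow> 0 \<le> g k"
  shows "exp (- \<epsilon>) * (2 * (\<Sum>k<\<kappa>. exp (- g k)) - 1) \<le> subset_exp {0..int N} q (edge_missing N \<kappa>)"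
proof -
  let ?U = "{0..int N}"
  define P where "P n = subset_exp ?U q (\<lambda>S. of_bool (missed S n))" for n
  have P0: "P n \<ge> 0" for n unfolding P_def using q by (intro subset_exp_nonneg) auto
  have low: "exp (- \<epsilon>) * (exp (- g k) - of_bool (n = 0)) \<le> P n"
    if k: "k < \<kappa>" and n: "n = lo N k \<or> n = hi N k" for k n
  proof (cases "n = 0")
    case True
    have "exp (- g k) \<le> 1" using g[OF k] by simp
    then have "exp (- \<epsilon>) * (exp (- g k) - of_bool (n = 0)) \<le> 0"
      using True by (intro mult_nonneg_nonpos) auto
    then show ?thesis using P0[of n] by linarith
  next
    case False
    have "k \<le> N * m" using k \<kappa> by linarith
    then have "intensity N q n = q ^ h * real (bsol I wt N k) / real \<theta>" using n intensity_lo intensity_hi by auto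
    then have intensity: "q ^ h * real (card (tuples ?U n)) / real \<theta> = q ^ h * real (bsol I wt N k) / real \<theta>"
      by (simp add: intensity_def)
    have "n \<in> targets N \<kappa>" using n k by (auto simp: targets_def)
    then have "exp (- ((1 + 2 * q) * (q ^ h * real (card (tuples ?U n)) / real \<theta> + real (h ^ (h + 1)) * err1 q (2 * \<kappa>)))) \<le> P n"
      unfolding P_def
      by (intro missed_lower[where V = "window N \<kappa>"] window_subset targets_window card_window q False) auto
    moreover have "exp (- \<epsilon>) * exp (- g k) \<le> exp (- ((1 + 2 * q) * (q ^ h * real (card (tuples ?U n)) / real \<theta> + real (h ^ (h + 1)) * err1 q (2 * \<kappa>))))"
      unfolding intensity using approx[OF k] by (simp flip: exp_add)
    ultimately show ?thesis using False by simp
  qed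
  have "exp (- \<epsilon>) * (2 * (\<Sum>k<\<kappa>. exp (- g k)) - 1) \<le>
    exp (- \<epsilon>) * (2 * (\<Sum>k<\<kappa>. exp (- g k)) - (\<Sum>k<\<kappa>. of_bool (lo N k = 0) + of_bool (hi N k = 0)))"
    using sum_targets_zero[OF \<kappa>] by (intro mult_left_mono) auto
  also have "\<dots> = (\<Sum>k<\<kappa>. exp (- \<epsilon>) * (exp (- g k) - of_bool (lo N k = 0)) + exp (- \<epsilon>) * (exp (- g k) - of_bool (hi N k = 0)))"
    by (simp add: sum.distrib sum_subtractf sum_distrib_left algebra_simps)
  also have "\<dots> \<le> (\<Sum>k<\<kappa>. P (lo N k) + P (hi N k))" by (intro sum_mono add_mono low) auto
  also have "\<dots> = (\<Sum>n\<in>targets N \<kappa>. P n)" by (rule sum_targets[OF \<kappa>, symmetric])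
  also have "\<dots> = subset_exp ?U q (edge_missing N \<kappa>)" unfolding edge_missing_def[abs_def] subset_exp_sum P_def ..
  finally show ?thesis .
qed

text \<open>Pairs with \<open>\<bar>n\<bar> = \<bar>n'\<bar>\<close> are excluded from the product bound: for \<open>u = (1, -1)\<close> the values
  \<open>n\<close> and \<open>- n\<close> are missed simultaneously.\<close>

lemma edge_missing_second_moment:
  assumes \<kappa>: "2 * \<kappa> \<le> N * m + 1" and q: "0 \<le> q" "q \<le> 1" "q * real (2 * \<kappa>) \<ge> 1"
    and approx: "\<And>k. k < \<kappa> \<Longrightarrow> g k - \<epsilon> \<le> q ^ h * real (bsol I wt N k) / real \<theta>"
    and err: "(4 * real ((2 * h) ^ (2 * h + 1)) + 2 * real (h ^ (h + 1)) + 3 * fact h) * err2 q (2 * \<kappa>) \<le> \<epsilon>"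
  shows "subset_exp {0..int N} q (\<lambda>S. (edge_missing N \<kappa> S)\<^sup>2) \<le> exp (3 * \<epsilon>) * (2 * (\<Sum>k<\<kappa>. exp (- g k)))\<^sup>2 + 8 * real \<kappa>"
proof -
  let ?U = "{0..int N}" and ?T = "targets N \<kappa>"
  define P where "P n n' = subset_exp ?U q (\<lambda>S. of_bool (missed S n) * of_bool (missed S n'))" for n n'
  define v where "v n = exp (- intensity N q n)" for n
  have P1: "P n n' \<le> 1" for n n'
  proof -
    have "P n n' \<le> subset_exp ?U q (\<lambda>_. 1)" unfolding P_def using q by (intro subset_exp_mono) auto
    then show ?thesis by simp
  qed
  have up: "P n n' \<le> exp \<epsilon> * (v n * v n') + (of_bool (\<bar>n\<bar> = \<bar>n'\<bar>) + of_bool (n = 0) + of_bool (n' = 0))"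
    if n: "n \<in> ?T" "n' \<in> ?T" for n n'
  proof (cases "\<bar>n\<bar> = \<bar>n'\<bar> \<or> n = 0 \<or> n' = 0")
    case True
    have "0 \<le> exp \<epsilon> * (v n * v n')" by (simp add: v_def)
    moreover have "1 \<le> (of_bool (\<bar>n\<bar> = \<bar>n'\<bar>) + of_bool (n = 0) + of_bool (n' = 0) :: real)"
      using True by auto
    ultimately show ?thesis using P1[of n n'] by linarith
  next
    case False
    have "P n n' \<le> exp (- (q ^ h * real (card (tuples ?U n)) / real \<theta>) - q ^ h * real (card (tuples ?U n')) / real \<theta>
      + (4 * real ((2 * h) ^ (2 * h + 1)) + 2 * real (h ^ (h + 1)) + 3 * fact h) * err2 q (2 * \<kappa>))"
      unfolding P_def using False
      by (intro missed_pair_upper[where V = "window N \<kappa>"] window_subset targets_window card_window q n) auto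
    also have "\<dots> \<le> exp (- intensity N q n - intensity N q n' + \<epsilon>)" using err by (simp add: intensity_def)
    also have "\<dots> = exp \<epsilon> * (v n * v n')" unfolding v_def exp_add[symmetric] by simp
    finally show ?thesis using False by simp
  qed
  have vsum: "(\<Sum>n\<in>?T. v n) \<le> exp \<epsilon> * (2 * (\<Sum>k<\<kappa>. exp (- g k)))"
  proof -
    have "(\<Sum>n\<in>?T. v n) = (\<Sum>k<\<kappa>. v (lo N k) + v (hi N k))" by (rule sum_targets[OF \<kappa>])
    also have "\<dots> \<le> (\<Sum>k<\<kappa>. exp \<epsilon> * exp (- g k) + exp \<epsilon> * exp (- g k))"
    proof (intro sum_mono add_mono)
      fix k assume k: "k \<in> {..<\<kappa>}"
      then have "k \<le> N * m" using \<kappa> by auto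
      then show "v (lo N k) \<le> exp \<epsilon> * exp (- g k)" "v (hi N k) \<le> exp \<epsilon> * exp (- g k)"
        using approx[of k] k by (auto simp: v_def intensity_lo intensity_hi simp flip: exp_add)
    qed
    also have "\<dots> = exp \<epsilon> * (2 * (\<Sum>k<\<kappa>. exp (- g k)))"
      by (simp add: sum_distrib_left mult.left_commute)
    finally show ?thesis .
  qed
  have v0: "0 \<le> (\<Sum>n\<in>?T. v n)" by (intro sum_nonneg) (simp add: v_def)
  have ct: "real (card ?T) \<le> 2 * real \<kappa>" using card_targets[of N \<kappa>] by linarith
  have zero: "(\<Sum>n\<in>?T. of_bool (n = 0)) \<le> (1::real)" by (simp add: of_bool_def sum.If_cases)
  \<comment> \<open>Each target has at most two partners of equal absolute value. With the row and
    the column of the target 0, the exceptional pairs number at most \<open>4 * card ?T\<close>,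
    hence \<open>8 * \<kappa>\<close> in the statement.\<close>
  have eqabs: "(\<Sum>n'\<in>?T. of_bool (\<bar>n\<bar> = \<bar>n'\<bar>)) \<le> (2::real)" for n
  proof -
    have "(\<Sum>n'\<in>?T. of_bool (\<bar>n\<bar> = \<bar>n'\<bar>)) = real (card {n'\<in>?T. \<bar>n\<bar> = \<bar>n'\<bar>})"
      by (simp add: of_bool_def sum.If_cases Int_def)
    also have "card {n'\<in>?T. \<bar>n\<bar> = \<bar>n'\<bar>} \<le> card {n, - n}" by (intro card_mono) auto
    also have "card {n, - n} \<le> 2" by (simp add: card_insert_if)
    finally show ?thesis by simp
  qed
  have "subset_exp ?U q (\<lambda>S. (edge_missing N \<kappa> S)\<^sup>2) = (\<Sum>n\<in>?T. \<Sum>n'\<in>?T. P n n')"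
    unfolding edge_missing_def power2_eq_square sum_product P_def subset_exp_sum ..
  also have "\<dots> \<le> (\<Sum>n\<in>?T. \<Sum>n'\<in>?T. exp \<epsilon> * (v n * v n') + (of_bool (\<bar>n\<bar> = \<bar>n'\<bar>) + of_bool (n = 0) + of_bool (n' = 0)))"
    by (intro sum_mono up)
  also have "\<dots> = exp \<epsilon> * (\<Sum>n\<in>?T. v n)\<^sup>2 + (\<Sum>n\<in>?T. (\<Sum>n'\<in>?T. of_bool (\<bar>n\<bar> = \<bar>n'\<bar>)) + of_bool (n = 0) * real (card ?T) + (\<Sum>n'\<in>?T. of_bool (n' = 0)))"
    unfolding power2_eq_square sum_product by (simp add: sum.distrib sum_distrib_left mult_ac)
  also have "\<dots> \<le> exp \<epsilon> * (exp \<epsilon> * (2 * (\<Sum>k<\<kappa>. exp (- g k))))\<^sup>2 + (\<Sum>n\<in>?T. 2 + of_bool (n = 0) * real (card ?T) + 1)"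
    using vsum v0 by (intro add_mono mult_left_mono power_mono sum_mono eqabs zero) auto
  also have "(\<Sum>n\<in>?T. 2 + of_bool (n = 0) * real (card ?T) + 1) = 3 * real (card ?T) + (\<Sum>n\<in>?T. of_bool (n = 0)) * real (card ?T)"
    by (simp add: sum.distrib sum_distrib_right)
  also have "\<dots> \<le> 3 * real (card ?T) + 1 * real (card ?T)"
    using zero by (intro add_mono mult_right_mono) auto
  \<comment> \<open>One factor \<open>exp \<epsilon>\<close> is the error of the pair bound, the
    other two come from replacing the intensities of both members by \<open>g\<close>.\<close>
  also have "exp \<epsilon> * (exp \<epsilon> * (2 * (\<Sum>k<\<kappa>. exp (- g k))))\<^sup>2 = exp (3 * \<epsilon>) * (2 * (\<Sum>k<\<kappa>. exp (- g k)))\<^sup>2"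
  proof -
    have "exp \<epsilon> * (exp \<epsilon>)\<^sup>2 = exp (3 * \<epsilon>)" by (simp add: power2_eq_square flip: exp_add)
    then show ?thesis by (metis mult.assoc power_mult_distrib)
  qed
  finally show ?thesis using ct by simp
qed

text \<open>Chebyshev around the limit \<open>2 * J * s N\<close> instead of the true mean, so that
  no upper bound for the mean is required. The accuracy \<open>\<eta>\<close> of the approximation
  is fixed while \<open>N\<close> grows and is sent to 0 only at the end.\<close>

lemma edge_missing_concentration:
  fixes p s :: "nat \<Rightarrow> real"
  assumes p: "\<And>N. 0 < p N \<and> p N < 1" and p0: "p \<longlonglongrightarrow> 0"
    and s: "filterlim s at_top sequentially" and ps: "filterlim (\<lambda>N. p N * s N) at_top sequentially"
    and nu: "eventually (\<lambda>N. p N ^ h * s N ^ (h - 1) \<le> \<nu>) sequentially"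
    and T: "T > 0" and G: "continuous_on {0..T} G" "\<And>x. x \<in> {0..T} \<Longrightarrow> 0 \<le> G x"
    and size: "eventually (\<lambda>N. 2 * nat \<lceil>T * s N\<rceil> \<le> N * m + 1) sequentially"
    and unif: "\<And>\<epsilon>. \<epsilon> > 0 \<Longrightarrow> eventually (\<lambda>N. \<forall>k<nat \<lceil>T * s N\<rceil>.
        \<bar>p N ^ h * real (bsol I wt N k) / real \<theta> - G (real k / s N)\<bar> \<le> \<epsilon>) sequentially"
    and \<epsilon>: "\<epsilon> > 0"
  shows "(\<lambda>N. subset_exp {0..int N} (p N) (\<lambda>S. of_bool
     (\<bar>edge_missing N (nat \<lceil>T * s N\<rceil>) S - 2 * integral {0..T} (\<lambda>x. exp (- G x)) * s N\<bar> > \<epsilon> * s N))) \<longlonglongrightarrow> 0"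
proof -
  define \<kappa> where "\<kappa> N = nat \<lceil>T * s N\<rceil>" for N
  define J where "J = integral {0..T} (\<lambda>x. exp (- G x))"
  define R where "R N = (\<Sum>k<\<kappa> N. exp (- G (real k / s N)))" for N
  define c1 where "c1 = real (h ^ (h + 1))"
  define c2 where "c2 = (4 * real ((2 * h) ^ (2 * h + 1)) + 2 * real (h ^ (h + 1)) + 3 * fact h :: real)"
  have c: "c1 \<ge> 0" "c2 \<ge> 0" by (auto simp: c1_def c2_def)
  have Rlim: "(\<lambda>N. R N / s N) \<longlonglongrightarrow> J"
    unfolding R_def J_def \<kappa>_def by (intro riemann_sum_tendsto T s continuous_intros G)
  have \<kappa>lim: "(\<lambda>N. real (\<kappa> N) / s N) \<longlonglongrightarrow> T"
    using riemann_sum_tendsto[of T "\<lambda>_. 1" s] T s by (simp add: \<kappa>_def)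
  have inv: "(\<lambda>N. 1 / s N) \<longlonglongrightarrow> 0"
    using tendsto_inverse_0_at_top[OF s] by (simp add: inverse_eq_divide)
  obtain Gm where Gm: "\<And>x. x \<in> {0..T} \<Longrightarrow> G x \<le> Gm"
  proof -
    have "bounded (G ` {0..T})" by (intro compact_imp_bounded compact_continuous_image G compact_Icc)
    then obtain B where "\<forall>y\<in>G ` {0..T}. norm y \<le> B" unfolding bounded_iff by blast
    then show thesis by (intro that[of B]) force
  qed
  have s1: "eventually (\<lambda>N. s N \<ge> 1) sequentially" using s by (simp add: filterlim_at_top)
  have kin: "real k / s N \<in> {0..T}" if "k < \<kappa> N" "s N \<ge> 1" for k N
  proof -
    have "real k < T * s N" using that unfolding \<kappa>_def by linarith
    then show ?thesis using that by (auto simp: field_simps)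
  qed
  have \<kappa>b: "T * s N \<le> real (\<kappa> N)" "real (\<kappa> N) \<le> T * s N + 1" if "s N \<ge> 1" for N
  proof -
    have "0 < T * s N" using T that by simp
    then have "real (\<kappa> N) = of_int \<lceil>T * s N\<rceil>" by (simp add: \<kappa>_def)
    then show "T * s N \<le> real (\<kappa> N)" "real (\<kappa> N) \<le> T * s N + 1" by linarith+
  qed
  have pM: "filterlim (\<lambda>N. p N * real (2 * \<kappa> N)) at_top sequentially"
  proof (rule filterlim_at_top_mono)
    show "filterlim (\<lambda>N. (2 * T) * (p N * s N)) at_top sequentially"
      using T ps by (intro filterlim_tendsto_pos_mult_at_top[OF tendsto_const]) auto
    show "eventually (\<lambda>N. (2 * T) * (p N * s N) \<le> p N * real (2 * \<kappa> N)) sequentially"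
      using s1
    proof eventually_elim
      case (elim N)
      have "2 * (p N * (T * s N)) \<le> 2 * (p N * real (\<kappa> N))" using p[of N] \<kappa>b(1)[OF elim] by simp
      then show ?case by (simp add: mult_ac)
    qed
  qed
  define \<nu>1 where "\<nu>1 = (max 0 \<nu>) * (2 * T + 2) ^ (h - 1)"
  have \<nu>1: "eventually (\<lambda>N. p N ^ h * real (2 * \<kappa> N) ^ (h - 1) \<le> \<nu>1) sequentially"
    using nu s1
  proof eventually_elim
    case (elim N)
    have "real (2 * \<kappa> N) \<le> (2 * T + 2) * s N" using \<kappa>b(2)[OF elim(2)] elim(2) by (simp add: algebra_simps)
    then have "p N ^ h * real (2 * \<kappa> N) ^ (h - 1) \<le> p N ^ h * ((2 * T + 2) * s N) ^ (h - 1)"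
      using p[of N] by (intro mult_left_mono power_mono) auto
    also have "\<dots> = (p N ^ h * s N ^ (h - 1)) * (2 * T + 2) ^ (h - 1)" by (simp add: power_mult_distrib)
    also have "\<dots> \<le> \<nu>1" unfolding \<nu>1_def using elim T by (intro mult_right_mono) auto
    finally show ?case .
  qed
  have invM: "(\<lambda>N. x / (p N * real (2 * \<kappa> N))) \<longlonglongrightarrow> 0" for x
    by (rule tendsto_divide_0[OF tendsto_const filterlim_at_top_imp_at_infinity[OF pM]])
  have M1: "eventually (\<lambda>N. p N * real (2 * \<kappa> N) \<ge> 1) sequentially" using pM by (simp add: filterlim_at_top)
  have e1: "(\<lambda>N. err1 (p N) (2 * \<kappa> N)) \<longlonglongrightarrow> 0"
  proof (rule tendsto_sandwich[OF _ _ tendsto_const invM[of \<nu>1]])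
    show "eventually (\<lambda>N. 0 \<le> err1 (p N) (2 * \<kappa> N)) sequentially"
      using p by (intro always_eventually allI) (simp add: err1_def less_imp_le)
    show "eventually (\<lambda>N. err1 (p N) (2 * \<kappa> N) \<le> \<nu>1 / (p N * real (2 * \<kappa> N))) sequentially"
      using \<nu>1 M1
    proof eventually_elim
      case (elim N)
      then have "2 * \<kappa> N > 0" by (cases "\<kappa> N") auto
      then show ?case using p[of N] elim unfolding err1_eq[OF \<open>2 * \<kappa> N > 0\<close> conjunct1[OF p]]
        by (intro divide_right_mono) auto
    qed
  qed
  have e2: "(\<lambda>N. err2 (p N) (2 * \<kappa> N)) \<longlonglongrightarrow> 0"
  proof (rule tendsto_sandwich[OF _ _ tendsto_const invM[of "\<nu>1\<^sup>2"]])
    show "eventually (\<lambda>N. 0 \<le> err2 (p N) (2 * \<kappa> N)) sequentially"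
      using p by (intro always_eventually allI) (simp add: err2_def less_imp_le)
    show "eventually (\<lambda>N. err2 (p N) (2 * \<kappa> N) \<le> \<nu>1\<^sup>2 / (p N * real (2 * \<kappa> N))) sequentially"
      using \<nu>1 M1
    proof eventually_elim
      case (elim N)
      then have "2 * \<kappa> N > 0" by (cases "\<kappa> N") auto
      then show ?case using p[of N] elim unfolding err2_eq[OF \<open>2 * \<kappa> N > 0\<close> conjunct1[OF p]]
        by (intro divide_right_mono power_mono) auto
    qed
  qed
  define val where "val N = subset_exp {0..int N} (p N) (\<lambda>S. of_bool (\<bar>edge_missing N (\<kappa> N) S - 2 * J * s N\<bar> > \<epsilon> * s N))" for N
  \<comment> \<open>The resulting bound for the mean square deviation divided by \<open>s N\<close>
    squared, written so that each ingredient has a limit.\<close>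
  define Bd where "Bd \<eta> N = exp (3 * \<eta>) * (2 * (R N / s N))\<^sup>2 + 8 * (real (\<kappa> N) / s N) * (1 / s N)
      - 4 * J * (exp (- (2 * \<eta>)) * (2 * (R N / s N) - 1 / s N)) + 4 * J\<^sup>2" for \<eta> N
  have Jnn: "J \<ge> 0" unfolding J_def by (rule Henstock_Kurzweil_Integration.integral_nonneg) (auto intro!: integrable_continuous_interval continuous_intros G)
  have val_le: "eventually (\<lambda>N. val N \<le> Bd \<eta> N / \<epsilon>\<^sup>2) sequentially" if \<eta>: "\<eta> > 0" for \<eta>
  proof -
    have ev1: "eventually (\<lambda>N. c1 * err1 (p N) (2 * \<kappa> N) < \<eta> / 4) sequentially"
      using tendsto_mult_right_zero[OF e1, of c1] \<eta> by (intro order_tendstoD(2)[of _ 0]) auto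
    have ev2: "eventually (\<lambda>N. c2 * err2 (p N) (2 * \<kappa> N) < \<eta>) sequentially"
      using tendsto_mult_right_zero[OF e2, of c2] \<eta> by (intro order_tendstoD(2)[of _ 0]) auto
    \<comment> \<open>This absorbs the factor \<open>1 + 2 * p N\<close> of the lower bound for the
      mean; it uses that \<open>G\<close> is bounded on the compact interval.\<close>
    have ev3: "eventually (\<lambda>N. 2 * (Gm + 2 * \<eta>) * p N < \<eta> / 4) sequentially"
      using tendsto_mult_right_zero[OF p0, of "2 * (Gm + 2 * \<eta>)"] \<eta> by (intro order_tendstoD(2)[of _ 0]) auto
    have ev4: "eventually (\<lambda>N. p N < 1 / 2) sequentially" using p0 by (rule order_tendstoD) auto
    show ?thesis
      using ev1 ev2 ev3 ev4 s1 M1 size unif[OF \<eta>]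
    proof eventually_elim
      case (elim N)
      define q where "q = p N"
      have q: "0 \<le> q" "q \<le> 1 / 2" "q \<le> 1" "q * real (2 * \<kappa> N) \<ge> 1" using elim p[of N] by (auto simp: q_def)
      have \<kappa>: "2 * \<kappa> N \<le> N * m + 1" using elim by (simp add: \<kappa>_def)
      let ?g = "\<lambda>k. G (real k / s N)"
      have gk: "0 \<le> ?g k" "?g k \<le> Gm" if "k < \<kappa> N" for k using kin[OF that elim(5)] G(2) Gm by auto
      have ap: "\<bar>q ^ h * real (bsol I wt N k) / real \<theta> - ?g k\<bar> \<le> \<eta>" if "k < \<kappa> N" for k
        using elim(8) that by (simp add: q_def \<kappa>_def)
      have mean: "exp (- (2 * \<eta>)) * (2 * R N - 1) \<le> subset_exp {0..int N} q (edge_missing N (\<kappa> N))"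
        unfolding R_def
      proof (rule edge_missing_mean_lower[OF \<kappa> q(1,2,4)])
        fix k assume k: "k < \<kappa> N"
        show "0 \<le> ?g k" by (rule gk(1)[OF k])
        define l where "l = q ^ h * real (bsol I wt N k) / real \<theta>"
        have l: "l \<le> ?g k + \<eta>" using ap[OF k] by (simp add: l_def abs_le_iff)
        define x where "x = l + c1 * err1 q (2 * \<kappa> N)"
        have x: "x \<le> ?g k + \<eta> + \<eta> / 4" "x \<le> Gm + 2 * \<eta>" using l elim(1) gk[OF k] \<eta> by (auto simp: x_def q_def)
        have "2 * q * x \<le> 2 * q * (Gm + 2 * \<eta>)" using q x by (intro mult_left_mono) auto
        also have "\<dots> \<le> \<eta> / 4" using elim(3) by (simp add: q_def mult_ac)
        finally have "(1 + 2 * q) * x \<le> ?g k + 2 * \<eta>" using x(1) \<eta> unfolding distrib_right by linarith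
        then show "(1 + 2 * q) * (q ^ h * real (bsol I wt N k) / real \<theta> + real (h ^ (h + 1)) * err1 q (2 * \<kappa> N)) \<le> ?g k + 2 * \<eta>"
          unfolding x_def l_def c1_def .
      qed
      have second: "subset_exp {0..int N} q (\<lambda>S. (edge_missing N (\<kappa> N) S)\<^sup>2) \<le> exp (3 * \<eta>) * (2 * R N)\<^sup>2 + 8 * real (\<kappa> N)"
        unfolding R_def
      proof (rule edge_missing_second_moment[OF \<kappa> q(1,3,4)])
        show "?g k - \<eta> \<le> q ^ h * real (bsol I wt N k) / real \<theta>" if "k < \<kappa> N" for k
          using ap[OF that] by linarith
        show "(4 * real ((2 * h) ^ (2 * h + 1)) + 2 * real (h ^ (h + 1)) + 3 * fact h) * err2 q (2 * \<kappa> N) \<le> \<eta>"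
          using elim(2) by (simp add: c2_def q_def)
      qed
      let ?t = "s N"
      have t: "?t \<ge> 1" using elim by simp
      have "val N \<le> subset_exp {0..int N} q (\<lambda>S. (edge_missing N (\<kappa> N) S - 2 * J * ?t)\<^sup>2) / (\<epsilon> * ?t)\<^sup>2"
        unfolding val_def q_def[symmetric]
      proof (rule subset_exp_Markov[OF q(1,3)])
        show "(\<epsilon> * ?t)\<^sup>2 > 0" using \<epsilon> t by simp
        fix S assume "\<epsilon> * ?t < \<bar>edge_missing N (\<kappa> N) S - 2 * J * ?t\<bar>"
        then have "(\<epsilon> * ?t)\<^sup>2 \<le> \<bar>edge_missing N (\<kappa> N) S - 2 * J * ?t\<bar>\<^sup>2" using \<epsilon> t by (intro power_mono) auto
        then show "(\<epsilon> * ?t)\<^sup>2 \<le> (edge_missing N (\<kappa> N) S - 2 * J * ?t)\<^sup>2" by simp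
      qed auto
      \<comment> \<open>After expanding the square the mean enters with a negative sign, so the
        lower bound for the mean and the upper bound for the second moment are what is
        needed.\<close>
      also have "subset_exp {0..int N} q (\<lambda>S. (edge_missing N (\<kappa> N) S - 2 * J * ?t)\<^sup>2) =
        subset_exp {0..int N} q (\<lambda>S. (edge_missing N (\<kappa> N) S)\<^sup>2 + (4 * J\<^sup>2 * ?t\<^sup>2 - (4 * J * ?t) * edge_missing N (\<kappa> N) S))"
        by (intro subset_exp_cong) (simp add: power2_eq_square algebra_simps)
      also have "\<dots> = subset_exp {0..int N} q (\<lambda>S. (edge_missing N (\<kappa> N) S)\<^sup>2) + (4 * J\<^sup>2 * ?t\<^sup>2 - (4 * J * ?t) * subset_exp {0..int N} q (edge_missing N (\<kappa> N)))"
        unfolding subset_exp_add subset_exp_diff subset_exp_cmult by simp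
      also have "\<dots> \<le> (exp (3 * \<eta>) * (2 * R N)\<^sup>2 + 8 * real (\<kappa> N)) + (4 * J\<^sup>2 * ?t\<^sup>2 - (4 * J * ?t) * (exp (- (2 * \<eta>)) * (2 * R N - 1)))"
        using second mean Jnn t by (intro add_mono diff_left_mono mult_left_mono) auto
      also have "\<dots> = Bd \<eta> N * ?t\<^sup>2"
        using t unfolding Bd_def by (simp add: field_simps power2_eq_square)
      finally have "val N \<le> Bd \<eta> N * ?t\<^sup>2 / (\<epsilon> * ?t)\<^sup>2"
        using \<epsilon> t by (simp add: divide_right_mono)
      then show ?case using t by (simp add: power_mult_distrib)
    qed
  qed
  have Bdlim: "(\<lambda>N. Bd \<eta> N) \<longlonglongrightarrow> 4 * J\<^sup>2 * (exp (3 * \<eta>) - 2 * exp (- (2 * \<eta>)) + 1)" for \<eta>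
  proof -
    have "(\<lambda>N. Bd \<eta> N) \<longlonglongrightarrow> exp (3 * \<eta>) * (2 * J)\<^sup>2 + 8 * T * 0 - 4 * J * (exp (- (2 * \<eta>)) * (2 * J - 0)) + 4 * J\<^sup>2"
      unfolding Bd_def by (intro tendsto_intros Rlim \<kappa>lim inv)
    then show ?thesis by (simp add: algebra_simps power2_eq_square)
  qed
  have "val \<longlonglongrightarrow> 0"
  proof (rule order_tendstoI)
    fix a :: real assume "a < 0"
    moreover have "val N \<ge> 0" for N unfolding val_def using p[of N] by (intro subset_exp_nonneg) auto
    ultimately show "eventually (\<lambda>N. a < val N) sequentially" by (intro always_eventually allI) (meson less_le_trans)
  next
    fix a :: real assume a: "0 < a"
    \<comment> \<open>The limit of \<open>Bd \<eta>\<close> vanishes at \<open>\<eta> = 0\<close>,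
      because \<open>1 - 2 + 1 = 0\<close>; a small positive \<open>\<eta>\<close> brings it below
      the required bound.\<close>
    have "((\<lambda>\<eta>. 4 * J\<^sup>2 * (exp (3 * \<eta>) - 2 * exp (- (2 * \<eta>)) + 1)) \<longlongrightarrow> 4 * J\<^sup>2 * (exp (3 * 0) - 2 * exp (- (2 * 0)) + 1)) (at_right 0)"
      by (intro tendsto_intros)
    then have "eventually (\<lambda>\<eta>. 4 * J\<^sup>2 * (exp (3 * \<eta>) - 2 * exp (- (2 * \<eta>)) + 1) < a * \<epsilon>\<^sup>2) (at_right (0::real))"
      using a \<epsilon> by (intro order_tendstoD(2)) auto
    then have "eventually (\<lambda>\<eta>. 4 * J\<^sup>2 * (exp (3 * \<eta>) - 2 * exp (- (2 * \<eta>)) + 1) < a * \<epsilon>\<^sup>2 \<and> \<eta> > 0) (at_right (0::real))"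
      by (intro eventually_conj eventually_at_right_less)
    then obtain \<eta> :: real where \<eta>: "4 * J\<^sup>2 * (exp (3 * \<eta>) - 2 * exp (- (2 * \<eta>)) + 1) < a * \<epsilon>\<^sup>2" "\<eta> > 0"
      using eventually_happens by (metis (mono_tags, lifting) trivial_limit_at_right_real)
    have "eventually (\<lambda>N. Bd \<eta> N < a * \<epsilon>\<^sup>2) sequentially" by (rule order_tendstoD(2)[OF Bdlim \<eta>(1)])
    then show "eventually (\<lambda>N. val N < a) sequentially"
      using val_le[OF \<eta>(2)]
    proof eventually_elim
      case (elim N)
      have "Bd \<eta> N / \<epsilon>\<^sup>2 < a" using elim(1) \<epsilon> by (simp add: field_simps)
      then show ?case using elim(2) by simp
    qed
  qed
  then show ?thesis unfolding val_def \<kappa>_def J_def .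
qed

end

subsection \<open>Targets in the bulk\<close>

text \<open>The exponential dominates its compound interest power with exponent
  \<open>2 * j\<close>. This exponent cancels the root and leaves \<open>y\<close> squared, just
  enough for summability.\<close>

lemma exp_neg_root_le:
  fixes b y :: real
  assumes "b > 0" "y > 0" "j > 0"
  shows "exp (- (b * root j y)) \<le> (2 * real j / b) ^ (2 * j) / y\<^sup>2"
proof -
  define r where "r = root j y"
  have r: "r > 0" "r ^ j = y" using assms by (auto simp: r_def)
  have "(b * r / real (2 * j)) ^ (2 * j) \<le> (1 + b * r / real (2 * j)) ^ (2 * j)"
    using assms r by (intro power_mono) auto
  also have "\<dots> \<le> exp (b * r)"
    using assms r by (intro exp_ge_one_plus_x_over_n_power_n) (auto intro: order.trans[of _ 0])
  finally have le: "(b * r / real (2 * j)) ^ (2 * j) \<le> exp (b * r)" .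
  have "0 < (b * r / real (2 * j)) ^ (2 * j)" using assms r by simp
  then have "exp (- (b * r)) \<le> 1 / (b * r / real (2 * j)) ^ (2 * j)"
    unfolding exp_minus inverse_eq_divide using le by (intro divide_left_mono) auto
  also have "\<dots> = (2 * real j / b) ^ (2 * j) / (r ^ j)\<^sup>2"
    by (simp add: power_divide power_mult_distrib power_mult[symmetric] mult.commute)
  finally show ?thesis unfolding r(2) r_def[symmetric] .
qed

text \<open>Comparison with the series of inverse squares. The summation starts at a successor
  because the comparison fails at \<open>k = 0\<close>, where the right-hand term is 0.\<close>

lemma sum_exp_neg_root_bounded:
  fixes b :: real
  assumes "b > 0" "j > 0"
  shows "\<exists>C\<ge>0. \<forall>k0 K. (\<Sum>k\<in>{Suc k0..<K}. exp (- (b * root j (real k)))) \<le> C"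
proof -
  define D where "D = (2 * real j / b) ^ (2 * j)"
  have D: "D \<ge> 0" using assms by (simp add: D_def)
  have sm: "summable (\<lambda>k. D * (1 / (real k)\<^sup>2))"
    using inverse_power_summable[of 2, where 'a = real] by (intro summable_mult) (simp add: inverse_eq_divide)
  have "(\<Sum>k\<in>{Suc k0..<K}. exp (- (b * root j (real k)))) \<le> (\<Sum>k. D * (1 / (real k)\<^sup>2))" for k0 K
  proof -
    have "(\<Sum>k\<in>{Suc k0..<K}. exp (- (b * root j (real k)))) \<le> (\<Sum>k\<in>{Suc k0..<K}. D * (1 / (real k)\<^sup>2))"
      unfolding D_def using exp_neg_root_le[OF assms(1) _ assms(2)] by (intro sum_mono) simp
    also have "\<dots> \<le> (\<Sum>k. D * (1 / (real k)\<^sup>2))" using sm D by (intro sum_le_suminf) auto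
    finally show ?thesis .
  qed
  moreover have "(\<Sum>k. D * (1 / (real k)\<^sup>2)) \<ge> 0" using sm D by (intro suminf_nonneg) auto
  ultimately show ?thesis by blast
qed

text \<open>A geometric series with ratio \<open>exp (- y)\<close>; the factor
  \<open>1 / (1 - exp (- y))\<close> is at most \<open>1 + 1 / y\<close> since
  \<open>1 + y \<le> exp y\<close>.\<close>

lemma sum_exp_tail_le:
  fixes y :: real
  assumes "y > 0"
  shows "(\<Sum>k\<in>{\<kappa>..<K}. exp (- (y * real k))) \<le> exp (- (y * real \<kappa>)) * (1 + 1 / y)"
proof -
  define x where "x = exp (- y)"
  have x: "0 < x" "x < 1" using assms by (auto simp: x_def)
  have eq: "exp (- (y * real k)) = x ^ k" for k
    unfolding x_def by (simp add: exp_of_nat_mult[symmetric] mult.commute)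
  have "(\<Sum>k\<in>{\<kappa>..<K}. x ^ k) \<le> x ^ \<kappa> / (1 - x)"
  proof -
    have "(1 - x) * (\<Sum>k\<in>{\<kappa>..<K}. x ^ k) \<le> x ^ \<kappa>"
    proof (induction K)
      case (Suc K)
      show ?case
      proof (cases "\<kappa> \<le> K")
        case True
        have "(1 - x) * (\<Sum>k\<in>{\<kappa>..<n}. x ^ k) = x ^ \<kappa> - x ^ n" if "\<kappa> \<le> n" for n
          using that
        proof (induction n rule: dec_induct)
          case (step n)
          have "(1 - x) * (\<Sum>k\<in>{\<kappa>..<Suc n}. x ^ k) = (1 - x) * (\<Sum>k\<in>{\<kappa>..<n}. x ^ k) + (1 - x) * x ^ n"
            using step.hyps by (simp add: distrib_left)
          then show ?case unfolding step.IH by (simp add: algebra_simps)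
        qed simp
        from this[of "Suc K"] True show ?thesis using x by (simp del: sum.op_ivl_Suc)
      qed (use x in auto)
    qed (use x in auto)
    then show ?thesis using x by (simp add: field_simps)
  qed
  also have "\<dots> \<le> x ^ \<kappa> * (1 + 1 / y)"
  proof -
    have "1 + y \<le> exp y" by (rule exp_ge_add_one_self)
    then have "x \<le> 1 / (1 + y)" unfolding x_def using assms by (simp add: exp_minus field_simps)
    then have "y / (1 + y) \<le> 1 - x" using assms by (simp add: field_simps)
    then have "1 / (1 - x) \<le> 1 / (y / (1 + y))" using assms x by (intro divide_left_mono mult_pos_pos) auto
    also have "\<dots> = 1 + 1 / y" using assms by (simp add: field_simps)
    finally have "x ^ \<kappa> * (1 / (1 - x)) \<le> x ^ \<kappa> * (1 + 1 / y)" using x by (intro mult_left_mono) auto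
    then show ?thesis by simp
  qed
  finally show ?thesis unfolding eq .
qed

text \<open>Substituting \<open>x ^ j / C\<close> for the variable in Euler's integral for
  \<open>Gamma (1 / j)\<close> gives the integral over the half line. Dominated convergence, with
  the integrand itself as majorant, gives the limit of the truncated integrals.\<close>

lemma Gamma_stretched_exponential:
  fixes C :: real and j :: nat
  assumes "C > 0" "j > 0"
  defines "J \<equiv> Gamma (1 / real j) * root j C / real j"
  shows "(\<lambda>n. integral {0..real n} (\<lambda>x. exp (- (x ^ j / C)))) \<longlonglongrightarrow> J"
proof -
  define H where "H x = exp (- (x ^ j / C))" for x :: real
  define e where "e = 1 / real j"
  have e: "e > 0" using assms by (simp add: e_def)
  define f where "f t = t powr (e - 1) / exp t" for t :: real
  define g where "g x = x ^ j / C" for x :: real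
  define g' where "g' x = real j * x ^ (j - 1) / C" for x :: real
  \<comment> \<open>Euler's integral is available on the closed half line, the substitution is made
    on the open one, where the powers can be split; the endpoint has measure 0.\<close>
  have spike: "(k has_integral i) {0..} \<longleftrightarrow> (k has_integral i) {0<..}" for k :: "real \<Rightarrow> real" and i
    by (rule has_integral_spike_set_eq; rule negligible_subset[of "{0}"]) auto
  have "(f has_integral Gamma e) {0..}" unfolding f_def by (rule Gamma_integral_real[OF e])
  then have fi: "(f has_integral Gamma e) {0<..}"
    unfolding spike .
  then have "f integrable_on {0<..}" by auto
  then have fa: "f absolutely_integrable_on {0<..}"
    by (rule nonnegative_absolutely_integrable_1) (simp add: f_def)
  have img: "g ` {0<..} = {0<..}"
  proof (intro equalityI subsetI)
    fix y :: real assume y: "y \<in> {0<..}"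
    have "g (root j (C * y)) = y" using assms y by (simp add: g_def)
    moreover have "root j (C * y) \<in> {0<..}" using assms y by simp
    ultimately show "y \<in> g ` {0<..}" by (metis image_eqI)
  qed (use assms in \<open>auto simp: g_def\<close>)
  have inj: "inj_on g {0<..}"
  proof (rule inj_onI)
    fix x y :: real assume "x \<in> {0<..}" "y \<in> {0<..}" "g x = g y"
    then show "x = y" using assms power_eq_imp_eq_base[of x j y] by (simp add: g_def)
  qed
  have "(\<lambda>x. \<bar>g' x\<bar> * f (g x)) absolutely_integrable_on {0<..} \<and>
      integral {0<..} (\<lambda>x. \<bar>g' x\<bar> * f (g x)) = Gamma e"
  proof (rule iffD2[OF has_absolute_integral_change_of_variables_1'[where g = g and S = "{0<..}"]])
    show "(g has_field_derivative g' x) (at x within {0<..})" for x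
      unfolding g_def g'_def using assms by (auto intro!: derivative_eq_intros)
    show "f absolutely_integrable_on g ` {0<..} \<and> integral (g ` {0<..}) f = Gamma e"
      unfolding img using fa fi by auto
  qed (use inj in auto)
  then have "((\<lambda>x. \<bar>g' x\<bar> * f (g x)) has_integral Gamma e) {0<..}"
    by (metis has_integral_integral set_lebesgue_integral_eq_integral(1))
  moreover have "\<bar>g' x\<bar> * f (g x) = (real j / root j C) * H x" if x: "x \<in> {0<..}" for x
  proof -
    have "root j C = C powr e" using assms by (simp add: root_powr_inverse e_def)
    moreover have "g x powr (e - 1) = x powr (1 - real j) * C powr (1 - e)"
    proof -
      have "g x powr (e - 1) = (x powr real j) powr (e - 1) / C powr (e - 1)"
        using x assms by (simp add: g_def powr_divide powr_realpow)
      also have "(x powr real j) powr (e - 1) = x powr (1 - real j)"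
        using assms by (simp add: powr_powr e_def algebra_simps)
      also have "1 / C powr (e - 1) = C powr (1 - e)" by (simp add: powr_minus_divide[symmetric])
      then have "x powr (1 - real j) / C powr (e - 1) = x powr (1 - real j) * C powr (1 - e)"
        by (metis divide_inverse inverse_eq_divide)
      finally show ?thesis .
    qed
    moreover have "x ^ (j - 1) = x powr (real j - 1)"
      using x assms by (simp add: powr_realpow[symmetric] of_nat_diff)
    moreover have "x powr (real j - 1) * x powr (1 - real j) = 1" using x by (simp add: powr_add[symmetric])
    moreover have "C powr (1 - e) / C = 1 / C powr e" using assms by (simp add: powr_diff)
    ultimately show ?thesis using x assms unfolding g'_def f_def H_def
      by (simp add: g_def exp_minus field_simps)
  qed
  ultimately have "((\<lambda>x. (real j / root j C) * H x) has_integral Gamma e) {0<..}"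
    by (rule has_integral_eq[rotated])
  then have "((\<lambda>x. (root j C / real j) * ((real j / root j C) * H x)) has_integral (root j C / real j) * Gamma e) {0<..}"
    by (rule has_integral_mult_right)
  then have "(H has_integral J) {0<..}" using assms by (simp add: J_def e_def mult.commute)
  then have HJ: "(H has_integral J) {0..}"
    unfolding spike .
  define F where "F n x = (if x \<in> {0..real n} then H x else 0)" for n x
  have "(\<lambda>n. integral {0..} (F n)) \<longlonglongrightarrow> integral {0..} H"
  proof (rule dominated_convergence(2)[where h = H])
    show "H integrable_on {0..}" using HJ by auto
    have "H integrable_on {0..real n}" for n
      unfolding H_def using assms by (intro integrable_continuous_interval continuous_intros) auto
    then show "F n integrable_on {0..}" for n
      unfolding F_def by (subst integrable_restrict_Int) (simp add: Int_absorb2 inf.absorb1 subset_eq)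
    show "norm (F n x) \<le> H x" if "x \<in> {0..}" for n x by (simp add: F_def H_def)
    show "(\<lambda>n. F n x) \<longlonglongrightarrow> H x" if "x \<in> {0..}" for x
    proof (rule tendsto_eventually)
      have "eventually (\<lambda>n. n \<ge> nat \<lceil>x\<rceil>) sequentially" by (rule eventually_ge_at_top)
      then show "eventually (\<lambda>n. F n x = H x) sequentially"
      proof eventually_elim
        case (elim n)
        then have "x \<le> real n" by linarith
        then show ?case using that by (simp add: F_def)
      qed
    qed
  qed
  moreover have "integral {0..} (F n) = integral {0..real n} H" for n
    unfolding F_def by (subst integral_restrict_Int) (simp add: Int_absorb2 inf.absorb1 subset_eq)
  moreover have "integral {0..} H = J" using HJ by (rule integral_unique)
  ultimately show ?thesis by (simp add: H_def[abs_def])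
qed

context primitive_form
begin

text \<open>Janson's inequality is applied with density \<open>min p (root (h - 1) (\<gamma> / k ^ (h - 2)))\<close>, for which the
  correction term is at most half of the main term.\<close>

lemma missed_tail_prob:
  "\<exists>a>0. \<exists>b>0. \<exists>k0>0. \<forall>N k p n. k0 \<le> k \<longrightarrow> 2 * k \<le> N * m \<longrightarrow> 0 < p \<longrightarrow> p < 1 \<longrightarrow> 1 \<le> p * real k \<longrightarrow>
     n = lo N k \<or> n = hi N k \<longrightarrow> n \<noteq> 0 \<longrightarrow>
     subset_exp {0..int N} p (\<lambda>S. of_bool (missed S n)) \<le>
       exp (- (a * (p ^ h * real k ^ (h - 1)))) + exp (- (b * root (h - 1) (real k)))"
proof -
  obtain c0 k1 where c0: "c0 > 0" and k1: "\<And>N k. k1 \<le> k \<Longrightarrow> 2 * k \<le> N * m \<Longrightarrow> c0 * real k ^ (h - 1) \<le> real (bsol I wt N k)"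
    using wts.bsol_lower unfolding wts_n by blast
  define c where "c = c0 / (2 * fact h)"
  define C2 where "C2 = 4 * real ((2 * h) ^ (2 * h + 1))"
  \<comment> \<open>Solves the balance \<open>C2 * 4 ^ (2 * h - 3) * \<gamma> = c / 2\<close>, so
    that the correction takes at most half of the main term. The powers of 4 come from
    \<open>M \<le> 4 * k\<close>.\<close>
  define \<gamma> where "\<gamma> = c / (2 * C2 * 4 ^ (2 * h - 3))"
  define H1 where "H1 = real (h ^ (h + 1)) * 4 ^ (h - 2)"
  have c: "c > 0" using c0 by (simp add: c_def)
  have C2: "C2 > 0" using h2 by (simp add: C2_def)
  have \<gamma>: "\<gamma> > 0" using c C2 by (simp add: \<gamma>_def)
  \<comment> \<open>The thresholds serve the lower bound for \<open>bsol\<close>, the claim that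
    noninjective solutions take at most half of that bound, and \<open>1 \<le> \<gamma> * k\<close>,
    which keeps \<open>q * k \<ge> 1\<close> after the density has been lowered.\<close>
  define k0 where "k0 = max (max 1 k1) (max (nat \<lceil>2 * H1 / c0\<rceil>) (nat \<lceil>1 / \<gamma>\<rceil>))"
  define a where "a = c / 2"
  define b where "b = c / 2 * (\<gamma> * root (h - 1) \<gamma>)"
  have h1: "h - 1 > 0" using h2 by simp
  have ab: "a > 0" "b > 0" using c \<gamma> h1 by (auto simp: a_def b_def)
  have "subset_exp {0..int N} p (\<lambda>S. of_bool (missed S n)) \<le>
       exp (- (a * (p ^ h * real k ^ (h - 1)))) + exp (- (b * root (h - 1) (real k)))"
    if k: "k0 \<le> k" "2 * k \<le> N * m" and p: "0 < p" "p < 1" "1 \<le> p * real k"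
      and n: "n = lo N k \<or> n = hi N k" "n \<noteq> 0" for N k p n
  proof -
    have kk: "k \<ge> 1" "k1 \<le> k" "2 * H1 \<le> c0 * real k" "1 \<le> \<gamma> * real k"
    proof -
      have "real k \<ge> 2 * H1 / c0" "real k \<ge> 1 / \<gamma>" using k(1) unfolding k0_def by linarith+
      then show "2 * H1 \<le> c0 * real k" "1 \<le> \<gamma> * real k" using c0 \<gamma> by (auto simp: field_simps)
      show "k \<ge> 1" "k1 \<le> k" using k(1) by (auto simp: k0_def)
    qed
    define V where "V = window N (Suc k)"
    define M where "M = 2 * Suc k"
    have M: "card V \<le> M" "M \<ge> 1" "real M \<le> 4 * real k" "real k \<le> real M"
      using card_window[of N "Suc k"] kk by (auto simp: V_def M_def)
    have finV: "finite V" "V \<subseteq> {0..int N}"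
      using window_subset finite_subset[OF window_subset] by (auto simp: V_def)
    have "n \<in> targets N (Suc k)" using n(1) by (auto simp: targets_def)
    then have tup: "tuples {0..int N} n \<subseteq> tuples V n" unfolding V_def by (rule targets_window)
    then have tupeq: "tuples V n = tuples {0..int N} n" using finV by (auto simp: tuples_def)
    have "k \<le> N * m" using k(2) by simp
    then have cardt: "card (tuples V n) = bsol I wt N k"
      unfolding tupeq using n(1) card_tuples_lo[of N k] card_tuples_hi[of k N] by metis
    have supl: "c * real k ^ (h - 1) \<le> real (card (supports V n))"
    proof -
      have eq: "{a \<in> tuples V n. \<not> inj_on a I} \<union> {a \<in> tuples V n. inj_on a I} = tuples V n" by auto
      have "card (tuples V n) \<le> card {a \<in> tuples V n. \<not> inj_on a I} + card {a \<in> tuples V n. inj_on a I}"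
        using card_Un_le[of "{a \<in> tuples V n. \<not> inj_on a I}" "{a \<in> tuples V n. inj_on a I}"] unfolding eq .
      also have "\<dots> \<le> h ^ (h + 1) * M ^ (h - 2) + fact h * card (supports V n)"
        by (intro add_mono card_tuples_noninj card_supports_crude finV n(2) M)
      finally have "real (bsol I wt N k) \<le> real (h ^ (h + 1) * M ^ (h - 2) + fact h * card (supports V n))"
        unfolding cardt by (simp only: of_nat_le_iff)
      then have "real (bsol I wt N k) \<le> real (h ^ (h + 1)) * real M ^ (h - 2) + fact h * real (card (supports V n))" by simp
      moreover have "real (h ^ (h + 1)) * real M ^ (h - 2) \<le> real (h ^ (h + 1)) * (4 * real k) ^ (h - 2)"
        using M by (intro mult_left_mono power_mono) auto
      then have "real (h ^ (h + 1)) * real M ^ (h - 2) \<le> H1 * real k ^ (h - 2)"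
        by (simp add: H1_def power_mult_distrib mult_ac)
      moreover have "H1 * real k ^ (h - 2) \<le> (c0 / 2 * real k) * real k ^ (h - 2)"
        using kk(3) by (intro mult_right_mono) auto
      moreover have "real k ^ (h - 1) = real k * real k ^ (h - 2)"
        using h2 by (cases h; cases "h - 1") auto
      moreover have "c0 * real k ^ (h - 1) \<le> real (bsol I wt N k)" by (rule k1[OF kk(2) k(2)])
      ultimately have "c0 / 2 * real k ^ (h - 1) \<le> fact h * real (card (supports V n))" by (simp add: algebra_simps)
      then show ?thesis by (simp add: c_def field_simps)
    qed
    define q2 where "q2 = root (h - 1) (\<gamma> / real k ^ (h - 2))"
    define q where "q = min p q2"
    have q2: "q2 > 0" "q2 ^ (h - 1) * real k ^ (h - 2) = \<gamma>"
      using \<gamma> kk h1 by (auto simp: q2_def)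
    have hh: "real k ^ (h - 1) = real k * real k ^ (h - 2)" "q2 ^ h = q2 * q2 ^ (h - 1)"
      using h2 by (cases h; cases "h - 1"; auto)+
    \<comment> \<open>At the balanced density the expected number of elements in a window of length
      \<open>k\<close> is itself a root of \<open>k\<close>; this is where the root in the second
      exponential comes from.\<close>
    have q2k: "q2 * real k = root (h - 1) (\<gamma> * real k)"
    proof -
      have "(q2 * real k) ^ (h - 1) = \<gamma> * real k"
        unfolding power_mult_distrib hh using q2(2) by (simp add: mult_ac)
      then show ?thesis using q2(1) h1 real_root_power_cancel[of "h - 1" "q2 * real k"] by simp
    qed
    have q: "0 < q" "q \<le> 1" "q \<le> p" "q \<le> q2" using p q2 by (auto simp: q_def)
    have qk: "1 \<le> q * real k"
    proof -
      have "1 \<le> q2 * real k" unfolding q2k using kk(4) h1 by simp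
      then show ?thesis using p(3) by (simp add: q_def min_def)
    qed
    have qM: "1 \<le> q * real M"
      using qk mult_left_mono[OF M(4), of q] q by linarith
    have err: "C2 * err2 q M \<le> c / 2 * (q ^ h * real k ^ (h - 1))"
    proof -
      obtain j where j: "h = Suc (Suc j)" using h2 by (cases h; cases "h - 1") auto
      have "err2 q M = q ^ (2 * h - 1) * real M ^ (2 * h - 3)"
        using M(2) unfolding err2_def by (simp add: j power_mult_distrib power2_eq_square)
      also have "\<dots> \<le> q ^ (2 * h - 1) * (4 * real k) ^ (2 * h - 3)"
        using M q by (intro mult_left_mono power_mono) auto
      also have "\<dots> = 4 ^ (2 * h - 3) * ((q ^ (h - 1) * real k ^ (h - 2)) * (q ^ h * real k ^ (h - 1)))"
        
      proof -
        have e: "2 * h - 1 = (h - 1) + h" "2 * h - 3 = (h - 2) + (h - 1)" using h2 by auto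
        have "q ^ (2 * h - 1) * real k ^ (2 * h - 3) = (q ^ (h - 1) * real k ^ (h - 2)) * (q ^ h * real k ^ (h - 1))"
          unfolding e power_add by (simp only: mult_ac)
        then show ?thesis unfolding power_mult_distrib mult.left_commute[of _ "4 ^ (2 * h - 3)"] by simp
      qed
      also have "\<dots> \<le> 4 ^ (2 * h - 3) * (\<gamma> * (q ^ h * real k ^ (h - 1)))"
      proof -
        have "q ^ (h - 1) * real k ^ (h - 2) \<le> q2 ^ (h - 1) * real k ^ (h - 2)"
          using q by (intro mult_right_mono power_mono) auto
        then show ?thesis using q q2(2) by (intro mult_left_mono mult_right_mono) auto
      qed
      finally have "C2 * err2 q M \<le> C2 * (4 ^ (2 * h - 3) * (\<gamma> * (q ^ h * real k ^ (h - 1))))"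
        using C2 by (intro mult_left_mono) auto
      also have "\<dots> = c / 2 * (q ^ h * real k ^ (h - 1))" using C2 by (simp add: \<gamma>_def)
      finally show ?thesis .
    qed
    have "subset_exp {0..int N} p (\<lambda>S. of_bool (missed S n)) \<le> subset_exp {0..int N} q (\<lambda>S. of_bool (missed S n))"
    proof (rule subset_exp_antimono_prob)
      show "(of_bool (missed T n) :: real) \<le> of_bool (missed S n)" if "S \<subseteq> T" for S T
        using that by (auto simp: missed_def form_values_def) blast
    qed (use q p in auto)
    also have "\<dots> \<le> subset_exp {0..int N} q (\<lambda>S. of_bool (avoids (supports V n \<union> supports V n) S))"
    proof (intro subset_exp_mono)
      fix S assume "S \<subseteq> {0..int N}"
      then show "(of_bool (missed S n) :: real) \<le> of_bool (avoids (supports V n \<union> supports V n) S)"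
        using missed_iff[OF _ tup finV(2)] by (auto simp: avoids_def)
    qed (use q in auto)
    also have "\<dots> \<le> exp (- (q ^ h * real (card (supports V n \<union> supports V n))) + 4 * real ((2 * h) ^ (2 * h + 1)) * err2 q M)"
      by (intro avoids_upper finV M qM) (use q in auto)
    also have "\<dots> \<le> exp (- (c / 2 * (q ^ h * real k ^ (h - 1))))"
    proof -
      have "q ^ h * (c * real k ^ (h - 1)) \<le> q ^ h * real (card (supports V n))"
        using supl q by (intro mult_left_mono) auto
      then show ?thesis using err unfolding C2_def by (simp add: algebra_simps)
    qed
    \<comment> \<open>Whichever density is the minimum, one of the two exponentials bounds the
      probability; adding both avoids a case distinction in the statement.\<close>
    also have "\<dots> \<le> exp (- (a * (p ^ h * real k ^ (h - 1)))) + exp (- (b * root (h - 1) (real k)))"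
    proof (cases "p \<le> q2")
      case True
      then show ?thesis by (simp add: q_def min_def a_def)
    next
      case False
      then have "q = q2" by (simp add: q_def)
      moreover have "q2 ^ h * real k ^ (h - 1) = \<gamma> * (root (h - 1) \<gamma> * root (h - 1) (real k))"
      proof -
        have "q2 ^ h * real k ^ (h - 1) = (q2 ^ (h - 1) * real k ^ (h - 2)) * (q2 * real k)"
          unfolding hh by (simp add: mult_ac)
        then show ?thesis unfolding q2(2) q2k by (simp add: real_root_mult)
      qed
      ultimately show ?thesis by (simp add: b_def mult_ac)
    qed
    finally show ?thesis .
  qed
  moreover have "k0 > 0" by (simp add: k0_def)
  ultimately show ?thesis using ab by blast
qed

section \<open>Splitting the missing values into those near the ends and those in the bulk\<close>

lemma card_missing:
  assumes "S \<subseteq> {0..int N}"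
  shows "real (card (missing_values h u N S)) = (\<Sum>n\<in>{- (d * int N)..pos_sum h u * int N}. of_bool (missed S n))"
proof -
  have "missing_values h u N S = {n\<in>{- (d * int N)..pos_sum h u * int N}. missed S n}"
    by (auto simp: missing_values_def missed_def)
  then show ?thesis by (simp add: of_bool_def sum.If_cases Int_def)
qed

lemma range_eq: "{- (d * int N)..pos_sum h u * int N} = lo N ` {..N * m}"
proof (intro equalityI subsetI)
  fix n assume n: "n \<in> {- (d * int N)..pos_sum h u * int N}"
  have "n + d * int N \<le> (pos_sum h u + d) * int N" using n by (simp add: distrib_right)
  then have "n + d * int N \<le> int m * int N" by (simp only: sum_wt)
  moreover have "0 \<le> n + d * int N" using n by simp
  ultimately have "nat (n + d * int N) \<le> N * m" by (simp add: nat_le_iff mult.commute)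
  moreover have "n = lo N (nat (n + d * int N))" using n by (simp add: lo_def)
  ultimately show "n \<in> lo N ` {..N * m}" by blast
next
  fix n assume "n \<in> lo N ` {..N * m}"
  then obtain k where k: "k \<le> N * m" "n = lo N k" by auto
  have "int k \<le> int m * int N" using k by (simp flip: of_nat_mult add: mult.commute)
  then have "int k \<le> (pos_sum h u + d) * int N" by (simp only: sum_wt)
  then show "n \<in> {- (d * int N)..pos_sum h u * int N}" using k by (simp add: lo_def distrib_right)
qed

lemma range_cover:
  assumes "n \<in> {- (d * int N)..pos_sum h u * int N}"
  obtains k where "2 * k \<le> N * m" "n = lo N k \<or> n = hi N k"
proof -
  obtain k where k: "k \<le> N * m" "n = lo N k" using assms unfolding range_eq by auto
  show thesis
  proof (cases "2 * k \<le> N * m")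
    case True
    then show thesis using k that by blast
  next
    case False
    have "n = hi N (N * m - k)" using k lo_eq_hi[of N k "N * m - k"] by simp
    then show thesis using False k that[of "N * m - k"] by simp
  qed
qed

lemma targets_subset:
  assumes "2 * \<kappa> \<le> N * m + 1"
  shows "targets N \<kappa> \<subseteq> {- (d * int N)..pos_sum h u * int N}"
proof
  fix n assume "n \<in> targets N \<kappa>"
  then obtain k where k: "k < \<kappa>" "n = lo N k \<or> n = hi N k" by (auto simp: targets_def)
  have "lo N (N * m - k) = hi N k" "k \<le> N * m" using k assms lo_eq_hi[of N "N * m - k" k] by auto
  then show "n \<in> {- (d * int N)..pos_sum h u * int N}" unfolding range_eq
    using k by (metis atMost_iff diff_le_self image_eqI)
qed

definition bulk_missing :: "nat \<Rightarrow> nat \<Rightarrow> int set \<Rightarrow> real" where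
  "bulk_missing N \<kappa> S = (\<Sum>n\<in>{- (d * int N)..pos_sum h u * int N} - targets N \<kappa>. of_bool (missed S n))"

lemma missing_split:
  assumes "S \<subseteq> {0..int N}" "2 * \<kappa> \<le> N * m + 1"
  shows "real (card (missing_values h u N S)) = edge_missing N \<kappa> S + bulk_missing N \<kappa> S"
  unfolding card_missing[OF assms(1)] edge_missing_def bulk_missing_def
  using sum.subset_diff[OF targets_subset[OF assms(2)], of "\<lambda>n. of_bool (missed S n) :: real"] by simp

text \<open>Every value of the range is reached from its nearer end with
  \<open>2 * k \<le> N * m\<close>. The value 0 escapes the tail bound and contributes the summand
  1.\<close>

lemma bulk_missing_mean:
  assumes tail: "\<And>k n. \<kappa> \<le> k \<Longrightarrow> 2 * k \<le> N * m \<Longrightarrow> n = lo N k \<or> n = hi N k \<Longrightarrow> n \<noteq> 0 \<Longrightarrow>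
      subset_exp {0..int N} p (\<lambda>S. of_bool (missed S n)) \<le> f k"
    and f: "\<And>k. 0 \<le> f k" and p: "0 \<le> p" "p \<le> 1"
  shows "subset_exp {0..int N} p (bulk_missing N \<kappa>) \<le> 1 + 2 * (\<Sum>k\<in>{\<kappa>..<Suc (N * m)}. f k)"
proof -
  let ?P = "\<lambda>n. subset_exp {0..int N} p (\<lambda>S. of_bool (missed S n))"
  let ?R = "{- (d * int N)..pos_sum h u * int N} - targets N \<kappa>"
  let ?A = "lo N ` {k\<in>{\<kappa>..<Suc (N * m)}. 2 * k \<le> N * m \<and> lo N k \<noteq> 0}"
  let ?B = "hi N ` {k\<in>{\<kappa>..<Suc (N * m)}. 2 * k \<le> N * m \<and> hi N k \<noteq> 0}"
  have P0: "?P n \<ge> 0" for n using p by (intro subset_exp_nonneg) auto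
  have "?R \<subseteq> insert 0 (?A \<union> ?B)"
  proof
    fix n assume n: "n \<in> ?R"
    then obtain k where k: "2 * k \<le> N * m" "n = lo N k \<or> n = hi N k" using range_cover by blast
    have "\<kappa> \<le> k" using n k(2) by (force simp: targets_def)
    then show "n \<in> insert 0 (?A \<union> ?B)" using k by (cases "n = 0") auto
  qed
  then have "(\<Sum>n\<in>?R. ?P n) \<le> (\<Sum>n\<in>insert 0 (?A \<union> ?B). ?P n)" using P0 by (intro sum_mono2) auto
  also have "\<dots> \<le> ?P 0 + (\<Sum>n\<in>?A \<union> ?B. ?P n)"
    using P0 by (subst sum.insert_if) auto
  also have "(\<Sum>n\<in>?A \<union> ?B. ?P n) \<le> (\<Sum>n\<in>?A. ?P n) + (\<Sum>n\<in>?B. ?P n)"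
    using sum.union_inter[of ?A ?B ?P] sum_nonneg[of "?A \<inter> ?B" ?P] P0 by simp
  also have "(\<Sum>n\<in>?A. ?P n) \<le> (\<Sum>k\<in>{\<kappa>..<Suc (N * m)}. f k)"
  proof -
    have "(\<Sum>n\<in>?A. ?P n) = (\<Sum>k\<in>{k\<in>{\<kappa>..<Suc (N * m)}. 2 * k \<le> N * m \<and> lo N k \<noteq> 0}. ?P (lo N k))"
      by (subst sum.reindex) (auto simp: inj_on_def lo_inj)
    also have "\<dots> \<le> (\<Sum>k\<in>{k\<in>{\<kappa>..<Suc (N * m)}. 2 * k \<le> N * m \<and> lo N k \<noteq> 0}. f k)"
      using tail by (intro sum_mono) auto
    also have "\<dots> \<le> (\<Sum>k\<in>{\<kappa>..<Suc (N * m)}. f k)" using f by (intro sum_mono2) auto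
    finally show ?thesis .
  qed
  also have "(\<Sum>n\<in>?B. ?P n) \<le> (\<Sum>k\<in>{\<kappa>..<Suc (N * m)}. f k)"
  proof -
    have "(\<Sum>n\<in>?B. ?P n) = (\<Sum>k\<in>{k\<in>{\<kappa>..<Suc (N * m)}. 2 * k \<le> N * m \<and> hi N k \<noteq> 0}. ?P (hi N k))"
      by (subst sum.reindex) (auto simp: inj_on_def hi_inj)
    also have "\<dots> \<le> (\<Sum>k\<in>{k\<in>{\<kappa>..<Suc (N * m)}. 2 * k \<le> N * m \<and> hi N k \<noteq> 0}. f k)"
      using tail by (intro sum_mono) auto
    also have "\<dots> \<le> (\<Sum>k\<in>{\<kappa>..<Suc (N * m)}. f k)" using f by (intro sum_mono2) auto
    finally show ?thesis .
  qed
  also have "?P 0 \<le> 1"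
  proof -
    have "?P 0 \<le> subset_exp {0..int N} p (\<lambda>_. 1)" using p by (intro subset_exp_mono) auto
    then show ?thesis by simp
  qed
  finally show ?thesis unfolding bulk_missing_def[abs_def] subset_exp_sum by simp
qed

end

subsection \<open>The critical regime\<close>

text \<open>The relation \<open>concentrates\<close> measures deviations relative to
  \<open>K * s N\<close>. As \<open>K\<close> is positive, deviations relative to \<open>s N\<close>
  are equivalent, with tolerance \<open>\<epsilon>1 * K\<close>.\<close>

lemma concentrates_random_subset:
  fixes p s :: "nat \<Rightarrow> real"
  assumes p: "\<And>N. 0 < p N \<and> p N < 1" and K: "K > 0"
    and conv: "\<And>\<epsilon>. \<epsilon> > 0 \<Longrightarrow> (\<lambda>N. subset_exp {0..int N} (p N) (\<lambda>S. of_bool (\<bar>X N S - K * s N\<bar> > \<epsilon> * s N))) \<longlonglongrightarrow> 0"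
  shows "concentrates (\<lambda>N. random_subset N (p N)) X (\<lambda>N. K * s N)"
  unfolding concentrates_def
proof (intro allI impI)
  fix \<epsilon>1 \<epsilon>2 :: real assume e: "0 < \<epsilon>1" "0 < \<epsilon>2"
  have "eventually (\<lambda>N. subset_exp {0..int N} (p N) (\<lambda>S. of_bool (\<bar>X N S - K * s N\<bar> > (\<epsilon>1 * K) * s N)) < \<epsilon>2) sequentially"
    using conv[of "\<epsilon>1 * K"] e K by (intro order_tendstoD(2)) auto
  then show "eventually (\<lambda>N. measure_pmf.prob (random_subset N (p N))
      {\<omega>. X N \<omega> \<notin> {(1 - \<epsilon>1) * (K * s N)..(1 + \<epsilon>1) * (K * s N)}} < \<epsilon>2) sequentially"
  proof eventually_elim
    case (elim N)
    have "measure_pmf.prob (random_subset N (p N)) {\<omega>. X N \<omega> \<notin> {(1 - \<epsilon>1) * (K * s N)..(1 + \<epsilon>1) * (K * s N)}}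
      = subset_exp {0..int N} (p N) (\<lambda>S. of_bool (X N S \<notin> {(1 - \<epsilon>1) * (K * s N)..(1 + \<epsilon>1) * (K * s N)}))"
      using p[of N] by (intro prob_random_subset) auto
    also have "\<dots> \<le> subset_exp {0..int N} (p N) (\<lambda>S. of_bool (\<bar>X N S - K * s N\<bar> > (\<epsilon>1 * K) * s N))"
      using p[of N] by (intro subset_exp_mono) (auto simp: algebra_simps abs_if)
    finally show ?case using elim by simp
  qed
qed

context weights
begin

lemma dens_continuous: "continuous_on X dens"
  unfolding dens_def by (intro continuous_intros)

text \<open>Positivity is hard to see from the alternating sum. It is inherited from the counts:
  approximate \<open>x\<close> by \<open>k / N\<close> and let \<open>N\<close> grow in
  \<open>bsol_lower\<close> and \<open>bsol_approx\<close>.\<close>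

lemma dens_lower: "\<exists>c>0. \<forall>x. 0 \<le> x \<longrightarrow> x \<le> real W / 2 \<longrightarrow> c * x ^ (n - 1) \<le> dens x"
proof -
  obtain c k0 where c: "c > 0" "\<And>N k. k0 \<le> k \<Longrightarrow> 2 * k \<le> N * W \<Longrightarrow> c * real k ^ (n - 1) \<le> real (bsol I w N k)"
    using bsol_lower by blast
  obtain C where C: "C \<ge> 0" "\<And>N k. N \<ge> 1 \<Longrightarrow> k \<le> N * W \<Longrightarrow>
      \<bar>real (bsol I w N k) - real N ^ (n - 1) * dens (real k / real N)\<bar> \<le> C * real N ^ (n - 2)"
    using bsol_approx by blast
  have "c * x ^ (n - 1) \<le> dens x" if x: "0 \<le> x" "x \<le> real W / 2" for x
  \<comment> \<open>For \<open>x = 0\<close> the approximating indices remain 0 and never reach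
    \<open>k0\<close>, so this case is computed directly.\<close>
  proof (cases "x = 0")
    case True
    have "max 0 (0 - real (\<Sum>i\<in>J. w i)) = 0" for J by (simp del: of_nat_sum)
    moreover have "(0::real) ^ (n - 1) = 0" using n2 by (simp add: power_0_left)
    ultimately have "dens 0 = 0" unfolding dens_def by (simp only: mult_zero_right sum.neutral_const)
    then show ?thesis using True n2 by (simp add: power_0_left)
  next
    case False
    then have x0: "x > 0" using x by simp
    define k where "k N = nat \<lfloor>x * real N\<rfloor>" for N :: nat
    have k: "real (k N) \<le> x * real N" "x * real N < real (k N) + 1" for N
    proof -
      have "0 \<le> x * real N" using x by simp
      then show "real (k N) \<le> x * real N" "x * real N < real (k N) + 1" unfolding k_def by linarith+
    qed
    have lim: "(\<lambda>N. real (k N) / real N) \<longlonglongrightarrow> x"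
    proof (rule tendsto_sandwich)
      show "eventually (\<lambda>N. x - 1 / real N \<le> real (k N) / real N) sequentially"
        using eventually_gt_at_top[of 0]
      proof eventually_elim
        case (elim N)
        then have "x - 1 / real N = (x * real N - 1) / real N" by (simp add: diff_divide_distrib)
        also have "\<dots> \<le> real (k N) / real N" using k(2)[of N] by (intro divide_right_mono) auto
        finally show ?case .
      qed
      show "eventually (\<lambda>N. real (k N) / real N \<le> x) sequentially"
        using eventually_gt_at_top[of 0]
      proof eventually_elim
        case (elim N)
        then show ?case using k(1)[of N] by (simp add: field_simps)
      qed
      show "(\<lambda>N. x - 1 / real N) \<longlonglongrightarrow> x" using tendsto_diff[OF tendsto_const lim_1_over_n, of x] by simp
    qed simp
    have "isCont dens x" using dens_continuous[of UNIV] by (simp add: continuous_on_eq_continuous_at)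
    then have dlim: "(\<lambda>N. dens (real (k N) / real N) + C * (1 / real N)) \<longlonglongrightarrow> dens x + C * 0"
      by (intro tendsto_intros isCont_tendsto_compose[OF _ lim] lim_1_over_n)
    have clim: "(\<lambda>N. c * (real (k N) / real N) ^ (n - 1)) \<longlonglongrightarrow> c * x ^ (n - 1)"
      by (intro tendsto_intros lim)
    have "filterlim (\<lambda>N. x * real N) at_top sequentially"
      using x0 by (intro filterlim_tendsto_pos_mult_at_top[OF tendsto_const _ filterlim_real_sequentially]) auto
    then have "eventually (\<lambda>N. x * real N \<ge> real k0 + 1) sequentially" by (simp add: filterlim_at_top)
    then have "eventually (\<lambda>N. c * (real (k N) / real N) ^ (n - 1) \<le> dens (real (k N) / real N) + C * (1 / real N)) sequentially"
      using eventually_gt_at_top[of 0]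
    proof eventually_elim
      case (elim N)
      have kk: "k0 \<le> k N" using elim(1) k(2)[of N] by linarith
      have "x * real N \<le> real W / 2 * real N" using x by (intro mult_right_mono) auto
      then have "2 * real (k N) \<le> real N * real W" using k(1)[of N] by (simp add: mult.commute)
      then have "real (2 * k N) \<le> real (N * W)" by simp
      then have k2: "2 * k N \<le> N * W" by (simp only: of_nat_le_iff)
      have P: "real N ^ (n - 1) = real N * real N ^ (n - 2)" using n2 by (cases n; cases "n - 1") auto
      have "c * real (k N) ^ (n - 1) \<le> real N ^ (n - 1) * dens (real (k N) / real N) + C * real N ^ (n - 2)"
        using c(2)[OF kk k2] C(2)[of N "k N"] k2 elim by simp
      also have "\<dots> = real N ^ (n - 1) * (dens (real (k N) / real N) + C * (1 / real N))"
        using elim unfolding P by (simp add: field_simps)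
      finally show ?case using elim by (simp add: power_divide field_simps)
    qed
    then show ?thesis using tendsto_le[OF _ dlim clim] by simp
  qed
  then show ?thesis using c(1) by blast
qed

end

context primitive_form
begin

lemma card_form_values:
  assumes "S \<subseteq> {0..int N}"
  shows "real (card (form_values h u S)) = real m * real N + 1 - real (card (missing_values h u N S))"
proof -
  let ?R = "{- (d * int N)..pos_sum h u * int N}"
  have sub: "form_values h u S \<subseteq> ?R"
  proof
    fix n assume n: "n \<in> form_values h u S"
    then obtain b where "b \<in> I \<rightarrow>\<^sub>E S" "L b = n" unfolding form_values_eq by blast
    then have b: "b \<in> I \<rightarrow>\<^sub>E {0..int N}" "L b = n" using PiE_mono[of I "\<lambda>_. S" "\<lambda>_. {0..int N}"] assms by auto
    let ?k = "\<Sum>i\<in>I. wt i * flip N b i"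
    have "?k \<le> (\<Sum>i\<in>I. wt i * N)" using flip_mem[OF b(1)] by (intro sum_mono mult_left_mono) (auto simp: PiE_iff)
    then have "?k \<le> N * m" by (simp add: wts.W_def sum_distrib_left mult.commute)
    moreover have "n = lo N ?k" using flip_sum[OF b(1)] b(2) by (simp add: lo_def)
    ultimately show "n \<in> ?R" unfolding range_eq by blast
  qed
  have "card ?R = card {..N * m}" unfolding range_eq by (intro card_image) (simp add: inj_on_def lo_inj)
  then have cR: "card ?R = N * m + 1" by simp
  have "card (missing_values h u N S) = card ?R - card (form_values h u S)"
    unfolding missing_values_def using sub by (intro card_Diff_subset) (auto intro: finite_subset)
  moreover have "card (form_values h u S) \<le> card ?R" using sub by (intro card_mono) auto
  ultimately show ?thesis using cR by (simp add: of_nat_diff mult.commute)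
qed

text \<open>When the windows from both ends reach the middle of the range, only the middle value
  itself can be left over.\<close>

lemma critical_bulk_missing:
  assumes "2 * \<kappa> \<ge> N * m"
  shows "bulk_missing N \<kappa> S \<le> 1" "0 \<le> bulk_missing N \<kappa> S"
proof -
  let ?R = "{- (d * int N)..pos_sum h u * int N} - targets N \<kappa>"
  have "?R \<subseteq> {lo N (N * m div 2)}"
  proof
    fix n assume n: "n \<in> ?R"
    then obtain k where k: "2 * k \<le> N * m" "n = lo N k \<or> n = hi N k" using range_cover by blast
    then have "\<not> k < \<kappa>" using n by (auto simp: targets_def)
    then have e: "2 * k = N * m" using k assms by linarith
    then have "lo N k = hi N k" by (simp add: lo_eq_hi mult_2)
    moreover have "k = N * m div 2" using e by linarith
    ultimately show "n \<in> {lo N (N * m div 2)}" using k by auto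
  qed
  then have "card ?R \<le> 1" using card_mono[of "{lo N (N * m div 2)}" ?R] by simp
  moreover have "bulk_missing N \<kappa> S \<le> (\<Sum>n\<in>?R. 1)" unfolding bulk_missing_def by (intro sum_mono) auto
  ultimately show "bulk_missing N \<kappa> S \<le> 1" by simp
  show "0 \<le> bulk_missing N \<kappa> S" unfolding bulk_missing_def by (intro sum_nonneg) auto
qed

text \<open>Here \<open>s N = N\<close> and \<open>T = m / 2\<close>, so the edge targets exhaust
  the range up to one value. The product \<open>p ^ h * N ^ (h - 1)\<close> eventually equals
  \<open>c ^ h\<close>, which turns \<open>bsol_approx\<close> into uniform convergence of the
  intensities.\<close>

lemma critical:
  fixes p :: "nat \<Rightarrow> real"
  assumes p: "\<And>N. 0 < p N \<and> p N < 1" and p0: "p \<longlonglongrightarrow> 0"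
    and Np: "filterlim (\<lambda>N. real N * p N) at_top sequentially"
    and c: "c > 0" and pc: "eventually (\<lambda>N. p N = c * real N powr (- ((real h - 1) / real h))) sequentially"
  defines "J \<equiv> integral {0..real m / 2} (\<lambda>x. exp (- (c ^ h * wts.dens x / real \<theta>)))"
  shows "concentrates (\<lambda>N. random_subset N (p N)) (\<lambda>N A. real (card (form_values h u A))) (\<lambda>N. (real m - 2 * J) * real N)"
    and "concentrates (\<lambda>N. random_subset N (p N)) (\<lambda>N A. real (card (missing_values h u N A))) (\<lambda>N. (2 * J) * real N)"
proof -
  define G where "G x = c ^ h * wts.dens x / real \<theta>" for x
  define T where "T = real m / 2"
  define \<kappa> where "\<kappa> N = nat \<lceil>T * real N\<rceil>" for N :: nat
  have T: "T > 0" using wts.W2 by (simp add: T_def)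
  have th: "real \<theta> > 0" using theta_pos by simp
  obtain c1 where c1: "c1 > 0" "\<And>x. 0 \<le> x \<Longrightarrow> x \<le> T \<Longrightarrow> c1 * x ^ (h - 1) \<le> wts.dens x"
    using wts.dens_lower unfolding T_def wts_n by blast
  have Gc: "continuous_on {0..T} G" unfolding G_def by (intro continuous_intros wts.dens_continuous) (use th in auto)
  have Glow: "c ^ h * (c1 * x ^ (h - 1)) / real \<theta> \<le> G x" if "x \<in> {0..T}" for x
    unfolding G_def using that c c1 th by (intro divide_right_mono mult_left_mono) auto
  have G0: "0 \<le> G x" if "x \<in> {0..T}" for x
  proof -
    have "0 \<le> c ^ h * (c1 * x ^ (h - 1)) / real \<theta>" using that c c1 by auto
    then show ?thesis using Glow[OF that] by linarith
  qed
  have J: "J = integral {0..T} (\<lambda>x. exp (- G x))" by (simp add: J_def G_def T_def)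
  have \<kappa>: "2 * \<kappa> N \<le> N * m + 1" "N * m \<le> 2 * \<kappa> N" for N
  proof -
    have "real (\<kappa> N) = of_int \<lceil>T * real N\<rceil>" using T by (simp add: \<kappa>_def)
    then have "real (\<kappa> N) < T * real N + 1" "T * real N \<le> real (\<kappa> N)" by linarith+
    then have "2 * real (\<kappa> N) < real m * real N + 2" "real m * real N \<le> 2 * real (\<kappa> N)" by (auto simp: T_def)
    then have "real (2 * \<kappa> N) < real (N * m + 2)" "real (N * m) \<le> real (2 * \<kappa> N)" by (auto simp: mult.commute)
    then have "2 * \<kappa> N < N * m + 2" "N * m \<le> 2 * \<kappa> N" by (simp_all only: of_nat_less_iff of_nat_le_iff)
    then show "2 * \<kappa> N \<le> N * m + 1" "N * m \<le> 2 * \<kappa> N" by auto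
  qed
  have php: "eventually (\<lambda>N. p N ^ h * real N ^ (h - 1) = c ^ h) sequentially"
    using pc eventually_gt_at_top[of 0]
  proof eventually_elim
    case (elim N)
    have "(real N powr (- ((real h - 1) / real h))) ^ h = real N powr (- (real h - 1))"
      using elim h2 by (simp add: powr_powr flip: powr_realpow)
    moreover have "real N ^ (h - 1) = real N powr (real h - 1)"
      using elim h2 by (simp add: of_nat_diff flip: powr_realpow)
    ultimately show ?case using elim by (simp add: power_mult_distrib flip: powr_add)
  qed
  have unif: "eventually (\<lambda>N. \<forall>k<nat \<lceil>T * real N\<rceil>.
        \<bar>p N ^ h * real (bsol I wt N k) / real \<theta> - G (real k / real N)\<bar> \<le> \<epsilon>) sequentially" if \<epsilon>: "\<epsilon> > 0" for \<epsilon>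
  proof -
    obtain C where C: "C \<ge> 0" "\<And>N k. N \<ge> 1 \<Longrightarrow> k \<le> N * m \<Longrightarrow>
      \<bar>real (bsol I wt N k) - real N ^ (h - 1) * wts.dens (real k / real N)\<bar> \<le> C * real N ^ (h - 2)"
      using wts.bsol_approx unfolding wts_n by blast
    have "(\<lambda>N. c ^ h * C / real \<theta> * (1 / real N)) \<longlonglongrightarrow> c ^ h * C / real \<theta> * 0"
      by (intro tendsto_intros lim_1_over_n)
    then have "eventually (\<lambda>N. c ^ h * C / real \<theta> * (1 / real N) < \<epsilon>) sequentially"
      using \<epsilon> by (intro order_tendstoD(2)) auto
    then show ?thesis using php eventually_gt_at_top[of 0]
    proof eventually_elim
      case (elim N)
      show ?case
      proof (intro allI impI)
        fix k assume "k < nat \<lceil>T * real N\<rceil>"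
        then have k: "k \<le> N * m" using \<kappa>(1)[of N] by (simp add: \<kappa>_def)
        define B Dn where "B = real (bsol I wt N k)" and "Dn = wts.dens (real k / real N)"
        have P: "real N ^ (h - 1) = real N * real N ^ (h - 2)" using h2 by (cases h; cases "h - 1") auto
        have "p N ^ h * B / real \<theta> - G (real k / real N) = p N ^ h / real \<theta> * (B - real N ^ (h - 1) * Dn)"
          unfolding G_def Dn_def[symmetric] elim(2)[symmetric] by (simp add: algebra_simps diff_divide_distrib)
        then have "\<bar>p N ^ h * B / real \<theta> - G (real k / real N)\<bar> = p N ^ h / real \<theta> * \<bar>B - real N ^ (h - 1) * Dn\<bar>"
          using p[of N] th by (simp add: abs_mult)
        also have "\<dots> \<le> p N ^ h / real \<theta> * (C * real N ^ (h - 2))"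
          using C(2)[of N k] elim k p[of N] th unfolding B_def Dn_def by (intro mult_left_mono) auto
        also have "\<dots> = c ^ h * C / real \<theta> * (1 / real N)"
          unfolding elim(2)[symmetric] P using elim by simp
        finally show "\<bar>p N ^ h * real (bsol I wt N k) / real \<theta> - G (real k / real N)\<bar> \<le> \<epsilon>"
          using elim(1) by (simp add: B_def)
      qed
    qed
  qed
  have X: "(\<lambda>N. subset_exp {0..int N} (p N) (\<lambda>S. of_bool (\<bar>edge_missing N (\<kappa> N) S - 2 * J * real N\<bar> > \<epsilon> * real N))) \<longlonglongrightarrow> 0" if "\<epsilon> > 0" for \<epsilon>
    unfolding J \<kappa>_def
  proof (rule edge_missing_concentration[OF p p0 filterlim_real_sequentially _ _ T Gc G0 _ unif that])
    show "filterlim (\<lambda>N. p N * real N) at_top sequentially" using Np by (simp add: mult.commute)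
    show "eventually (\<lambda>N. p N ^ h * real N ^ (h - 1) \<le> c ^ h) sequentially"
      using php by eventually_elim simp
    show "eventually (\<lambda>N. 2 * nat \<lceil>T * real N\<rceil> \<le> N * m + 1) sequentially"
      using \<kappa>(1) by (simp add: \<kappa>_def)
  qed auto
  have miss: "(\<lambda>N. subset_exp {0..int N} (p N) (\<lambda>S. of_bool (\<bar>real (card (missing_values h u N S)) - 2 * J * real N\<bar> > \<epsilon> * real N))) \<longlonglongrightarrow> 0"
    and form: "(\<lambda>N. subset_exp {0..int N} (p N) (\<lambda>S. of_bool (\<bar>real (card (form_values h u S)) - (real m - 2 * J) * real N\<bar> > \<epsilon> * real N))) \<longlonglongrightarrow> 0"
    if \<epsilon>: "\<epsilon> > 0" for \<epsilon>
  proof -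
    have ev: "eventually (\<lambda>N. 4 / \<epsilon> \<le> real N) sequentially"
      using filterlim_real_sequentially by (simp add: filterlim_at_top)
    \<comment> \<open>For \<open>N \<ge> 4 / \<epsilon>\<close>, half of
      \<open>\<epsilon> * N\<close> is at least 2: one unit pays for the middle value, the other for
      the \<open>+ 1\<close> in the size of the range, which enters when passing to
      \<open>form_values\<close>.\<close>
    have b: "\<bar>edge_missing N (\<kappa> N) S - 2 * J * real N\<bar> > (\<epsilon> / 2) * real N"
      if N: "4 / \<epsilon> \<le> real N" and S: "S \<subseteq> {0..int N}"
        and big: "\<bar>real (card (missing_values h u N S)) - 2 * J * real N\<bar> > \<epsilon> * real N - 1" for N S
    proof -
      have "4 \<le> \<epsilon> * real N" using N \<epsilon> by (simp add: field_simps)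
      then show ?thesis using big missing_split[OF S \<kappa>(1)] critical_bulk_missing[OF \<kappa>(2), of N S] by linarith
    qed
    show "(\<lambda>N. subset_exp {0..int N} (p N) (\<lambda>S. of_bool (\<bar>real (card (missing_values h u N S)) - 2 * J * real N\<bar> > \<epsilon> * real N))) \<longlonglongrightarrow> 0"
    proof (rule tendsto_sandwich[OF _ _ tendsto_const X[of "\<epsilon> / 2"]])
      show "eventually (\<lambda>N. subset_exp {0..int N} (p N) (\<lambda>S. of_bool (\<bar>real (card (missing_values h u N S)) - 2 * J * real N\<bar> > \<epsilon> * real N)) \<le>
        subset_exp {0..int N} (p N) (\<lambda>S. of_bool (\<bar>edge_missing N (\<kappa> N) S - 2 * J * real N\<bar> > (\<epsilon> / 2) * real N))) sequentially"
        using ev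
      proof eventually_elim
        case (elim N)
        then show ?case using p[of N] b[OF elim] by (intro subset_exp_mono) auto
      qed
    qed (use p \<epsilon> in \<open>auto intro!: always_eventually subset_exp_nonneg simp: less_imp_le\<close>)
    show "(\<lambda>N. subset_exp {0..int N} (p N) (\<lambda>S. of_bool (\<bar>real (card (form_values h u S)) - (real m - 2 * J) * real N\<bar> > \<epsilon> * real N))) \<longlonglongrightarrow> 0"
    proof (rule tendsto_sandwich[OF _ _ tendsto_const X[of "\<epsilon> / 2"]])
      show "eventually (\<lambda>N. subset_exp {0..int N} (p N) (\<lambda>S. of_bool (\<bar>real (card (form_values h u S)) - (real m - 2 * J) * real N\<bar> > \<epsilon> * real N)) \<le>
        subset_exp {0..int N} (p N) (\<lambda>S. of_bool (\<bar>edge_missing N (\<kappa> N) S - 2 * J * real N\<bar> > (\<epsilon> / 2) * real N))) sequentially"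
        using ev
      proof eventually_elim
        case (elim N)
        show ?case
        proof (intro subset_exp_mono)
          fix S assume S: "S \<subseteq> {0..int N}"
          have "\<bar>real (card (missing_values h u N S)) - 2 * J * real N\<bar> > \<epsilon> * real N - 1"
            if "\<bar>real (card (form_values h u S)) - (real m - 2 * J) * real N\<bar> > \<epsilon> * real N"
            using that unfolding card_form_values[OF S] left_diff_distrib by linarith
          then show "(of_bool (\<epsilon> * real N < \<bar>real (card (form_values h u S)) - (real m - 2 * J) * real N\<bar>) :: real) \<le>
            of_bool (\<bar>edge_missing N (\<kappa> N) S - 2 * J * real N\<bar> > (\<epsilon> / 2) * real N)"
            using b[OF elim S] by auto
        qed (use p[of N] in auto)
      qed
    qed (use p \<epsilon> in \<open>auto intro!: always_eventually subset_exp_nonneg simp: less_imp_le\<close>)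
  qed
  have expc: "continuous_on {0..T} (\<lambda>x. exp (- G x))" by (intro continuous_intros Gc)
  \<comment> \<open>\<open>J\<close> lies strictly between 0 and \<open>T\<close>, so both limiting
    constants are positive, as \<open>concentrates_random_subset\<close> demands. The upper
    inequality rests on \<open>G\<close> being positive inside the interval.\<close>
  have "integral {0..T} (\<lambda>x. 0) < J"
    unfolding J using T by (intro integral_less_real expc continuous_intros) auto
  then have Jpos: "2 * J > 0" by simp
  have "J < integral {0..T} (\<lambda>x. 1)"
    unfolding J
  proof (intro integral_less_real expc continuous_intros)
    fix x assume x: "x \<in> {0<..<T}"
    then have "0 < c ^ h * (c1 * x ^ (h - 1)) / real \<theta>" using c c1 th by simp
    then have "0 < G x" using Glow[of x] x by simp
    then show "exp (- G x) < 1" by simp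
  qed (use T in auto)
  then have Jup: "real m - 2 * J > 0" using T by (simp add: T_def)
  show "concentrates (\<lambda>N. random_subset N (p N)) (\<lambda>N A. real (card (form_values h u A))) (\<lambda>N. (real m - 2 * J) * real N)"
    by (intro concentrates_random_subset p Jup form)
  show "concentrates (\<lambda>N. random_subset N (p N)) (\<lambda>N A. real (card (missing_values h u N A))) (\<lambda>N. (2 * J) * real N)"
    by (intro concentrates_random_subset p Jpos miss)
qed

end

subsection \<open>The supercritical regime\<close>

lemma filterlim_powr_at_top: "a > 0 \<Longrightarrow> filterlim (\<lambda>x::real. x powr a) at_top at_top"
proof -
  assume a: "a > 0"
  have "filterlim (\<lambda>x. exp (a * ln x)) at_top (at_top :: real filter)"
    by (intro filterlim_compose[OF exp_at_top] filterlim_tendsto_pos_mult_at_top[OF tendsto_const a] ln_at_top)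
  moreover have "eventually (\<lambda>x::real. exp (a * ln x) = x powr a) at_top"
    using eventually_gt_at_top[of 0] by eventually_elim (simp add: powr_def)
  ultimately show ?thesis by (simp add: filterlim_cong)
qed

context primitive_form
begin

text \<open>The scale \<open>s\<close> makes \<open>p ^ h * s ^ (h - 1)\<close> equal to 1 and is of
  smaller order than \<open>N\<close>. Near the ends the upper bound on the entries is therefore
  vacuous, and the density reduces to the pure power \<open>G\<close>, whose exponential integrates
  to a Gamma value.\<close>

lemma supercritical:
  fixes p :: "nat \<Rightarrow> real"
  assumes p: "\<And>N. 0 < p N \<and> p N < 1" and p0: "p \<longlonglongrightarrow> 0"
    and Np: "filterlim (\<lambda>N. real N * p N) at_top sequentially"
    and small: "(\<lambda>N. real N powr (- ((real h - 1) / real h))) \<in> o(p)"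
  defines "J \<equiv> Gamma (1 / real (h - 1)) * root (h - 1) (fact (h - 1) * real \<theta> * (\<Prod>i\<in>I. real (wt i))) / real (h - 1)"
  shows "concentrates (\<lambda>N. random_subset N (p N)) (\<lambda>N A. real (card (missing_values h u N A)))
     (\<lambda>N. (2 * J) * p N powr (- (real h / (real h - 1))))"
proof -
  define Q where "Q = (\<Prod>i\<in>I. real (wt i))"
  define D where "D = fact (h - 1) * real \<theta> * Q"
  define s where "s N = p N powr (- (real h / (real h - 1)))" for N
  define G where "G x = x ^ (h - 1) / D" for x :: real
  have th: "real \<theta> \<ge> 1" using theta_pos by simp
  have Q: "Q > 0" unfolding Q_def using wts.wpos by (intro prod_pos) auto
  have D: "D > 0" using th Q by (simp add: D_def)
  have AD: "wts.A / real \<theta> = 1 / D" unfolding wts.A_def wts_n D_def Q_def[symmetric] by simp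
  have h1: "h - 1 > 0" "real h - 1 > 0" "real (h - 1) = real h - 1" using h2 by (auto simp: of_nat_diff)
  have Jp: "J > 0" unfolding J_def Q_def[symmetric] D_def[symmetric] using D h1 by (intro divide_pos_pos mult_pos_pos) auto
  have s_pos: "s N > 0" for N using p[of N] by (simp add: s_def)
  have slim: "filterlim s at_top sequentially"
  proof -
    have "filterlim (\<lambda>N. inverse (p N)) at_top sequentially"
      using p p0 by (intro filterlim_inverse_at_top always_eventually) auto
    then have "filterlim (\<lambda>N. inverse (p N) powr (real h / (real h - 1))) at_top sequentially"
      using h1 h2 by (intro filterlim_compose[OF filterlim_powr_at_top]) auto
    moreover have "inverse (p N) powr (real h / (real h - 1)) = s N" for N
      using p[of N] by (simp add: s_def powr_minus inverse_powr)
    ultimately show ?thesis by simp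
  qed
  have phs: "p N ^ h * s N ^ (h - 1) = 1" for N
  proof -
    have "s N ^ (h - 1) = p N powr (- real h)"
      using p[of N] h1 s_pos[of N] by (simp add: s_def powr_powr flip: powr_realpow)
    moreover have "p N ^ h = p N powr real h" using p[of N] by (simp add: powr_realpow)
    ultimately show ?thesis using p[of N] by (simp flip: powr_add)
  qed
  have ps: "filterlim (\<lambda>N. p N * s N) at_top sequentially"
  proof -
    have "p N * s N = s N powr (1 / real h)" for N
    proof -
      have "p N * s N = p N powr (1 - real h / (real h - 1))"
        using p[of N] powr_add[of "p N" 1 "- (real h / (real h - 1))"] by (simp add: s_def)
      also have "1 - real h / (real h - 1) = - (real h / (real h - 1)) * (1 / real h)"
        using h1 h2 by (simp add: field_simps)
      finally show ?thesis by (simp add: s_def powr_powr)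
    qed
    moreover have "filterlim (\<lambda>N. s N powr (1 / real h)) at_top sequentially"
      using h2 by (intro filterlim_compose[OF filterlim_powr_at_top slim]) auto
    ultimately show ?thesis by simp
  qed
  \<comment> \<open>The hypothesis on \<open>p\<close>, raised to the power
    \<open>h / (h - 1)\<close>, says exactly that \<open>s N / N\<close> tends to 0.\<close>
  have sN: "(\<lambda>N. s N / real N) \<longlonglongrightarrow> 0"
  proof -
    have "(\<lambda>N. real N powr (- ((real h - 1) / real h)) / p N) \<longlonglongrightarrow> 0"
      using small by (rule smalloD_tendsto)
    then have "(\<lambda>N. (real N powr (- ((real h - 1) / real h)) / p N) powr (real h / (real h - 1))) \<longlonglongrightarrow> 0 powr (real h / (real h - 1))"
      using p h1 h2 by (intro tendsto_powr' tendsto_const) (auto intro!: always_eventually divide_nonneg_pos)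
    moreover have "eventually (\<lambda>N. (real N powr (- ((real h - 1) / real h)) / p N) powr (real h / (real h - 1)) = s N / real N) sequentially"
      using eventually_gt_at_top[of 0]
    proof eventually_elim
      case (elim N)
      have "(real N powr (- ((real h - 1) / real h)) / p N) powr (real h / (real h - 1)) =
        real N powr (- ((real h - 1) / real h) * (real h / (real h - 1))) / p N powr (real h / (real h - 1))"
        using p[of N] by (simp add: powr_divide powr_powr)
      also have "- ((real h - 1) / real h) * (real h / (real h - 1)) = - 1" using h1(2) h2 by (simp add: divide_simps)
      finally have e: "(real N powr (- ((real h - 1) / real h)) / p N) powr (real h / (real h - 1)) =
        real N powr (- 1) / p N powr (real h / (real h - 1))" .
      have "real N powr (- 1) = 1 / real N" using elim by (simp add: powr_minus_divide)
      moreover have "s N = 1 / p N powr (real h / (real h - 1))" by (simp only: s_def powr_minus_divide)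
      ultimately show ?case unfolding e by simp
    qed
    ultimately show ?thesis using h1 h2 by (simp add: tendsto_cong)
  qed
  have s1: "eventually (\<lambda>N. s N \<ge> 1) sequentially" using slim by (simp add: filterlim_at_top)
  obtain a b k0 where ab: "a > 0" "b > 0" "k0 > (0::nat)"
    and tail: "\<And>N k p n. k0 \<le> k \<Longrightarrow> 2 * k \<le> N * m \<Longrightarrow> 0 < p \<Longrightarrow> p < 1 \<Longrightarrow> 1 \<le> p * real k \<Longrightarrow>
     n = lo N k \<or> n = hi N k \<Longrightarrow> n \<noteq> 0 \<Longrightarrow>
     subset_exp {0..int N} p (\<lambda>S. of_bool (missed S n)) \<le>
       exp (- (a * (p ^ h * real k ^ (h - 1)))) + exp (- (b * root (h - 1) (real k)))"
    using missed_tail_prob by metis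
  obtain C4 where C4: "C4 \<ge> 0" "\<And>k0 K. (\<Sum>k\<in>{Suc k0..<K}. exp (- (b * root (h - 1) (real k)))) \<le> C4"
    using sum_exp_neg_root_bounded[OF ab(2) h1(1)] by blast
  obtain C where C: "C \<ge> 0" "\<And>k. \<bar>real (nsol I wt k) - wts.A * real k ^ (h - 1)\<bar> \<le> C * (real k + 1) ^ (h - 2)"
    using wts.nsol_approx unfolding wts_n by blast
  have Jlim: "(\<lambda>n. integral {0..real n} (\<lambda>x. exp (- G x))) \<longlonglongrightarrow> J"
    unfolding G_def J_def Q_def[symmetric] D_def[symmetric] by (rule Gamma_stretched_exponential[OF D h1(1)])
  have miss: "(\<lambda>N. subset_exp {0..int N} (p N) (\<lambda>S. of_bool (\<bar>real (card (missing_values h u N S)) - 2 * J * s N\<bar> > \<epsilon> * s N))) \<longlonglongrightarrow> 0"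
    if \<epsilon>: "\<epsilon> > 0" for \<epsilon>
  proof (rule order_tendstoI)
    fix y :: real assume "y < 0"
    moreover have "subset_exp {0..int N} (p N) (\<lambda>S. of_bool (\<bar>real (card (missing_values h u N S)) - 2 * J * s N\<bar> > \<epsilon> * s N)) \<ge> 0" for N
      using p[of N] by (intro subset_exp_nonneg) auto
    ultimately show "eventually (\<lambda>N. y < subset_exp {0..int N} (p N) (\<lambda>S. of_bool (\<bar>real (card (missing_values h u N S)) - 2 * J * s N\<bar> > \<epsilon> * s N))) sequentially"
      by (intro always_eventually allI) (meson less_le_trans)
  next
    fix \<delta> :: real assume \<delta>: "0 < \<delta>"
    \<comment> \<open>The cutoff \<open>T\<close> must bring the truncated integral close to
      \<open>J\<close> and make the limit of the Markov bound for the bulk small. It is at least 1,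
      so that bulk indices satisfy \<open>k \<ge> s N\<close>.\<close>
    have "eventually (\<lambda>n. dist (integral {0..real n} (\<lambda>x. exp (- G x))) J < \<epsilon> / 8) sequentially"
      using tendstoD[OF Jlim, of "\<epsilon> / 8"] \<epsilon> by simp
    moreover have "(\<lambda>n. 8 / (a * \<epsilon>) * exp (- a) ^ n) \<longlonglongrightarrow> 8 / (a * \<epsilon>) * 0"
      using ab by (intro tendsto_intros LIMSEQ_power_zero) auto
    then have "eventually (\<lambda>n. 8 / (a * \<epsilon>) * exp (- a) ^ n < \<delta> / 2) sequentially"
      using \<delta> by (intro order_tendstoD(2)) auto
    ultimately have "eventually (\<lambda>n. dist (integral {0..real n} (\<lambda>x. exp (- G x))) J < \<epsilon> / 8 \<and>
        8 / (a * \<epsilon>) * exp (- a) ^ n < \<delta> / 2 \<and> n \<ge> 1) sequentially"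
      using eventually_ge_at_top[of 1] by eventually_elim auto
    then obtain n0 where n0: "dist (integral {0..real n0} (\<lambda>x. exp (- G x))) J < \<epsilon> / 8"
        "8 / (a * \<epsilon>) * exp (- a) ^ n0 < \<delta> / 2" "n0 \<ge> 1"
      by (auto simp: eventually_sequentially)
    define T where "T = real n0"
    define JT where "JT = integral {0..T} (\<lambda>x. exp (- G x))"
    define \<kappa> where "\<kappa> N = nat \<lceil>T * s N\<rceil>" for N
    have T: "T \<ge> 1" using n0 by (simp add: T_def)
    have JT: "\<bar>JT - J\<bar> < \<epsilon> / 8" using n0 by (simp add: JT_def T_def dist_real_def)
    have eaT: "8 / (a * \<epsilon>) * exp (- (a * T)) < \<delta> / 2"
      using n0(2) by (simp add: T_def exp_of_nat_mult[symmetric] mult.commute)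
    have \<kappa>b: "T * s N \<le> real (\<kappa> N)" "real (\<kappa> N) < T * s N + 1" for N
    proof -
      have "0 < T * s N" using T s_pos[of N] by simp
      then have "real (\<kappa> N) = of_int \<lceil>T * s N\<rceil>" by (simp add: \<kappa>_def)
      then show "T * s N \<le> real (\<kappa> N)" "real (\<kappa> N) < T * s N + 1" by linarith+
    qed
    \<comment> \<open>Keeps every index below \<open>N\<close>, where \<open>bsol\<close> coincides
      with \<open>nsol\<close>.\<close>
    have half: "eventually (\<lambda>N. 2 * \<kappa> N \<le> N) sequentially"
    proof -
      have "eventually (\<lambda>N. s N / real N < 1 / (2 * (T + 1))) sequentially"
        using T by (intro order_tendstoD(2)[OF sN]) auto
      then show ?thesis using s1 eventually_gt_at_top[of 0]
      proof eventually_elim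
        case (elim N)
        have "2 * (T + 1) * s N < real N" using elim T by (simp add: field_simps)
        then have "2 * real (\<kappa> N) \<le> real N" using \<kappa>b(2)[of N] elim(2) by (simp add: algebra_simps)
        then have "real (2 * \<kappa> N) \<le> real N" by simp
        then show ?case by (simp only: of_nat_le_iff)
      qed
    qed
    have size: "eventually (\<lambda>N. 2 * \<kappa> N \<le> N * m + 1) sequentially"
      using half
    proof eventually_elim
      case (elim N)
      have "N * 1 \<le> N * m" using wts.W2 by (intro mult_le_mono) auto
      then show ?case using elim by linarith
    qed
    have unif: "eventually (\<lambda>N. \<forall>k<\<kappa> N. \<bar>p N ^ h * real (bsol I wt N k) / real \<theta> - G (real k / s N)\<bar> \<le> e) sequentially"
      if e: "e > 0" for e
    proof -
      have inv: "(\<lambda>N. C * (T + 1) ^ (h - 2) / s N) \<longlonglongrightarrow> 0"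
        by (rule tendsto_divide_0[OF tendsto_const filterlim_at_top_imp_at_infinity[OF slim]])
      have "eventually (\<lambda>N. C * (T + 1) ^ (h - 2) / s N < e) sequentially"
        by (rule order_tendstoD(2)[OF inv e])
      then show ?thesis using half s1
      proof eventually_elim
        case (elim N)
        show ?case
        proof (intro allI impI)
          fix k assume k: "k < \<kappa> N"
          have b: "bsol I wt N k = nsol I wt k" using k elim(2) by (intro wts.bsol_eq_nsol) auto
          have g: "p N ^ h * (wts.A * real k ^ (h - 1)) / real \<theta> = G (real k / s N)"
          proof -
            have "p N ^ h = 1 / s N ^ (h - 1)" using phs[of N] s_pos[of N] by (simp add: field_simps)
            then have "p N ^ h * (wts.A * real k ^ (h - 1)) / real \<theta> = (wts.A / real \<theta>) * (real k / s N) ^ (h - 1)"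
              by (simp add: power_divide)
            then show ?thesis unfolding AD G_def by simp
          qed
          have "p N ^ h * real (bsol I wt N k) / real \<theta> - G (real k / s N) =
            (p N ^ h / real \<theta>) * (real (nsol I wt k) - wts.A * real k ^ (h - 1))"
            unfolding b g[symmetric] by (simp add: right_diff_distrib diff_divide_distrib)
          then have "\<bar>p N ^ h * real (bsol I wt N k) / real \<theta> - G (real k / s N)\<bar> =
            (p N ^ h / real \<theta>) * \<bar>real (nsol I wt k) - wts.A * real k ^ (h - 1)\<bar>"
            using p[of N] by (simp add: abs_mult)
          also have "\<dots> \<le> p N ^ h * (C * (real k + 1) ^ (h - 2))"
          proof (intro mult_mono C(2))
            show "p N ^ h / real \<theta> \<le> p N ^ h" using p[of N] th divide_left_mono[of 1 "real \<theta>" "p N ^ h"] by simp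
          qed (use p[of N] in auto)
          also have "\<dots> \<le> p N ^ h * (C * ((T + 1) * s N) ^ (h - 2))"
          proof -
            have "real k + 1 \<le> real (\<kappa> N)" using k by simp
            then have "real k + 1 \<le> (T + 1) * s N" using \<kappa>b(2)[of N] elim(3) by (simp add: algebra_simps)
            then show ?thesis using C p[of N] by (intro mult_left_mono power_mono) auto
          qed
          also have "\<dots> = C * (T + 1) ^ (h - 2) / s N"
          proof -
            have "s N ^ (h - 1) = s N * s N ^ (h - 2)" using h2 by (cases h; cases "h - 1") auto
            then have "p N ^ h * s N ^ (h - 2) = 1 / s N" using phs[of N] s_pos[of N] by (simp add: field_simps)
            then have "C * (T + 1) ^ (h - 2) * (p N ^ h * s N ^ (h - 2)) = C * (T + 1) ^ (h - 2) * (1 / s N)" by (simp only:)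
            then show ?thesis by (simp add: power_mult_distrib mult_ac)
          qed
          finally show "\<bar>p N ^ h * real (bsol I wt N k) / real \<theta> - G (real k / s N)\<bar> \<le> e" using elim(1) by simp
        qed
      qed
    qed
    have X: "(\<lambda>N. subset_exp {0..int N} (p N) (\<lambda>S. of_bool (\<bar>edge_missing N (\<kappa> N) S - 2 * JT * s N\<bar> > (\<epsilon> / 4) * s N))) \<longlonglongrightarrow> 0"
      unfolding JT_def \<kappa>_def
    proof (rule edge_missing_concentration[OF p p0 slim ps])
      show "continuous_on {0..T} G" unfolding G_def using D by (intro continuous_intros) auto
      show "0 \<le> G x" if "x \<in> {0..T}" for x using that D by (simp add: G_def)
      show "eventually (\<lambda>N. p N ^ h * s N ^ (h - 1) \<le> 1) sequentially" using phs by simp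
      show "eventually (\<lambda>N. 2 * nat \<lceil>T * s N\<rceil> \<le> N * m + 1) sequentially" using size by (simp add: \<kappa>_def)
      show "eventually (\<lambda>N. \<forall>k<nat \<lceil>T * s N\<rceil>. \<bar>p N ^ h * real (bsol I wt N k) / real \<theta> - G (real k / s N)\<bar> \<le> e) sequentially"
        if "e > 0" for e using unif[OF that] by (simp add: \<kappa>_def)
    qed (use T \<epsilon> in auto)
    \<comment> \<open>The Markov bound for the bulk. The geometric tail contributes
      \<open>s N / a\<close>, which is of the same order as the denominator; hence the limit is not
      0 but carries the factor \<open>exp (- (a * T))\<close>.\<close>
    define Y where "Y N = (1 + 2 * (exp (- (a * T)) * (1 + s N / a) + C4)) / (\<epsilon> / 4 * s N)" for N
    have Ylim: "Y \<longlonglongrightarrow> 8 / (a * \<epsilon>) * exp (- (a * T))"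
    proof -
      have inv: "(\<lambda>N. 1 / s N) \<longlonglongrightarrow> 0"
        by (rule tendsto_divide_0[OF tendsto_const filterlim_at_top_imp_at_infinity[OF slim]])
      have "(\<lambda>N. (4 / \<epsilon>) * ((1 + 2 * exp (- (a * T)) + 2 * C4) * (1 / s N) + 2 * exp (- (a * T)) / a)) \<longlonglongrightarrow>
        (4 / \<epsilon>) * ((1 + 2 * exp (- (a * T)) + 2 * C4) * 0 + 2 * exp (- (a * T)) / a)"
        by (intro tendsto_intros inv) (use ab in auto)
      moreover have "Y = (\<lambda>N. (4 / \<epsilon>) * ((1 + 2 * exp (- (a * T)) + 2 * C4) * (1 / s N) + 2 * exp (- (a * T)) / a))"
      proof
        fix N
        show "Y N = (4 / \<epsilon>) * ((1 + 2 * exp (- (a * T)) + 2 * C4) * (1 / s N) + 2 * exp (- (a * T)) / a)"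
          using s_pos[of N] \<epsilon> ab by (simp add: Y_def field_simps)
      qed
      moreover have "(4 / \<epsilon>) * ((1 + 2 * exp (- (a * T)) + 2 * C4) * 0 + 2 * exp (- (a * T)) / a) = 8 / (a * \<epsilon>) * exp (- (a * T))"
        by simp
      ultimately show ?thesis by (simp only:)
    qed
    have "eventually (\<lambda>N. Y N < \<delta> / 2) sequentially" by (rule order_tendstoD(2)[OF Ylim eaT])
    moreover have "eventually (\<lambda>N. subset_exp {0..int N} (p N) (\<lambda>S. of_bool (\<bar>edge_missing N (\<kappa> N) S - 2 * JT * s N\<bar> > (\<epsilon> / 4) * s N)) < \<delta> / 2) sequentially"
      using \<delta> by (intro order_tendstoD(2)[OF X]) auto
    moreover have "eventually (\<lambda>N. p N * s N \<ge> 1) sequentially" using ps by (simp add: filterlim_at_top)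
    moreover have "eventually (\<lambda>N. s N \<ge> real k0) sequentially" using slim by (simp add: filterlim_at_top)
    ultimately show "eventually (\<lambda>N. subset_exp {0..int N} (p N) (\<lambda>S. of_bool (\<bar>real (card (missing_values h u N S)) - 2 * J * s N\<bar> > \<epsilon> * s N)) < \<delta>) sequentially"
      using s1 size
    proof eventually_elim
      case (elim N)
      let ?E = "subset_exp {0..int N} (p N)"
      have p01: "0 \<le> p N" "p N \<le> 1" using p[of N] by auto
      have ks: "s N \<le> real k" if "\<kappa> N \<le> k" for k
      proof -
        have "1 * s N \<le> T * s N" using T s_pos[of N] by (intro mult_right_mono) auto
        then show ?thesis using \<kappa>b(1)[of N] that by linarith
      qed
      define f where "f k = exp (- ((a / s N) * real k)) + exp (- (b * root (h - 1) (real k)))" for k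
      have "?E (bulk_missing N (\<kappa> N)) \<le> 1 + 2 * (\<Sum>k\<in>{\<kappa> N..<Suc (N * m)}. f k)"
      proof (rule bulk_missing_mean[OF _ _ p01])
        show "0 \<le> f k" for k by (simp add: f_def)
        fix k n assume k: "\<kappa> N \<le> k" "2 * k \<le> N * m" "n = lo N k \<or> n = hi N k" "n \<noteq> 0"
        have sk: "s N \<le> real k" by (rule ks[OF k(1)])
        have "1 \<le> p N * real k" using elim(3) mult_left_mono[OF sk p01(1)] by linarith
        moreover have "k0 \<le> k" using elim(4) sk by simp
        ultimately have "?E (\<lambda>S. of_bool (missed S n)) \<le> exp (- (a * (p N ^ h * real k ^ (h - 1)))) + exp (- (b * root (h - 1) (real k)))"
          using p[of N] k by (intro tail) auto
        also have "\<dots> \<le> f k"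
        proof -
          have "p N ^ h = 1 / s N ^ (h - 1)" using phs[of N] s_pos[of N] by (simp add: field_simps)
          then have "p N ^ h * real k ^ (h - 1) = (real k / s N) ^ (h - 1)" by (simp add: power_divide)
          \<comment> \<open>Beyond \<open>s N\<close> the power \<open>h - 1 \<ge> 1\<close> only
            helps, so the exponent may be replaced by a linear one and the tail becomes
            geometric.\<close>
          moreover have "(real k / s N) ^ 1 \<le> (real k / s N) ^ (h - 1)"
            using sk s_pos[of N] h1 by (intro power_increasing) auto
          ultimately have "real k / s N \<le> p N ^ h * real k ^ (h - 1)" by simp
          then have "a * (real k / s N) \<le> a * (p N ^ h * real k ^ (h - 1))" using ab by (intro mult_left_mono) auto
          then show ?thesis by (simp add: f_def)
        qed
        finally show "?E (\<lambda>S. of_bool (missed S n)) \<le> f k" .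
      qed
      also have "(\<Sum>k\<in>{\<kappa> N..<Suc (N * m)}. f k) \<le> exp (- (a * T)) * (1 + s N / a) + C4"
      proof -
        have "(\<Sum>k\<in>{\<kappa> N..<Suc (N * m)}. exp (- ((a / s N) * real k))) \<le> exp (- ((a / s N) * real (\<kappa> N))) * (1 + 1 / (a / s N))"
          using ab s_pos[of N] by (intro sum_exp_tail_le) auto
        also have "\<dots> \<le> exp (- (a * T)) * (1 + s N / a)"
        proof (intro mult_mono)
          have "(a / s N) * (T * s N) \<le> (a / s N) * real (\<kappa> N)"
            using \<kappa>b(1)[of N] ab s_pos[of N] by (intro mult_left_mono) auto
          then show "exp (- ((a / s N) * real (\<kappa> N))) \<le> exp (- (a * T))" using s_pos[of N] by simp
        qed (use ab s_pos[of N] in auto)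
        finally have 1: "(\<Sum>k\<in>{\<kappa> N..<Suc (N * m)}. exp (- ((a / s N) * real k))) \<le> exp (- (a * T)) * (1 + s N / a)" .
        have "0 < T * s N" using T s_pos[of N] by simp
        then have "real (\<kappa> N) > 0" using \<kappa>b(1)[of N] by linarith
        then have "\<kappa> N > 0" by simp
        then have "(\<Sum>k\<in>{\<kappa> N..<Suc (N * m)}. exp (- (b * root (h - 1) (real k)))) \<le> C4"
          using C4(2)[of "\<kappa> N - 1" "Suc (N * m)"] by simp
        then show ?thesis using 1 unfolding f_def sum.distrib by linarith
      qed
      finally have EY: "?E (bulk_missing N (\<kappa> N)) \<le> 1 + 2 * (exp (- (a * T)) * (1 + s N / a) + C4)" by simp
      have Y0: "0 \<le> bulk_missing N \<kappa>' S" for \<kappa>' S unfolding bulk_missing_def by (intro sum_nonneg) auto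
      have "?E (\<lambda>S. of_bool (\<bar>real (card (missing_values h u N S)) - 2 * J * s N\<bar> > \<epsilon> * s N)) \<le>
        ?E (\<lambda>S. of_bool (\<bar>edge_missing N (\<kappa> N) S - 2 * JT * s N\<bar> > (\<epsilon> / 4) * s N) + of_bool (\<epsilon> / 4 * s N \<le> bulk_missing N (\<kappa> N) S))"
      proof (intro subset_exp_mono p01)
        fix S assume S: "S \<subseteq> {0..int N}"
        \<comment> \<open>The tolerance is split into quarters: fluctuation near the ends, missing
          values in the bulk, and the difference between \<open>JT\<close> and \<open>J\<close>,
          which enters twice.\<close>
        have "\<not> \<bar>real (card (missing_values h u N S)) - 2 * J * s N\<bar> > \<epsilon> * s N"
          if "\<not> \<bar>edge_missing N (\<kappa> N) S - 2 * JT * s N\<bar> > (\<epsilon> / 4) * s N" "\<not> \<epsilon> / 4 * s N \<le> bulk_missing N (\<kappa> N) S"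
        proof -
          have "\<bar>(JT - J) * s N\<bar> \<le> \<epsilon> / 8 * s N" using JT s_pos[of N] by (simp add: abs_mult)
          then have "\<bar>JT * s N - J * s N\<bar> \<le> \<epsilon> * s N / 8" by (simp add: left_diff_distrib)
          then have z: "\<bar>2 * JT * s N - 2 * J * s N\<bar> \<le> \<epsilon> * s N / 4" by linarith
          have es: "\<epsilon> * s N > 0" using \<epsilon> s_pos[of N] by simp
          have x: "\<bar>edge_missing N (\<kappa> N) S - 2 * JT * s N\<bar> \<le> \<epsilon> * s N / 4" "bulk_missing N (\<kappa> N) S < \<epsilon> * s N / 4" using that by auto
          then show ?thesis unfolding missing_split[OF S elim(6)] using z es Y0[of "\<kappa> N" S] by linarith
        qed
        then show "(of_bool (\<epsilon> * s N < \<bar>real (card (missing_values h u N S)) - 2 * J * s N\<bar>) :: real) \<le>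
          of_bool (\<epsilon> / 4 * s N < \<bar>edge_missing N (\<kappa> N) S - 2 * JT * s N\<bar>) + of_bool (\<epsilon> / 4 * s N \<le> bulk_missing N (\<kappa> N) S)"
          by (cases "\<epsilon> / 4 * s N < \<bar>edge_missing N (\<kappa> N) S - 2 * JT * s N\<bar>"; cases "\<epsilon> / 4 * s N \<le> bulk_missing N (\<kappa> N) S") simp_all
      qed
      also have "\<dots> = ?E (\<lambda>S. of_bool (\<bar>edge_missing N (\<kappa> N) S - 2 * JT * s N\<bar> > (\<epsilon> / 4) * s N)) + ?E (\<lambda>S. of_bool (\<epsilon> / 4 * s N \<le> bulk_missing N (\<kappa> N) S))"
        by (rule subset_exp_add)
      also have "?E (\<lambda>S. of_bool (\<epsilon> / 4 * s N \<le> bulk_missing N (\<kappa> N) S)) \<le> ?E (bulk_missing N (\<kappa> N)) / (\<epsilon> / 4 * s N)"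
        using \<epsilon> s_pos[of N] Y0 by (intro subset_exp_Markov p01) auto
      also have "\<dots> \<le> Y N" unfolding Y_def using EY \<epsilon> s_pos[of N] by (intro divide_right_mono) auto
      finally show ?case using elim(1,2) by linarith
    qed
  qed
  show ?thesis unfolding s_def[symmetric]
    by (rule concentrates_random_subset[OF p _ miss]) (use Jp in auto)
qed

end

subsection \<open>The subcritical regime\<close>

text \<open>Variance plus squared bias of a binomial variable. The centre \<open>c\<close> is
  arbitrary because inserting an element shifts it by 1 in one branch of the induction.\<close>

lemma subset_exp_card_square:
  assumes "finite V"
  shows "subset_exp V q (\<lambda>S. (real (card S) - c)\<^sup>2) = q * (1 - q) * real (card V) + (q * real (card V) - c)\<^sup>2"
  using assms
proof (induction V arbitrary: c rule: finite_induct)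
  case empty
  then show ?case by simp
next
  case (insert x V)
  have e: "subset_exp V q (\<lambda>S. (real (card (insert x S)) - c)\<^sup>2) = subset_exp V q (\<lambda>S. (real (card S) - (c - 1))\<^sup>2)"
  proof (rule subset_exp_cong)
    fix S assume "S \<subseteq> V"
    then have "card (insert x S) = Suc (card S)"
      using insert.hyps by (intro card_insert_disjoint) (auto intro: finite_subset)
    then show "(real (card (insert x S)) - c)\<^sup>2 = (real (card S) - (c - 1))\<^sup>2" by (simp add: algebra_simps)
  qed
  show ?case unfolding subset_exp_insert[OF insert.hyps] e insert.IH
    using insert.hyps by (simp add: power2_eq_square algebra_simps)
qed

context linear_form
begin

definition "inj_tuples S = {a \<in> I \<rightarrow>\<^sub>E S. inj_on a I}"
definition "equivalent a b \<longleftrightarrow> (\<exists>\<sigma>\<in>syms. \<forall>l\<in>I. b l = a (\<sigma> l))"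
text \<open>Coincidences of values that no symmetry of the coefficients explains. Without them, each
  value of an injective tuple would come from exactly \<open>\<theta>\<close> injective
  tuples.\<close>

definition "collisions S = {(a, b). a \<in> inj_tuples S \<and> b \<in> inj_tuples S \<and> L a = L b \<and> \<not> equivalent a b}"

lemma finite_inj_tuples [simp]: "finite S \<Longrightarrow> finite (inj_tuples S)"
  unfolding inj_tuples_def by (rule finite_PiE_filter) auto

lemma finite_collisions [simp]: "finite S \<Longrightarrow> finite (collisions S)"
  by (rule finite_subset[of _ "inj_tuples S \<times> inj_tuples S"]) (auto simp: collisions_def)

lemma card_noninj:
  assumes "finite S"
  shows "card ((I \<rightarrow>\<^sub>E S) - inj_tuples S) \<le> h ^ (h + 1) * card S ^ (h - 1)"
proof (cases "S = {}")
  case True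
  then have "(I \<rightarrow>\<^sub>E S) - inj_tuples S = {}" using I_nonempty by (auto simp: PiE_iff)
  then show ?thesis by (simp only: card.empty)
next
  case False
  have cS: "card S \<ge> 1" using False assms by (simp add: Suc_le_eq card_gt_0_iff)
  let ?Z = "\<lambda>j. {a \<in> I \<rightarrow>\<^sub>E S. card (a ` I) = j}"
  have finZ: "finite (?Z j)" for j using assms by (intro finite_PiE_filter) auto
  have "(I \<rightarrow>\<^sub>E S) - inj_tuples S \<subseteq> (\<Union>j\<in>{1..<h}. ?Z j)"
  proof
    fix a assume a: "a \<in> (I \<rightarrow>\<^sub>E S) - inj_tuples S"
    then have "card (a ` I) \<noteq> card I" using eq_card_imp_inj_on[of I a] by (auto simp: inj_tuples_def)
    moreover have "card (a ` I) \<le> card I" by (rule card_image_le) simp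
    moreover have "card (a ` I) > 0" using I_nonempty by (simp add: card_gt_0_iff)
    ultimately show "a \<in> (\<Union>j\<in>{1..<h}. ?Z j)" using a by auto
  qed
  then have "card ((I \<rightarrow>\<^sub>E S) - inj_tuples S) \<le> card (\<Union>j\<in>{1..<h}. ?Z j)" using finZ by (intro card_mono) auto
  also have "\<dots> \<le> (\<Sum>j\<in>{1..<h}. card (?Z j))" by (rule card_UN_le) simp
  also have "\<dots> \<le> (\<Sum>j\<in>{1..<h}. h ^ h * card S ^ (h - 1))"
  proof (rule sum_mono)
    fix j assume j: "j \<in> {1..<h}"
    have "card (?Z j) \<le> j ^ card I * card S ^ j"
    proof (rule card_by_pattern[where V = S])
      fix \<pi>
      have "card {v \<in> {..<j} \<rightarrow>\<^sub>E S. inj_on v {..<j} \<and> restrict (v \<circ> \<pi>) I \<in> ?Z j} \<le> card ({..<j} \<rightarrow>\<^sub>E S)"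
        using assms by (intro card_mono finite_PiE) auto
      then show "card {v \<in> {..<j} \<rightarrow>\<^sub>E S. inj_on v {..<j} \<and> restrict (v \<circ> \<pi>) I \<in> ?Z j} \<le> card S ^ j"
        by (simp add: card_PiE)
    qed (use assms in auto)
    also have "\<dots> \<le> h ^ h * card S ^ (h - 1)"
      using j cS by (intro mult_le_mono) (auto intro: power_mono power_increasing)
    finally show "card (?Z j) \<le> h ^ h * card S ^ (h - 1)" .
  qed
  also have "\<dots> \<le> h ^ (h + 1) * card S ^ (h - 1)" by simp
  finally show ?thesis .
qed

text \<open>A value of an injective tuple is taken by all its \<open>\<theta>\<close> rearrangements
  under symmetries, which are distinct. Values taken only by noninjective tuples are bounded by the
  number of such tuples.\<close>

lemma form_values_upper:
  assumes "finite S"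
  shows "\<theta> * card (form_values h u S) \<le> card S ^ h + \<theta> * (h ^ (h + 1) * card S ^ (h - 1))"
proof -
  have fin: "finite (I \<rightarrow>\<^sub>E S)" using assms by (intro finite_PiE) auto
  have sub: "inj_tuples S \<subseteq> I \<rightarrow>\<^sub>E S" by (auto simp: inj_tuples_def)
  have "\<theta> \<le> card {a \<in> inj_tuples S. L a = v}" if v: "v \<in> L ` inj_tuples S" for v
  proof -
    obtain a where a: "a \<in> inj_tuples S" "v = L a" using v by auto
    have at: "a \<in> tuples S v" "inj_on a I" using a by (auto simp: inj_tuples_def tuples_def)
    have "inj_on (\<lambda>\<sigma>. restrict (a \<circ> \<sigma>) I) syms"
      using inj_on_syms_comp[OF at(2)] by (rule inj_on_subset) (auto simp: syms_def)
    then have "\<theta> = card ((\<lambda>\<sigma>. restrict (a \<circ> \<sigma>) I) ` syms)" by (simp only: card_image card_syms)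
    also have "\<dots> \<le> card {a \<in> inj_tuples S. L a = v}"
    proof (intro card_mono image_subsetI)
      show "restrict (a \<circ> \<sigma>) I \<in> {a \<in> inj_tuples S. L a = v}" if "\<sigma> \<in> syms" for \<sigma>
        using comp_sym_mem[OF at that] by (simp add: tuples_def inj_tuples_def del: o_apply)
    qed (use assms in simp)
    finally show ?thesis .
  qed
  then have "(\<Sum>v\<in>L ` inj_tuples S. \<theta>) \<le> (\<Sum>v\<in>L ` inj_tuples S. card {a \<in> inj_tuples S. L a = v})" by (intro sum_mono)
  also have "\<dots> = card (inj_tuples S)" using assms by (intro card_fibers[symmetric]) auto
  also have "\<dots> \<le> card (I \<rightarrow>\<^sub>E S)" by (rule card_mono[OF fin sub])
  also have "\<dots> = card S ^ h" by (simp add: card_PiE)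
  finally have 1: "\<theta> * card (L ` inj_tuples S) \<le> card S ^ h" by (simp add: mult.commute)
  have "I \<rightarrow>\<^sub>E S = inj_tuples S \<union> ((I \<rightarrow>\<^sub>E S) - inj_tuples S)" using sub by auto
  then have "form_values h u S = L ` inj_tuples S \<union> L ` ((I \<rightarrow>\<^sub>E S) - inj_tuples S)"
    unfolding form_values_eq by (metis image_Un)
  then have "card (form_values h u S) \<le> card (L ` inj_tuples S) + card (L ` ((I \<rightarrow>\<^sub>E S) - inj_tuples S))"
    by (simp add: card_Un_le)
  also have "card (L ` ((I \<rightarrow>\<^sub>E S) - inj_tuples S)) \<le> card ((I \<rightarrow>\<^sub>E S) - inj_tuples S)"
    using fin by (intro card_image_le) auto
  also have "\<dots> \<le> h ^ (h + 1) * card S ^ (h - 1)" by (rule card_noninj[OF assms])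
  finally have "\<theta> * card (form_values h u S) \<le> \<theta> * (card (L ` inj_tuples S) + h ^ (h + 1) * card S ^ (h - 1))"
    by simp
  then show ?thesis using 1 unfolding add_mult_distrib2 by linarith
qed

text \<open>For each value fix one injective tuple \<open>a\<close>. Any further injective tuple
  with that value lies in the orbit of \<open>a\<close>, of size at most \<open>\<theta>\<close>, or
  forms a collision with \<open>a\<close>; collisions for different values are different.\<close>

lemma form_values_lower:
  assumes "finite S"
  shows "card S ^ h \<le> \<theta> * card (form_values h u S) + card (collisions S) + h ^ (h + 1) * card S ^ (h - 1)"
proof -
  have fin: "finite (I \<rightarrow>\<^sub>E S)" using assms by (intro finite_PiE) auto
  have sub: "inj_tuples S \<subseteq> I \<rightarrow>\<^sub>E S" by (auto simp: inj_tuples_def)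
  have fib: "card {b \<in> inj_tuples S. L b = v} \<le> \<theta> + card {x \<in> collisions S. L (fst x) = v}" if v: "v \<in> L ` inj_tuples S" for v
  proof -
    obtain a where a: "a \<in> inj_tuples S" "v = L a" using v by auto
    let ?orb = "(\<lambda>\<sigma>. restrict (a \<circ> \<sigma>) I) ` syms" and ?Z = "{b \<in> inj_tuples S. L b = v}"
    have "?Z \<subseteq> ?orb \<union> {b \<in> ?Z. \<not> equivalent a b}"
    proof
      fix b assume b: "b \<in> ?Z"
      show "b \<in> ?orb \<union> {b \<in> ?Z. \<not> equivalent a b}"
      proof (cases "equivalent a b")
        case True
        then obtain \<sigma> where \<sigma>: "\<sigma> \<in> syms" "\<forall>l\<in>I. b l = a (\<sigma> l)" by (auto simp: equivalent_def)
        have "b \<in> extensional I" using b by (auto simp: inj_tuples_def PiE_iff)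
        then have "b = restrict (a \<circ> \<sigma>) I"
          by (rule extensionalityI[OF _ restrict_extensional]) (use \<sigma> in simp)
        then show ?thesis using \<sigma>(1) by blast
      qed (use b in blast)
    qed
    then have "card ?Z \<le> card (?orb \<union> {b \<in> ?Z. \<not> equivalent a b})"
      using assms by (intro card_mono) auto
    also have "\<dots> \<le> card ?orb + card {b \<in> ?Z. \<not> equivalent a b}" by (rule card_Un_le)
    also have "card ?orb \<le> \<theta>" using card_image_le[of syms] card_syms by auto
    also have "card {b \<in> ?Z. \<not> equivalent a b} \<le> card {x \<in> collisions S. L (fst x) = v}"
    proof (rule card_inj_on_le[of "\<lambda>b. (a, b)"])
      show "(\<lambda>b. (a, b)) ` {b \<in> ?Z. \<not> equivalent a b} \<subseteq> {x \<in> collisions S. L (fst x) = v}"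
        using a by (auto simp: collisions_def)
    qed (use assms in \<open>auto simp: inj_on_def\<close>)
    finally show ?thesis by simp
  qed
  have "card (inj_tuples S) = (\<Sum>v\<in>L ` inj_tuples S. card {b \<in> inj_tuples S. L b = v})"
    using assms by (intro card_fibers) auto
  also have "\<dots> \<le> (\<Sum>v\<in>L ` inj_tuples S. \<theta> + card {x \<in> collisions S. L (fst x) = v})" by (intro sum_mono fib)
  also have "\<dots> = \<theta> * card (L ` inj_tuples S) + (\<Sum>v\<in>L ` inj_tuples S. card {x \<in> collisions S. L (fst x) = v})"
    by (simp add: sum.distrib mult.commute)
  also have "(\<Sum>v\<in>L ` inj_tuples S. card {x \<in> collisions S. L (fst x) = v}) = card (collisions S)"
    using assms by (intro card_fibers[symmetric]) (simp, simp, auto simp: collisions_def)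
  also have "card (L ` inj_tuples S) \<le> card (form_values h u S)"
    unfolding form_values_eq using fin sub by (intro card_mono) auto
  finally have 1: "card (inj_tuples S) \<le> \<theta> * card (form_values h u S) + card (collisions S)" by simp
  have "card (I \<rightarrow>\<^sub>E S) = card (inj_tuples S) + card ((I \<rightarrow>\<^sub>E S) - inj_tuples S)"
    using card_mono[OF fin sub] fin sub by (simp add: card_Diff_subset finite_subset)
  moreover have "card (I \<rightarrow>\<^sub>E S) = card S ^ h" by (simp add: card_PiE)
  ultimately show ?thesis using 1 card_noninj[OF assms] by linarith
qed

text \<open>After merging entries the equation \<open>L a = L b\<close> is nontrivial: if all
  coefficients cancelled, each entry of \<open>b\<close> would also occur in \<open>a\<close> with
  the same coefficient, and this matching of positions would be a symmetry.\<close>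

lemma card_collisions_size:
  assumes "finite V"
  shows "card {(a, b). (a, b) \<in> collisions V \<and> card (a ` I \<union> b ` I) = w} \<le> w ^ (2 * h) * card V ^ (w - 1)"
proof -
  let ?P = "{(a, b). (a, b) \<in> collisions V \<and> card (a ` I \<union> b ` I) = w}"
  have "card ?P \<le> w ^ (2 * card I) * card V ^ (w - 1)"
  proof (rule card_pairs_by_pattern[where V = V])
    show "?P \<subseteq> (I \<rightarrow>\<^sub>E V) \<times> (I \<rightarrow>\<^sub>E V)" by (auto simp: collisions_def inj_tuples_def)
    fix p q assume pq: "p \<in> I \<rightarrow> {..<w}" "q \<in> I \<rightarrow> {..<w}"
    let ?A = "{v \<in> {..<w} \<rightarrow>\<^sub>E V. inj_on v {..<w} \<and> (restrict (v \<circ> p) I, restrict (v \<circ> q) I) \<in> ?P}"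
    define e where "e i = (\<Sum>l\<in>{l\<in>I. p l = i}. u l) - (\<Sum>l\<in>{l\<in>I. q l = i}. u l)" for i
    have A: "(\<Sum>i<w. e i * v i) = 0" if "v \<in> ?A" for v
    proof -
      have "L (restrict (v \<circ> p) I) = L (restrict (v \<circ> q) I)" using that unfolding collisions_def by blast
      moreover have "L (restrict (v \<circ> p) I) = (\<Sum>l\<in>I. u l * v (p l))" "L (restrict (v \<circ> q) I) = (\<Sum>l\<in>I. u l * v (q l))"
        unfolding L_def by (auto intro!: sum.cong)
      ultimately show ?thesis
        using sum_pattern[OF finite_I pq(1), of u v] sum_pattern[OF finite_I pq(2), of u v]
        by (simp add: e_def left_diff_distrib sum_subtractf)
    qed
    show "card ?A \<le> card V ^ (w - 1)"
    proof (cases "\<exists>i<w. e i \<noteq> 0")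
      case True
      then obtain i where i: "i < w" "e i \<noteq> 0" by auto
      have "card ?A \<le> card {v \<in> {..<w} \<rightarrow>\<^sub>E V. (\<Sum>i<w. e i * v i) = 0}"
        using A by (intro card_mono finite_PiE_filter assms subsetI) (simp_all del: o_apply)
      also have "\<dots> \<le> card V ^ (card {..<w} - 1)"
        using i assms by (intro card_linear_eq[of _ _ i]) auto
      finally show ?thesis by simp
    next
      case False
      have "v \<notin> ?A" for v
      proof
        assume v: "v \<in> ?A"
        then have ab: "restrict (v \<circ> p) I \<in> inj_tuples V" "restrict (v \<circ> q) I \<in> inj_tuples V"
          "\<not> equivalent (restrict (v \<circ> p) I) (restrict (v \<circ> q) I)"
          unfolding collisions_def by blast+
        have inj: "inj_on p I" "inj_on q I"
        proof -
          have *: "inj_on (restrict (v \<circ> p) I) I" "inj_on (restrict (v \<circ> q) I) I"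
            using ab unfolding inj_tuples_def by blast+
          show "inj_on p I" "inj_on q I"
            by (intro inj_onI; rule inj_onD[OF *(1)] inj_onD[OF *(2)]; simp)+
        qed
        have "\<exists>k\<in>I. p k = q l \<and> u k = u l" if l: "l \<in> I" for l
        proof -
          have "{l'\<in>I. q l' = q l} = {l}" using inj l by (auto simp: inj_on_def)
          then have q: "(\<Sum>l'\<in>{l'\<in>I. q l' = q l}. u l') = u l" by simp
          have "q l < w" using pq l by auto
          then have "e (q l) = 0" using False by blast
          then have p: "(\<Sum>l'\<in>{l'\<in>I. p l' = q l}. u l') = u l" using q by (simp add: e_def)
          have "{l'\<in>I. p l' = q l} \<noteq> {}"
          proof
            assume "{l'\<in>I. p l' = q l} = {}"
            then have "(\<Sum>l'\<in>{l'\<in>I. p l' = q l}. u l') = 0" by (simp only: sum.empty)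
            then show False using p u_nz[OF l] by simp
          qed
          then obtain k where k: "k \<in> I" "p k = q l" by auto
          then have "{l'\<in>I. p l' = q l} = {k}" using inj by (auto simp: inj_on_def)
          then have "u k = u l" using p by simp
          then show ?thesis using k by blast
        qed
        then obtain \<sigma>' where \<sigma>': "\<And>l. l \<in> I \<Longrightarrow> \<sigma>' l \<in> I \<and> p (\<sigma>' l) = q l \<and> u (\<sigma>' l) = u l" by metis
        define \<sigma> where "\<sigma> l = (if l \<in> I then \<sigma>' l else l)" for l
        have "inj_on \<sigma> I"
        proof (rule inj_onI)
          fix l l' assume l: "l \<in> I" "l' \<in> I" "\<sigma> l = \<sigma> l'"
          then have "q l = q l'" using \<sigma>'[of l] \<sigma>'[of l'] by (simp add: \<sigma>_def)
          then show "l = l'" using inj l by (auto simp: inj_on_def)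
        qed
        moreover have "\<sigma> ` I \<subseteq> I" using \<sigma>' by (auto simp: \<sigma>_def)
        ultimately have "bij_betw \<sigma> I I" using endo_inj_surj[OF finite_I] by (auto simp: bij_betw_def)
        then have "\<sigma> permutes I" by (rule bij_imp_permutes) (simp add: \<sigma>_def)
        then have "\<sigma> \<in> syms" using \<sigma>' by (simp add: syms_def \<sigma>_def)
        moreover have "restrict (v \<circ> q) I l = restrict (v \<circ> p) I (\<sigma> l)" if "l \<in> I" for l
          using \<sigma>'[OF that] that by (simp add: \<sigma>_def)
        ultimately have "equivalent (restrict (v \<circ> p) I) (restrict (v \<circ> q) I)"
          unfolding equivalent_def by blast
        then show False using ab(3) by contradiction
      qed
      then have "?A = {}" by blast
      then show ?thesis by (simp only: card.empty)
    qed
  qed (use assms in auto)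
  then show ?thesis by simp
qed

text \<open>Up to \<open>2 * h\<close> distinct entries satisfy one equation, and
  \<open>q * M \<ge> 1\<close> lets the largest number dominate. Relative to the main term
  \<open>(q * M) ^ h\<close> the bound is of order \<open>q ^ h * M ^ (h - 1)\<close>, which
  vanishes exactly below criticality.\<close>

lemma collisions_mean:
  assumes "finite V" "card V = M" "0 \<le> q" "q * real M \<ge> 1"
  shows "subset_exp V q (\<lambda>S. real (card (collisions S))) \<le> real ((2 * h + 1) * (2 * h) ^ (2 * h)) * ((q * real M) ^ (2 * h) / real M)"
proof -
  have M: "M > 0" using assms(4) by (cases M) auto
  let ?U = "\<lambda>x. fst x ` I \<union> snd x ` I"
  have rng: "card (?U x) \<in> {1..2 * h}" if "x \<in> collisions V" for x
  proof -
    have "card (?U x) \<le> card (fst x ` I) + card (snd x ` I)" by (rule card_Un_le)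
    also have "\<dots> \<le> card I + card I" by (intro add_mono card_image_le) auto
    finally have "card (?U x) \<le> 2 * h" by simp
    moreover have "card (?U x) > 0" using I_nonempty by (simp add: card_gt_0_iff)
    ultimately show ?thesis by auto
  qed
  have "real (card (collisions S)) = (\<Sum>x\<in>collisions V. of_bool (?U x \<subseteq> S))" if "S \<subseteq> V" for S
  proof -
    have "collisions S = {x \<in> collisions V. ?U x \<subseteq> S}"
      using that by (auto simp: collisions_def inj_tuples_def PiE_iff)
    then show ?thesis using assms(1) by (simp add: of_bool_def sum.If_cases Int_def)
  qed
  then have "subset_exp V q (\<lambda>S. real (card (collisions S))) = subset_exp V q (\<lambda>S. \<Sum>x\<in>collisions V. of_bool (?U x \<subseteq> S))"
    by (rule subset_exp_cong)
  also have "\<dots> = (\<Sum>x\<in>collisions V. subset_exp V q (\<lambda>S. of_bool (?U x \<subseteq> S)))" by (rule subset_exp_sum)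
  also have "\<dots> = (\<Sum>x\<in>collisions V. q ^ card (?U x))"
  proof (intro sum.cong refl subset_exp_superset assms)
    fix x assume "x \<in> collisions V"
    then show "?U x \<subseteq> V" by (auto simp: collisions_def inj_tuples_def PiE_iff)
  qed
  also have "\<dots> = (\<Sum>w\<in>{1..2 * h}. \<Sum>x\<in>{x\<in>collisions V. card (?U x) = w}. q ^ card (?U x))"
    using rng assms by (intro sum.group[symmetric]) auto
  also have "\<dots> = (\<Sum>w\<in>{1..2 * h}. real (card {x\<in>collisions V. card (?U x) = w}) * q ^ w)"
    by (intro sum.cong refl) simp
  also have "\<dots> \<le> (\<Sum>w\<in>{1..2 * h}. real ((2 * h) ^ (2 * h)) * ((q * real M) ^ (2 * h) / real M))"
  proof (rule sum_mono)
    fix w assume w: "w \<in> {1..2 * h}"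
    have "{x\<in>collisions V. card (?U x) = w} = {(a, b). (a, b) \<in> collisions V \<and> card (a ` I \<union> b ` I) = w}" by auto
    then have "card {x\<in>collisions V. card (?U x) = w} \<le> w ^ (2 * h) * M ^ (w - 1)"
      using card_collisions_size[OF assms(1), of w] assms(2) by simp
    also have "\<dots> \<le> (2 * h) ^ (2 * h) * M ^ (w - 1)" using w by (intro mult_le_mono power_mono) auto
    finally have "real (card {x\<in>collisions V. card (?U x) = w}) \<le> real ((2 * h) ^ (2 * h) * M ^ (w - 1))"
      by (simp only: of_nat_le_iff)
    then have "real (card {x\<in>collisions V. card (?U x) = w}) * q ^ w \<le> real ((2 * h) ^ (2 * h) * M ^ (w - 1)) * q ^ w"
      using assms by (intro mult_right_mono) auto
    also have "\<dots> = real ((2 * h) ^ (2 * h)) * ((q * real M) ^ w / real M)"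
    proof -
      have "real M ^ w = real M ^ (w - 1) * real M" using w by (cases w) auto
      then show ?thesis using M by (simp add: power_mult_distrib)
    qed
    also have "\<dots> \<le> real ((2 * h) ^ (2 * h)) * ((q * real M) ^ (2 * h) / real M)"
      using w assms M by (intro mult_left_mono divide_right_mono power_increasing) auto
    finally show "real (card {x\<in>collisions V. card (?U x) = w}) * q ^ w \<le> real ((2 * h) ^ (2 * h)) * ((q * real M) ^ (2 * h) / real M)" .
  qed
  also have "\<dots> = real (2 * h) * (real ((2 * h) ^ (2 * h)) * ((q * real M) ^ (2 * h) / real M))" by simp
  also have "\<dots> \<le> real (2 * h + 1) * (real ((2 * h) ^ (2 * h)) * ((q * real M) ^ (2 * h) / real M))"
    using assms by (intro mult_right_mono) auto
  finally show ?thesis by (simp only: of_nat_mult mult.assoc)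
qed

text \<open>The deterministic half of the argument. Noninjective tuples, collisions and the
  deviation of \<open>card S ^ h\<close> from \<open>y ^ h\<close> each cost at most a quarter of
  the tolerance; \<open>\<eta> \<le> 1\<close> ensures \<open>card S \<le> 2 * y\<close> for the
  first of these.\<close>

lemma form_values_deviation:
  assumes y: "0 < y" and \<eta>: "\<eta> \<le> 1" "\<And>z. \<bar>z - 1\<bar> \<le> \<eta> \<Longrightarrow> \<bar>z ^ h - 1\<bar> \<le> \<epsilon> / 4"
    and big: "real (h ^ (h + 1)) * 2 ^ (h - 1) \<le> \<epsilon> / 4 * y"
    and S: "finite S" "\<bar>real (card S) - y\<bar> \<le> \<eta> * y" "real (card (collisions S)) \<le> \<epsilon> / 4 * y ^ h"
  shows "\<bar>real (card (form_values h u S)) - (1 / real \<theta>) * y ^ h\<bar> \<le> \<epsilon> * y ^ h"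
proof -
  define t F H K where "t = real (card S)" and "F = real (card (form_values h u S))"
    and "H = real (h ^ (h + 1))" and "K = real (card (collisions S))"
  have th: "real \<theta> \<ge> 1" using theta_pos by simp
  have up: "real \<theta> * F \<le> t ^ h + real \<theta> * (H * t ^ (h - 1))"
  proof -
    have "real (\<theta> * card (form_values h u S)) \<le> real (card S ^ h + \<theta> * (h ^ (h + 1) * card S ^ (h - 1)))"
      using form_values_upper[OF S(1)] by (simp only: of_nat_le_iff)
    then show ?thesis by (simp add: t_def F_def H_def)
  qed
  have low: "t ^ h \<le> real \<theta> * F + K + H * t ^ (h - 1)"
  proof -
    have "real (card S ^ h) \<le> real (\<theta> * card (form_values h u S) + card (collisions S) + h ^ (h + 1) * card S ^ (h - 1))"
      using form_values_lower[OF S(1)] by (simp only: of_nat_le_iff)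
    then show ?thesis by (simp add: t_def F_def H_def K_def)
  qed
  have K0: "K \<ge> 0" "H \<ge> 0" "t \<ge> 0" by (simp_all add: K_def H_def t_def)
  have Ht: "H * t ^ (h - 1) \<le> \<epsilon> / 4 * y ^ h"
  proof -
    have "\<eta> * y \<le> y" using mult_right_mono[OF \<eta>(1), of y] y by simp
    then have "t \<le> 2 * y" using S(2) unfolding t_def by linarith
    then have "H * t ^ (h - 1) \<le> H * (2 * y) ^ (h - 1)" using K0 by (intro mult_left_mono power_mono) auto
    also have "\<dots> = (H * 2 ^ (h - 1)) * y ^ (h - 1)" by (simp add: power_mult_distrib)
    also have "\<dots> \<le> (\<epsilon> / 4 * y) * y ^ (h - 1)" using big y unfolding H_def by (intro mult_right_mono) auto
    also have "\<dots> = \<epsilon> / 4 * y ^ h" using h2 by (cases h) auto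
    finally show ?thesis .
  qed
  have ty: "\<bar>t ^ h - y ^ h\<bar> \<le> \<epsilon> / 4 * y ^ h"
  proof -
    have "\<bar>t / y - 1\<bar> \<le> \<eta>"
    proof -
      have "t / y - 1 = (t - y) / y" using y by (simp add: diff_divide_distrib)
      then show ?thesis using S(2) y unfolding t_def by (simp add: abs_divide pos_divide_le_eq)
    qed
    then have "\<bar>(t / y) ^ h - 1\<bar> \<le> \<epsilon> / 4" by (rule \<eta>(2))
    then have "\<bar>(t / y) ^ h - 1\<bar> * y ^ h \<le> \<epsilon> / 4 * y ^ h" using y by (intro mult_right_mono) auto
    moreover have "\<bar>(t / y) ^ h - 1\<bar> * y ^ h = \<bar>((t / y) ^ h - 1) * y ^ h\<bar>" using y by (simp add: abs_mult)
    moreover have "((t / y) ^ h - 1) * y ^ h = t ^ h - y ^ h" using y by (simp add: power_divide left_diff_distrib)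
    ultimately show ?thesis by simp
  qed
  define E where "E = \<epsilon> * y ^ h"
  have b: "H * t ^ (h - 1) \<le> E / 4" "\<bar>t ^ h - y ^ h\<bar> \<le> E / 4" "K \<le> E / 4"
    using Ht ty S(3) by (simp_all add: E_def K_def)
  have E0: "E \<ge> 0" using b(3) K0 by linarith
  have thE: "E \<le> real \<theta> * E" "real \<theta> * (H * t ^ (h - 1)) \<le> real \<theta> * (E / 4)"
    using mult_right_mono[OF th E0] b(1) th by (auto intro: mult_left_mono)
  have "\<bar>real \<theta> * F - y ^ h\<bar> \<le> real \<theta> * E" 
  proof (rule abs_leI)
    show "real \<theta> * F - y ^ h \<le> real \<theta> * E" using up b thE K0 E0 by linarith
    show "- (real \<theta> * F - y ^ h) \<le> real \<theta> * E" using low b thE K0 E0 by linarith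
  qed
  then have "\<bar>real \<theta> * (F - (1 / real \<theta>) * y ^ h)\<bar> \<le> real \<theta> * E"
    using th by (simp add: right_diff_distrib)
  then have "real \<theta> * \<bar>F - (1 / real \<theta>) * y ^ h\<bar> \<le> real \<theta> * E" using th by (simp add: abs_mult)
  then show ?thesis using th unfolding F_def[symmetric] E_def[symmetric] by simp
qed

text \<open>Chebyshev's inequality controls the size of the random set, and Markov's inequality the
  number of collisions; the rest is \<open>form_values_deviation\<close>.\<close>

lemma subcritical:
  fixes p :: "nat \<Rightarrow> real"
  assumes p: "\<And>N. 0 < p N \<and> p N < 1"
    and Np: "filterlim (\<lambda>N. real N * p N) at_top sequentially"
    and small: "p \<in> o(\<lambda>N. real N powr (- ((real h - 1) / real h)))"
  shows "concentrates (\<lambda>N. random_subset N (p N)) (\<lambda>N A. real (card (form_values h u A)))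
     (\<lambda>N. (1 / real \<theta>) * (real N * p N) ^ h)"
proof (rule concentrates_random_subset[OF p])
  show "0 < 1 / real \<theta>" using theta_pos by simp
  fix \<epsilon> :: real assume \<epsilon>: "\<epsilon> > 0"
  define y where "y N = real N * p N" for N
  have ylim: "filterlim y at_top sequentially" using Np by (simp add: y_def[abs_def])
  have "((\<lambda>z::real. z ^ h) \<longlongrightarrow> 1 ^ h) (at 1)" by (intro tendsto_intros)
  then have "eventually (\<lambda>z::real. dist (z ^ h) (1 ^ h) < \<epsilon> / 4) (at 1)" using \<epsilon> by (intro tendstoD) auto
  then have "\<exists>\<eta>0>0. \<forall>z::real. z \<noteq> 1 \<and> dist z 1 < \<eta>0 \<longrightarrow> dist (z ^ h) (1 ^ h) < \<epsilon> / 4"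
    unfolding eventually_at by simp
  then obtain \<eta>0 where \<eta>0: "\<eta>0 > 0" "\<And>z. z \<noteq> 1 \<Longrightarrow> \<bar>z - 1\<bar> < \<eta>0 \<Longrightarrow> \<bar>z ^ h - 1\<bar> < \<epsilon> / 4"
    by (auto simp: dist_real_def)
  define \<eta> where "\<eta> = min 1 (\<eta>0 / 2)"
  have \<eta>: "0 < \<eta>" "\<eta> \<le> 1" "\<And>z. \<bar>z - 1\<bar> \<le> \<eta> \<Longrightarrow> \<bar>z ^ h - 1\<bar> \<le> \<epsilon> / 4"
  proof -
    show "0 < \<eta>" "\<eta> \<le> 1" using \<eta>0 by (auto simp: \<eta>_def)
    show "\<bar>z ^ h - 1\<bar> \<le> \<epsilon> / 4" if "\<bar>z - 1\<bar> \<le> \<eta>" for z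
      using \<eta>0(2)[of z] \<eta>0(1) that \<epsilon> by (cases "z = 1") (auto simp: \<eta>_def)
  qed
  define C where "C = real ((2 * h + 1) * (2 * h) ^ (2 * h)) * 2 ^ (2 * h)"
  \<comment> \<open>The first summand is Chebyshev's bound for the cardinality, the second Markov's
    bound for the collisions; the smallness hypothesis on \<open>p\<close> is equivalent to the
    second tending to 0.\<close>
  define bound where "bound N = (y N + 2) / (\<eta> * y N)\<^sup>2 + C * (p N ^ h * real N ^ (h - 1)) / (\<epsilon> / 4)" for N
  have lim: "bound \<longlonglongrightarrow> 0"
  proof -
    have inv: "(\<lambda>N. 1 / y N) \<longlonglongrightarrow> 0"
      by (rule tendsto_divide_0[OF tendsto_const filterlim_at_top_imp_at_infinity[OF ylim]])
    have "(\<lambda>N. p N / real N powr (- ((real h - 1) / real h))) \<longlonglongrightarrow> 0" using small by (rule smalloD_tendsto)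
    then have "(\<lambda>N. (p N / real N powr (- ((real h - 1) / real h))) ^ h) \<longlonglongrightarrow> 0 ^ h" by (intro tendsto_intros)
    then have ph: "(\<lambda>N. (p N / real N powr (- ((real h - 1) / real h))) ^ h) \<longlonglongrightarrow> 0" using h2 by (simp add: power_0_left)
    have "(\<lambda>N. (1 / \<eta>\<^sup>2) * (1 / y N + 2 * (1 / y N) ^ 2) + C / (\<epsilon> / 4) * (p N / real N powr (- ((real h - 1) / real h))) ^ h) \<longlonglongrightarrow>
      (1 / \<eta>\<^sup>2) * (0 + 2 * 0 ^ 2) + C / (\<epsilon> / 4) * 0"
      by (intro tendsto_intros inv ph)
    moreover have "eventually (\<lambda>N. (1 / \<eta>\<^sup>2) * (1 / y N + 2 * (1 / y N) ^ 2) + C / (\<epsilon> / 4) * (p N / real N powr (- ((real h - 1) / real h))) ^ h = bound N) sequentially"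
      using eventually_gt_at_top[of 0]
    proof eventually_elim
      case (elim N)
      have yN: "y N > 0" using elim p[of N] by (simp add: y_def)
      have "(real N powr (- ((real h - 1) / real h))) ^ h = real N powr (- (real h - 1))"
        using elim h2 by (simp add: powr_powr flip: powr_realpow)
      moreover have "real N ^ (h - 1) = real N powr (real h - 1)"
        using elim h2 by (simp add: of_nat_diff flip: powr_realpow)
      ultimately have e: "(real N powr (- ((real h - 1) / real h))) ^ h = 1 / real N ^ (h - 1)"
        by (simp only: powr_minus_divide)
      have "(p N / real N powr (- ((real h - 1) / real h))) ^ h = p N ^ h * real N ^ (h - 1)"
        unfolding power_divide e by simp
      moreover have "(1 / \<eta>\<^sup>2) * (1 / y N + 2 * (1 / y N) ^ 2) = (y N + 2) / (\<eta> * y N)\<^sup>2"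
        using yN \<eta>(1) by (simp add: field_simps power2_eq_square)
      ultimately show ?case by (simp add: bound_def)
    qed
    ultimately show ?thesis by (simp add: tendsto_cong)
  qed
  have le: "eventually (\<lambda>N. subset_exp {0..int N} (p N) (\<lambda>S. of_bool (\<bar>real (card (form_values h u S)) - (1 / real \<theta>) * y N ^ h\<bar> > \<epsilon> * y N ^ h)) \<le> bound N) sequentially"
  proof -
    have "eventually (\<lambda>N. y N \<ge> max 1 (4 * (real (h ^ (h + 1)) * 2 ^ (h - 1)) / \<epsilon>)) sequentially"
      using ylim unfolding filterlim_at_top by blast
    then show ?thesis using eventually_gt_at_top[of 0]
    proof eventually_elim
      case (elim N)
      let ?E = "subset_exp {0..int N} (p N)"
      have p01: "0 \<le> p N" "p N \<le> 1" using p[of N] by auto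
      have y1: "y N \<ge> 1" and big: "real (h ^ (h + 1)) * 2 ^ (h - 1) \<le> \<epsilon> / 4 * y N"
        using elim \<epsilon> by (auto simp: field_simps)
      have pN: "p N * real (N + 1) = y N + p N" by (simp add: y_def algebra_simps)
      have cU: "card {0..int N} = N + 1" by simp
      have "?E (\<lambda>S. of_bool (\<bar>real (card (form_values h u S)) - (1 / real \<theta>) * y N ^ h\<bar> > \<epsilon> * y N ^ h)) \<le>
        ?E (\<lambda>S. of_bool (\<bar>real (card S) - y N\<bar> > \<eta> * y N) + of_bool (real (card (collisions S)) \<ge> \<epsilon> / 4 * y N ^ h))"
      proof (intro subset_exp_mono p01)
        fix S assume "S \<subseteq> {0..int N}"
        then have S: "finite S" by (rule finite_subset) simp
        show "(of_bool (\<bar>real (card (form_values h u S)) - (1 / real \<theta>) * y N ^ h\<bar> > \<epsilon> * y N ^ h) :: real) \<le>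
          of_bool (\<bar>real (card S) - y N\<bar> > \<eta> * y N) + of_bool (real (card (collisions S)) \<ge> \<epsilon> / 4 * y N ^ h)"
        proof (cases "\<bar>real (card S) - y N\<bar> > \<eta> * y N \<or> real (card (collisions S)) \<ge> \<epsilon> / 4 * y N ^ h")
          case False
          then have "\<bar>real (card (form_values h u S)) - (1 / real \<theta>) * y N ^ h\<bar> \<le> \<epsilon> * y N ^ h"
            using y1 by (intro form_values_deviation[OF _ \<eta>(2,3) big S]) auto
          then have "\<not> \<bar>real (card (form_values h u S)) - (1 / real \<theta>) * y N ^ h\<bar> > \<epsilon> * y N ^ h" by linarith
          then show ?thesis by (simp only: of_bool_eq) simp
        qed auto
      qed
      also have "\<dots> = ?E (\<lambda>S. of_bool (\<bar>real (card S) - y N\<bar> > \<eta> * y N)) + ?E (\<lambda>S. of_bool (real (card (collisions S)) \<ge> \<epsilon> / 4 * y N ^ h))"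
        by (rule subset_exp_add)
      also have "?E (\<lambda>S. of_bool (\<bar>real (card S) - y N\<bar> > \<eta> * y N)) \<le> ?E (\<lambda>S. (real (card S) - y N)\<^sup>2) / (\<eta> * y N)\<^sup>2"
      proof (rule subset_exp_Markov[OF p01])
        show "0 < (\<eta> * y N)\<^sup>2" using \<eta>(1) y1 by simp
        fix S assume "\<eta> * y N < \<bar>real (card S) - y N\<bar>"
        then have "(\<eta> * y N)\<^sup>2 \<le> \<bar>real (card S) - y N\<bar>\<^sup>2" using \<eta>(1) y1 by (intro power_mono) auto
        then show "(\<eta> * y N)\<^sup>2 \<le> (real (card S) - y N)\<^sup>2" by simp
      qed auto
      \<comment> \<open>There are \<open>N + 1\<close> elements to choose from, so the mean is
        \<open>y N + p N\<close>; the bias \<open>p N\<close> relative to \<open>y N\<close> adds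
        its square to the variance.\<close>
      also have "?E (\<lambda>S. (real (card S) - y N)\<^sup>2) \<le> y N + 2"
      proof -
        have "?E (\<lambda>S. (real (card S) - y N)\<^sup>2) = p N * (1 - p N) * real (N + 1) + (p N)\<^sup>2"
          unfolding subset_exp_card_square[OF finite_atLeastAtMost_int] cU pN by simp
        also have "p N * (1 - p N) * real (N + 1) = (1 - p N) * (y N + p N)" unfolding pN[symmetric] by simp
        also have "(1 - p N) * (y N + p N) + (p N)\<^sup>2 \<le> 1 * (y N + p N) + 1"
          using p01 y1 by (intro add_mono mult_right_mono) (auto simp: power_le_one)
        also have "\<dots> \<le> y N + 2" using p01 by simp
        finally show ?thesis .
      qed
      also have "?E (\<lambda>S. of_bool (real (card (collisions S)) \<ge> \<epsilon> / 4 * y N ^ h)) \<le> ?E (\<lambda>S. real (card (collisions S))) / (\<epsilon> / 4 * y N ^ h)"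
        using \<epsilon> y1 by (intro subset_exp_Markov p01) auto
      also have "?E (\<lambda>S. real (card (collisions S))) \<le> C * (y N ^ (2 * h) / real N)"
      proof -
        have "?E (\<lambda>S. real (card (collisions S))) \<le> real ((2 * h + 1) * (2 * h) ^ (2 * h)) * ((p N * real (N + 1)) ^ (2 * h) / real (N + 1))"
          using p01 y1 by (intro collisions_mean) (auto simp only: cU pN finite_atLeastAtMost_int)
        \<comment> \<open>The same extra element is absorbed by
          \<open>y N + p N \<le> 2 * y N\<close>, since \<open>p N < 1 \<le> y N\<close>; this is
          the power of 2 in \<open>C\<close>.\<close>
        also have "\<dots> \<le> real ((2 * h + 1) * (2 * h) ^ (2 * h)) * ((2 * y N) ^ (2 * h) / real N)"
          unfolding pN using p01 y1 elim by (intro mult_left_mono frac_le power_mono) auto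
        finally show ?thesis by (simp add: C_def power_mult_distrib)
      qed
      also have "C * (y N ^ (2 * h) / real N) / (\<epsilon> / 4 * y N ^ h) = C * (p N ^ h * real N ^ (h - 1)) / (\<epsilon> / 4)"
      proof -
        have "real N ^ h = real N * real N ^ (h - 1)" using h2 by (cases h) auto
        then have "y N ^ (2 * h) / real N = (p N ^ h * real N ^ (h - 1)) * y N ^ h"
          using elim by (simp add: y_def mult_2 power_add power_mult_distrib)
        then show ?thesis using y1 by simp
      qed
      finally show ?case using \<epsilon> y1 \<eta>(1) by (simp add: bound_def divide_right_mono)
    qed
  qed
  show "(\<lambda>N. subset_exp {0..int N} (p N) (\<lambda>S. of_bool (\<bar>real (card (form_values h u S)) - (1 / real \<theta>) * (real N * p N) ^ h\<bar> > \<epsilon> * (real N * p N) ^ h))) \<longlonglongrightarrow> 0"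
    by (rule tendsto_sandwich[OF _ le[unfolded y_def] tendsto_const lim])
       (use p in \<open>auto intro!: always_eventually subset_exp_nonneg simp: less_imp_le\<close>)
qed

end

lemma (in primitive_form) wt_conversions:
  "real m = real_of_int (abs_sum h u)" "real m = real_of_int (\<Sum>i=1..h. \<bar>u i\<bar>)"
  "(\<Prod>i\<in>I. real (wt i)) = real_of_int (\<Prod>i=1..h. \<bar>u i\<bar>)"
  "(\<Pi>\<^sub>E i\<in>I. {0..int (wt i) - 1}) = (\<Pi>\<^sub>E i\<in>{1..h}. {0..\<bar>u i\<bar> - 1})"
proof -
  have "int m = (\<Sum>i\<in>I. \<bar>u i\<bar>)" by (simp add: wts.W_def int_wt)
  also have "\<dots> = (\<Sum>i=1..h. \<bar>u i\<bar>)" by (simp only: I_def)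
  finally have "int m = (\<Sum>i=1..h. \<bar>u i\<bar>)" .
  then have "real m = real_of_int (\<Sum>i=1..h. \<bar>u i\<bar>)" by (metis of_int_of_nat_eq)
  then show "real m = real_of_int (\<Sum>i=1..h. \<bar>u i\<bar>)" "real m = real_of_int (abs_sum h u)"
    by (simp_all only: abs_sum_def)
  have "real (wt i) = real_of_int \<bar>u i\<bar>" for i by (metis int_wt of_int_of_nat_eq)
  then show "(\<Prod>i\<in>I. real (wt i)) = real_of_int (\<Prod>i=1..h. \<bar>u i\<bar>)" by (simp add: I_def)
  show "(\<Pi>\<^sub>E i\<in>I. {0..int (wt i) - 1}) = (\<Pi>\<^sub>E i\<in>{1..h}. {0..\<bar>u i\<bar> - 1})"
    by (simp only: int_wt I_def)
qed

theorem theorem1p1: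
  fixes h :: nat and u :: "nat \<Rightarrow> int" and p :: "nat \<Rightarrow> real"
  assumes "h \<ge> 2"
    and "\<forall>i\<in>{1..h}. u i \<noteq> 0"
    and "(GCD i\<in>{1..h}. u i) = 1"
    and "\<forall>N. p N \<in> {0<..<1}"
    and "p \<longlonglongrightarrow> 0"
    and "filterlim (\<lambda>N. real N * p N) at_top sequentially"
  shows
    "(p \<in> o(\<lambda>N. real N powr (- ((real h - 1) / real h))) \<longrightarrow>
        concentrates (\<lambda>N. random_subset N (p N))
          (\<lambda>N A. real (card (form_values h u A)))
          (\<lambda>N. (real N * p N) ^ h / real (form_symmetries h u)))
     \<and>
     (\<forall>c>0. (\<forall>\<^sub>F N in sequentially. p N = c * real N powr (- ((real h - 1) / real h))) \<longrightarrow>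
        concentrates (\<lambda>N. random_subset N (p N))
          (\<lambda>N A. real (card (form_values h u A)))
          (\<lambda>N. (real_of_int (\<Sum>i=1..h. \<bar>u i\<bar>) -
             2 * integral {0..real_of_int (abs_sum h u) / 2}
               (\<lambda>x. exp (- (c ^ h *
                  (\<Sum>t\<in>(\<Pi>\<^sub>E i\<in>{1..h}. {0..\<bar>u i\<bar> - 1}).
                     Irwin_Hall h (x - real_of_int (\<Sum>i=1..h. t i)))
                  / (real (form_symmetries h u) * real_of_int (\<Prod>i=1..h. \<bar>u i\<bar>)))))) * real N)
        \<and>
        concentrates (\<lambda>N. random_subset N (p N))
          (\<lambda>N A. real (card (missing_values h u N A)))
          (\<lambda>N. (2 * integral {0..real_of_int (abs_sum h u) / 2}
               (\<lambda>x. exp (- (c ^ h *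
                  (\<Sum>t\<in>(\<Pi>\<^sub>E i\<in>{1..h}. {0..\<bar>u i\<bar> - 1}).
                     Irwin_Hall h (x - real_of_int (\<Sum>i=1..h. t i)))
                  / (real (form_symmetries h u) * real_of_int (\<Prod>i=1..h. \<bar>u i\<bar>)))))) * real N))
     \<and>
     ((\<lambda>N. real N powr (- ((real h - 1) / real h))) \<in> o(p) \<longrightarrow>
        concentrates (\<lambda>N. random_subset N (p N))
          (\<lambda>N A. real (card (missing_values h u N A)))
          (\<lambda>N. 2 * Gamma (1 / (real h - 1)) *
             root (h - 1) (fact (h - 1) * real (form_symmetries h u) *
               real_of_int (\<Prod>i=1..h. \<bar>u i\<bar>))
             / ((real h - 1) * p N powr (real h / (real h - 1)))))"
proof -
  interpret primitive_form h u
    by unfold_locales (use assms(1-3) in auto)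
  have p: "\<And>N. 0 < p N \<and> p N < 1" using assms(4) by auto
  \<comment> \<open>The regimes are proved for the weights \<open>wt\<close> and the density
    \<open>wts.dens\<close>; this translates the exponent into the sum of shifted Irwin-Hall
    densities.\<close>
  have dens: "c ^ h * wts.dens x / real \<theta> =
      c ^ h * (\<Sum>t\<in>(\<Pi>\<^sub>E i\<in>{1..h}. {0..\<bar>u i\<bar> - 1}). Irwin_Hall h (x - real_of_int (\<Sum>i=1..h. t i)))
        / (real \<theta> * real_of_int (\<Prod>i=1..h. \<bar>u i\<bar>))" for c x
    unfolding wts.dens_Irwin_Hall wts_n wt_conversions by (simp add: I_def mult.commute)
  have supercritical_rate: "(2 * (Gamma (1 / real (h - 1)) *
        root (h - 1) (fact (h - 1) * real \<theta> * (\<Prod>i\<in>I. real (wt i))) / real (h - 1))) * p N powr (- (real h / (real h - 1)))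
     = 2 * Gamma (1 / (real h - 1)) * root (h - 1) (fact (h - 1) * real \<theta> * real_of_int (\<Prod>i=1..h. \<bar>u i\<bar>))
        / ((real h - 1) * p N powr (real h / (real h - 1)))" for N
    unfolding wt_conversions using h2 by (simp add: of_nat_diff powr_minus_divide)
  show ?thesis
  proof (intro conjI impI allI)
    assume "p \<in> o(\<lambda>N. real N powr (- ((real h - 1) / real h)))"
    from subcritical[OF p assms(6) this]
    show "concentrates (\<lambda>N. random_subset N (p N)) (\<lambda>N A. real (card (form_values h u A)))
        (\<lambda>N. (real N * p N) ^ h / real \<theta>)" by simp
  next
    fix c :: real
    assume "0 < c" "\<forall>\<^sub>F N in sequentially. p N = c * real N powr (- ((real h - 1) / real h))"
    note crit = critical[OF p assms(5,6) this, unfolded dens wt_conversions(1)]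
    show "concentrates (\<lambda>N. random_subset N (p N)) (\<lambda>N A. real (card (form_values h u A)))
          (\<lambda>N. (real_of_int (\<Sum>i=1..h. \<bar>u i\<bar>) -
             2 * integral {0..real_of_int (abs_sum h u) / 2}
               (\<lambda>x. exp (- (c ^ h *
                  (\<Sum>t\<in>(\<Pi>\<^sub>E i\<in>{1..h}. {0..\<bar>u i\<bar> - 1}).
                     Irwin_Hall h (x - real_of_int (\<Sum>i=1..h. t i)))
                  / (real \<theta> * real_of_int (\<Prod>i=1..h. \<bar>u i\<bar>)))))) * real N)"
      using crit(1) by (simp only: abs_sum_def)
    show "concentrates (\<lambda>N. random_subset N (p N)) (\<lambda>N A. real (card (missing_values h u N A)))
          (\<lambda>N. (2 * integral {0..real_of_int (abs_sum h u) / 2}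
               (\<lambda>x. exp (- (c ^ h *
                  (\<Sum>t\<in>(\<Pi>\<^sub>E i\<in>{1..h}. {0..\<bar>u i\<bar> - 1}).
                     Irwin_Hall h (x - real_of_int (\<Sum>i=1..h. t i)))
                  / (real \<theta> * real_of_int (\<Prod>i=1..h. \<bar>u i\<bar>)))))) * real N)"
      by (rule crit(2))
  next
    assume "(\<lambda>N. real N powr (- ((real h - 1) / real h))) \<in> o(p)"
    from supercritical[OF p assms(5,6) this]
    show "concentrates (\<lambda>N. random_subset N (p N)) (\<lambda>N A. real (card (missing_values h u N A)))
        (\<lambda>N. 2 * Gamma (1 / (real h - 1)) *
             root (h - 1) (fact (h - 1) * real \<theta> * real_of_int (\<Prod>i=1..h. \<bar>u i\<bar>))
             / ((real h - 1) * p N powr (real h / (real h - 1))))"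
      by (simp only: supercritical_rate)
  qed
qed

end
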